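(* Let $\Omega,\lambda>0$, and let $X=\{x_k:k\in\mathbb{Z}\}\subseteq\mathbb{R}$ be a uniformly separated set with lower Beurling density $$D^-(X)=\liminf_{r\to\infty}\inf_{t\in\mathbb{R}}\frac{\#(X\cap[t-r,t+r])}{2r}>\Omega.$$ Let $\mathcal{B}\subseteq PW_\Omega(\mathbb{R})$ be a bounded set. Then the restriction to $\mathcal{B}$ of the folded sampling operator $$\mathcal{M}_{\lambda,X}:PW_\Omega(\mathbb{R})\to\ell^2_\lambda(\mathbb{Z}),\qquad f\mapsto(\mathcal{M}_\lambda f(x_k))_{k\in\mathbb{Z}},$$ has a Lipschitz continuous left inverse on its range. That is, there exists a constant $C=C_{\mathcal{B},\lambda,X}>0$ such that $$\|f-g\|_{L^2(\mathbb{R})}\le C\,\|\mathcal{M}_{\lambda,X}f-\mathcal{M}_{\lambda,X}g\|_{\ell^2_\lambda(\mathbb{Z})},\qquad f,g\in\mathcal{B}.$$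
   Context: Fourier transform: $\hat f(\xi)=\int_{\mathbb{R}}f(t)e^{-2\pi i t\xi}\,dt$. The Paley-Wiener space is $PW_\Omega(\mathbb{R})=\{f\in L^2(\mathbb{R}):\hat f=0\text{ a.e. outside }[-\Omega/2,\Omega/2]\}$ with the $L^2(\mathbb{R})$-norm; its (complex-valued) elements are identified with their continuous representatives. $X=\{x_k:k\in\mathbb{Z}\}$ is an enumerated set (distinct indices give distinct points); it is uniformly separated if $\inf_{x,y\in X,\,x\neq y}|x-y|>0$. Folding: for real $x$, $\mathcal{M}_\lambda(x)$ is the unique number in $[-\lambda,\lambda)$ with $x-\mathcal{M}_\lambda(x)\in 2\lambda\mathbb{Z}$; for complex numbers, $\mathcal{M}_\lambda(x+iy)=\mathcal{M}_\lambda(x)+i\mathcal{M}_\lambda(y)$. Toral (semi-)metric: $|z-w|_\lambda=\inf_{n\in\mathbb{Z}+i\mathbb{Z}}|z-w-2\lambda n|$ for $z,w\in\mathbb{C}$. The space $\ell^2_\lambda(\mathbb{Z})=\{a\in\ell^2(\mathbb{Z}): a_k\in[-\lambda,\lambda)+i[-\lambda,\lambda)\ \forall k\}$ carries the distance $\|a-b\|_{\ell^2_\lambda(\mathbb{Z})}=\big(\sum_{k\in\mathbb{Z}}|a_k-b_k|_\lambda^2\big)^{1/2}$. *)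

theory Defs
  imports "HOL-Analysis.Analysis"
begin

definition square_integrable :: "(real \<Rightarrow> complex) \<Rightarrow> bool" where
  "square_integrable f \<longleftrightarrow>
     f \<in> borel_measurable lborel \<and> integrable lborel (\<lambda>t. (cmod (f t))\<^sup>2)"

definition L2_norm :: "(real \<Rightarrow> complex) \<Rightarrow> real" where
  "L2_norm f = sqrt (LINT t|lborel. (cmod (f t))\<^sup>2)"

definition fourier_integral :: "(real \<Rightarrow> complex) \<Rightarrow> real \<Rightarrow> complex" where
  "fourier_integral f \<xi> =
     (LINT t|lborel. f t * exp (- 2 * complex_of_real pi * \<i> * complex_of_real (t * \<xi>)))"

text \<open>
  For a general \<open>f\<close> in \<open>L\<^sup>2\<close> the Fourier integral need not converge absolutely. As usual, its
  transform is the \<open>L\<^sup>2\<close>-limit of the Fourier integrals of the truncations of \<open>f\<close> to \<open>[-n, n]\<close>,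
  and is determined only up to a null set; hence a relation. The extended nonnegative
  integral is used so that no convergence is implied by default values.
\<close>

definition L2_fourier :: "(real \<Rightarrow> complex) \<Rightarrow> (real \<Rightarrow> complex) \<Rightarrow> bool" where
  "L2_fourier f F \<longleftrightarrow>
     square_integrable f \<and> square_integrable F \<and>
     (\<lambda>n::nat. \<integral>\<^sup>+ \<xi>. ennreal ((cmod
         (fourier_integral (\<lambda>t. indicator {- real n..real n} t * f t) \<xi> - F \<xi>))\<^sup>2) \<partial>lborel)
       \<longlonglongrightarrow> 0"

text \<open>Elements are the continuous representatives, so equality in \<open>PW \<Omega>\<close> is equality of functions.\<close>

definition PW :: "real \<Rightarrow> (real \<Rightarrow> complex) set" where
  "PW \<Omega> = {f. continuous_on UNIV f \<and> square_integrable f \<and>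
     (\<exists>F. L2_fourier f F \<and> (AE \<xi> in lborel. \<xi> \<notin> {- \<Omega> / 2..\<Omega> / 2} \<longrightarrow> F \<xi> = 0))}"

definition uniformly_separated :: "real set \<Rightarrow> bool" where
  "uniformly_separated X \<longleftrightarrow> 0 < (INF x\<in>X. INF y\<in>X - {x}. ereal \<bar>x - y\<bar>)"

text \<open>
  Meant for sets meeting every bounded interval in finitely many points (such as uniformly
  separated sets), because \<^const>\<open>card\<close> is 0 on infinite sets.
\<close>

definition lower_Beurling_density :: "real set \<Rightarrow> ereal" where
  "lower_Beurling_density X =
     Liminf at_top (\<lambda>r::real. INF t::real. ereal (real (card (X \<inter> {t - r..t + r})) / (2 * r)))"

definition fold_real :: "real \<Rightarrow> real \<Rightarrow> real" where
  "fold_real lam x = (THE m. m \<in> {- lam..<lam} \<and> (\<exists>n::int. x - m = 2 * lam * of_int n))"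

definition fold_complex :: "real \<Rightarrow> complex \<Rightarrow> complex" where
  "fold_complex lam z = Complex (fold_real lam (Re z)) (fold_real lam (Im z))"

definition toral_dist :: "real \<Rightarrow> complex \<Rightarrow> complex \<Rightarrow> real" where
  "toral_dist lam z w =
     (INF (a, b)\<in>(UNIV :: (int \<times> int) set).
        cmod (z - w - 2 * complex_of_real lam * Complex (of_int a) (of_int b)))"

definition ell2_torus :: "real \<Rightarrow> (int \<Rightarrow> complex) set" where
  "ell2_torus lam = {a. (\<lambda>k. (cmod (a k))\<^sup>2) summable_on UNIV \<and>
     (\<forall>k. Re (a k) \<in> {- lam..<lam} \<and> Im (a k) \<in> {- lam..<lam})}"

definition ell2_torus_dist :: "real \<Rightarrow> (int \<Rightarrow> complex) \<Rightarrow> (int \<Rightarrow> complex) \<Rightarrow> real" where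
  "ell2_torus_dist lam a b = sqrt (\<Sum>\<^sub>\<infinity>k\<in>UNIV. (toral_dist lam (a k) (b k))\<^sup>2)"

definition folded_sampling ::
  "real \<Rightarrow> (int \<Rightarrow> real) \<Rightarrow> (real \<Rightarrow> complex) \<Rightarrow> int \<Rightarrow> complex" where
  "folded_sampling lam x f = (\<lambda>k. fold_complex lam (f (x k)))"

end

theory Submission
  imports
    Defs
    "HOL-Complex_Analysis.Complex_Analysis"
    "HOL-Probability.Probability"
    "HOL-Real_Asymp.Real_Asymp"
begin

text \<open>
  Put $h = f - g$. Where $|h(x_k)| < \lambda$ folding loses nothing: the toral distance of the
  folded samples is $|h(x_k)|$. Since $X$ is separated, $\sum_k |h(x_k)|^2 \le B \|h\|^2$
  (\<open>plancherel_polya_separated\<close>), so on a bounded set the number of exceptional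
  indices with $|h(x_k)| \ge \lambda$ is bounded by a number $N_0$ that depends on the bound
  only. It therefore suffices to have the sampling inequality $\|h\|^2 \le A \sum_{y \in Y}
  |h(y)|^2$ for every $Y$ obtained from $X$ by deleting at most $N_0$ points, with $A$
  independent of the points deleted. As $X$ has more than $\Omega T$ points (with room to
  spare) in all intervals of a large length $T$, deleting $N_0$ points still leaves $m >
  \Omega T$ points in each block $[Tj, T(j+1))$ (\<open>node_blocks_avoiding\<close>), and the
  constant of the sampling inequality for sets with $m$ selected points in each block depends
  only on $T$, $m$, the separation and the band.

  The sampling inequality is proved by interpolation. After rescaling, $T = 1$ and $h$ is
  entire with $|h(z)| \le H e^{\kappa |\mathrm{Im} z|}$, $\kappa < \pi m$. Let $P$ be the
  polynomial vanishing at the nodes of the blocks near a real point $x$. Lagrange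
  interpolation of $u(z) = h(z) e^{-\alpha z^2}$ at these nodes and the maximum principle for
  $(u - Lu)/P$ on a disc of radius $\rho$ bound $u(x)$ by the node values and by $|P(x)|
  \max_{|z| = \rho} |u(z)/P(z)|$. Comparing the nodes with the integers shows that $P$ is at
  least as large as the $m$-th power of a partial product of $\sin \pi z$, up to powers of
  $\rho$, so $|P(x)/P(z)| \le \mathrm{poly}(\rho) e^{-\pi m |\mathrm{Im} z|}$. The Gaussian
  with $\alpha = (\pi m - \kappa)/(2\rho)$ uses up the gap $\pi m - \kappa$ to gain a factor
  $e^{-c \rho}$, which beats the polynomial. Thus $|h(x)| \le C \sup |h| + H/2$, the supremum
  being over the nodes (\<open>local_interpolation_estimate\<close>). By Phragmen--Lindelof
  one may take $H = \sup_{\mathbb{R}} |h|$, and the second term is absorbed.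

  Applying this to $h(z)$ times a narrow-band $\mathrm{sinc}$ centred at $x$ gives $|h(x)|^2
  \le C \sum_y |h(y)|^2/(1 + (y-x)^2)$. Integration in $x$ is the sampling inequality. The
  same bound for the shifted lattices $T(\mathbb{Z} + s)$, averaged over $s$, gives $|h(x)|^2
  \le C \int |h(t)|^2/(1 + (t-x)^2) dt$ and hence the upper bound for separated sets. That
  functions in the Paley--Wiener space extend to entire functions of exponential type follows
  from an $L^2$ inversion formula obtained by Gaussian summation.
\<close>

section \<open>Entire functions of exponential type\<close>

definition exp_type_bound :: "real \<Rightarrow> real \<Rightarrow> (complex \<Rightarrow> complex) \<Rightarrow> bool" where
  "exp_type_bound \<kappa> A h \<longleftrightarrow> h holomorphic_on UNIV \<and> (\<forall>z. cmod (h z) \<le> A * exp (\<kappa> * \<bar>Im z\<bar>))"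

lemma holomorphic_factor_zeros:
  fixes g :: "complex \<Rightarrow> complex"
  assumes "finite A" "g holomorphic_on UNIV" "\<And>a. a \<in> A \<Longrightarrow> g a = 0"
  obtains v where "v holomorphic_on UNIV" "\<And>z. g z = (\<Prod>a\<in>A. z - a) * v z"
  using assms
proof (induction A arbitrary: thesis rule: finite_induct)
  case empty
  then show ?case by simp
next
  case (insert b A)
  obtain v where v: "v holomorphic_on UNIV" "\<And>z. g z = (\<Prod>a\<in>A. z - a) * v z"
    using insert.IH insert.prems by blast
  have "(\<Prod>a\<in>A. b - a) \<noteq> 0" using insert.hyps by auto
  then have "v b = 0" using v(2)[of b] insert.prems(3)[of b] by auto
  define w where "w = (\<lambda>z. if z = b then deriv v b else (v z - v b) / (z - b))"
  have "w holomorphic_on UNIV" unfolding w_def using pole_lemma_open[OF v(1)] by simp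
  moreover have "v z = (z - b) * w z" for z using \<open>v b = 0\<close> by (simp add: w_def)
  ultimately show ?case
    using insert.prems(1)[of w] v(2) insert.hyps by (simp add: mult_ac)
qed

text \<open>
  The remainder of Lagrange interpolation has the form $P v$ with $P(z) = \prod_a (z - a)$ and
  $v$ entire, and the maximum principle bounds $v(x)$ by the values of $(u - Lu)/P$ on the
  circle, where $Lu$ is the interpolant. The function $K$ bounds $|P(x)/P(z)|$ there. It
  enters pointwise in the term with $u$, where its decay away from the real axis has to
  compensate the growth of $u$, but only through $K_0$ in the term with $Lu$.
\<close>

lemma lagrange_disc_bound:
  fixes u :: "complex \<Rightarrow> complex" and A :: "complex set"
  assumes hol: "u holomorphic_on UNIV" and fin: "finite A"
    and sep: "\<And>a b. a \<in> A \<Longrightarrow> b \<in> A \<Longrightarrow> a \<noteq> b \<Longrightarrow> \<delta> \<le> dist a b" and "\<delta> > 0"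
    and node: "\<And>a. a \<in> A \<Longrightarrow> cmod (u a) \<le> s" and "0 \<le> s"
    and x: "cmod x \<le> \<rho>"
    and D: "\<And>a z. a \<in> A \<Longrightarrow> cmod z \<le> \<rho> \<Longrightarrow> cmod (z - a) \<le> D"
    and ratio: "\<And>z. cmod z = \<rho> \<Longrightarrow> cmod (\<Prod>a\<in>A. x - a) \<le> K z * cmod (\<Prod>a\<in>A. z - a)"
    and Ku: "\<And>z. cmod z = \<rho> \<Longrightarrow> K z * cmod (u z) \<le> \<epsilon>"
    and K: "\<And>z. cmod z = \<rho> \<Longrightarrow> 0 \<le> K z \<and> K z \<le> K0"
    and nz: "\<And>z. cmod z = \<rho> \<Longrightarrow> (\<Prod>a\<in>A. z - a) \<noteq> 0"
    and "\<rho> > 0"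
  shows "cmod (u x) \<le> \<epsilon> + (1 + K0) * (card A * (D/\<delta>) ^ (card A - 1)) * s"
proof -
  define M where "M = card A * (D/\<delta>) ^ (card A - 1)"
  define L where "L = (\<lambda>z. \<Sum>a\<in>A. u a * (\<Prod>b\<in>A-{a}. (z - b) / (a - b)))"
  define P where "P = (\<lambda>z. \<Prod>a\<in>A. z - a)"
  have Lb: "cmod (L z) \<le> M * s" if z: "cmod z \<le> \<rho>" for z
  proof -
    have "cmod (L z) \<le> (\<Sum>a\<in>A. cmod (u a) * (\<Prod>b\<in>A-{a}. cmod (z - b) / cmod (a - b)))"
      unfolding L_def by (rule order_trans[OF norm_sum]) (simp add: norm_mult prod_norm[symmetric] norm_divide)
    also have "\<dots> \<le> (\<Sum>a\<in>A. s * (D/\<delta>) ^ (card A - 1))"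
    proof (intro sum_mono mult_mono node)
      fix a assume a: "a \<in> A"
      have "(\<Prod>b\<in>A-{a}. cmod (z - b) / cmod (a - b)) \<le> (\<Prod>b\<in>A-{a}. D/\<delta>)"
      proof (intro prod_mono conjI)
        fix b assume b: "b \<in> A - {a}"
        have "\<delta> \<le> cmod (a - b)" using sep[of a b] a b by (auto simp: dist_norm)
        then show "cmod (z - b) / cmod (a - b) \<le> D/\<delta>"
          using D[of b z] z b \<open>\<delta>>0\<close> by (intro frac_le) (auto intro: order_trans[OF norm_ge_zero])
      qed simp
      then show "(\<Prod>b\<in>A-{a}. cmod (z - b) / cmod (a - b)) \<le> (D/\<delta>) ^ (card A - 1)"
        using a fin by simp
    qed (use \<open>0\<le>s\<close> in \<open>auto intro: prod_nonneg\<close>)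
    also have "\<dots> = M * s" by (simp add: M_def)
    finally show ?thesis .
  qed
  have Lnode: "L c = u c" if c: "c \<in> A" for c
  proof -
    have "(\<Prod>b\<in>A-{a}. (c - b) / (a - b)) = (if a = c then 1 else 0)" if "a \<in> A" for a
      using that c fin by (auto intro!: prod.neutral)
    then have "L c = (\<Sum>a\<in>A. if a = c then u c else 0)"
      unfolding L_def by (intro sum.cong) auto
    then show ?thesis using c fin by simp
  qed
  have "(\<lambda>z. u z - L z) holomorphic_on UNIV"
    unfolding L_def divide_inverse by (intro holomorphic_intros hol)
  moreover have "u a - L a = 0" if "a \<in> A" for a using Lnode[OF that] by simp
  ultimately obtain v where v: "v holomorphic_on UNIV" "\<And>z. u z - L z = P z * v z"
    unfolding P_def using holomorphic_factor_zeros[OF fin] by (metis (no_types, lifting))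
  have "cmod (P x * v x) \<le> \<epsilon> + K0 * (M * s)"
  proof (rule maximum_modulus_frontier[where f = "\<lambda>z. P x * v z" and S = "cball 0 \<rho>"])
    show "(\<lambda>z. P x * v z) holomorphic_on interior (cball 0 \<rho>)"
      using v(1) by (intro holomorphic_intros) (auto intro: holomorphic_on_subset)
    show "continuous_on (closure (cball 0 \<rho>)) (\<lambda>z. P x * v z)"
      using v(1) by (intro continuous_intros) (auto intro: holomorphic_on_imp_continuous_on holomorphic_on_subset)
    fix z :: complex assume "z \<in> frontier (cball 0 \<rho>)"
    then have z: "cmod z = \<rho>" using \<open>\<rho>>0\<close> by simp
    have "cmod (P x * v z) \<le> K z * cmod (P z) * cmod (v z)"
      using ratio[OF z] by (simp add: norm_mult P_def mult_right_mono)
    also have "\<dots> = K z * cmod (u z - L z)" by (simp add: v(2) norm_mult)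
    also have "\<dots> \<le> K z * cmod (u z) + K z * cmod (L z)"
      using norm_triangle_ineq4[of "u z" "L z"] K[OF z] by (metis distrib_left mult_left_mono)
    also have "\<dots> \<le> \<epsilon> + K0 * (M * s)"
      using Ku[OF z] K[OF z] Lb[of z] z by (intro add_mono mult_mono) auto
    finally show "cmod (P x * v z) \<le> \<epsilon> + K0 * (M * s)" .
  qed (use x in auto)
  moreover have "u x = P x * v x + L x" using v(2)[of x] by (simp add: algebra_simps)
  then have "cmod (u x) \<le> cmod (P x * v x) + cmod (L x)" by (simp add: norm_triangle_ineq)
  ultimately show ?thesis using Lb[OF x] unfolding M_def[symmetric] by (simp add: algebra_simps)
qed

text \<open>
  Multiplication by $e^{i \kappa z}$ makes $h$ bounded on the closed upper half-plane. The
  maximum principle on half-discs needs decay at infinity as well; dividing by $1 - i \epsilon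
  z$, which has modulus at least $1$ there, supplies it, and $\epsilon$ is sent to $0$ at the
  end.
\<close>

lemma phragmen_lindelof_upper:
  assumes hol: "h holomorphic_on UNIV"
    and A: "\<And>z. cmod (h z) \<le> A * exp (\<kappa> * \<bar>Im z\<bar>)"
    and S: "\<And>t::real. cmod (h (of_real t)) \<le> S" and S0: "S > 0" and z0: "Im z0 \<ge> 0"
  shows "cmod (h z0) \<le> S * exp (\<kappa> * Im z0)"
proof -
  have bd: "cmod (h z0) * exp (- \<kappa> * Im z0) \<le> S * (1 + \<epsilon> * cmod z0)" if e: "\<epsilon> > 0" for \<epsilon> :: real
  proof -
    define g where "g = (\<lambda>z. h z * exp (\<i> * \<kappa> * z) / (1 - \<i> * \<epsilon> * z))"
    \<comment> \<open>Beyond this radius the factor $1/(1 - i \epsilon z)$ pushes the bound $A$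
      below $S$.\<close>
    define \<rho> where "\<rho> = max (cmod z0) (\<bar>A\<bar> / (\<epsilon> * S)) + 1"
    define H where "H = {z. Im z \<ge> 0 \<and> cmod z \<le> \<rho>}"
    have rho: "\<rho> > 0" "cmod z0 < \<rho>" "\<bar>A\<bar> / (\<epsilon> * S) < \<rho>"
      unfolding \<rho>_def using norm_ge_zero[of z0] by linarith+
    have den: "1 \<le> cmod (1 - \<i> * \<epsilon> * z)" "\<epsilon> * cmod z \<le> cmod (1 - \<i> * \<epsilon> * z)" if "Im z \<ge> 0" for z
    proof -
      have "Re (1 - \<i> * \<epsilon> * z) = 1 + \<epsilon> * Im z" by simp
      moreover have "\<epsilon> * Im z \<ge> 0" using e that by simp
      ultimately have "1 \<le> \<bar>Re (1 - \<i> * \<epsilon> * z)\<bar>" by linarith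
      then show "1 \<le> cmod (1 - \<i> * \<epsilon> * z)" using abs_Re_le_cmod order_trans by blast
      have "(cmod (1 - \<i> * \<epsilon> * z))\<^sup>2 = (1 + \<epsilon> * Im z)\<^sup>2 + (\<epsilon> * Re z)\<^sup>2"
        by (simp add: cmod_power2)
      moreover have "(\<epsilon> * cmod z)\<^sup>2 = (\<epsilon> * Im z)\<^sup>2 + (\<epsilon> * Re z)\<^sup>2"
        by (simp add: power_mult_distrib cmod_power2 algebra_simps)
      moreover have "(\<epsilon> * Im z)\<^sup>2 \<le> (1 + \<epsilon> * Im z)\<^sup>2"
        using \<open>\<epsilon> * Im z \<ge> 0\<close> by (intro power_mono) auto
      ultimately have "(\<epsilon> * cmod z)\<^sup>2 \<le> (cmod (1 - \<i> * \<epsilon> * z))\<^sup>2" by linarith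
      then show "\<epsilon> * cmod z \<le> cmod (1 - \<i> * \<epsilon> * z)"
        using power2_le_imp_le[of "\<epsilon> * cmod z"] norm_ge_zero by blast
    qed
    have gb: "cmod (g z) = cmod (h z) * exp (- \<kappa> * Im z) / cmod (1 - \<i> * \<epsilon> * z)" for z
      unfolding g_def by (simp add: norm_mult norm_divide norm_exp_eq_Re)
    have nz: "1 - \<i> * \<epsilon> * z \<noteq> 0" if "Im z \<ge> 0" for z using den(1)[OF that] by auto
    have closedH: "closed H"
      unfolding H_def by (intro closed_Collect_conj closed_Collect_le continuous_intros)
    have "cmod (g z0) \<le> S"
    proof (rule maximum_modulus_frontier[where f = g and S = H])
      have gH: "g holomorphic_on H"
        unfolding g_def using nz by (intro holomorphic_intros holomorphic_on_subset[OF hol]) (auto simp: H_def)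
      then show "g holomorphic_on interior H" by (rule holomorphic_on_subset) (rule interior_subset)
      show "continuous_on (closure H) g"
        using gH closedH by (simp add: holomorphic_on_imp_continuous_on)
      show "bounded H" unfolding H_def bounded_iff by auto
      show "z0 \<in> H" using z0 rho by (simp add: H_def)
      fix z assume z: "z \<in> frontier H"
      then have zH: "z \<in> H" using closedH frontier_subset_closed by blast
      have op: "open {z. Im z > 0 \<and> cmod z < \<rho>}"
        by (intro open_Collect_conj open_Collect_less continuous_intros)
      have "{z. Im z > 0 \<and> cmod z < \<rho>} \<subseteq> interior H"
        by (rule interior_maximal[OF _ op]) (auto simp: H_def)
      moreover have "z \<notin> interior H" using z by (simp add: frontier_def)
      ultimately have "Im z = 0 \<or> cmod z = \<rho>" using zH by (force simp: H_def)
      then show "cmod (g z) \<le> S"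
      proof
        assume im: "Im z = 0"
        then have "cmod (h z) \<le> S" using S[of "Re z"] by (metis complex_eq_iff Im_complex_of_real Re_complex_of_real)
        then show ?thesis using den(1)[of z] im S0 order_trans[OF _ mult_left_mono[OF den(1)[of z], of S], of "cmod (h z)"]
          unfolding gb by (simp add: divide_le_eq)
      next
        assume r: "cmod z = \<rho>"
        have imz: "Im z \<ge> 0" using zH by (simp add: H_def)
        have "cmod (h z) * exp (- \<kappa> * Im z) \<le> A * exp (\<kappa> * Im z) * exp (- \<kappa> * Im z)"
          using A[of z] imz by (intro mult_right_mono) auto
        also have "\<dots> = A" by (simp add: mult.assoc flip: exp_add)
        also have "A \<le> S * (\<epsilon> * \<rho>)" using rho(3) e S0 by (simp add: divide_less_eq mult_ac)
        also have "\<dots> \<le> S * cmod (1 - \<i> * \<epsilon> * z)" using den(2)[OF imz] r S0 by simp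
        finally show ?thesis unfolding gb using den(1)[OF imz] S0 by (simp add: divide_le_eq)
      qed
    qed
    then have "cmod (h z0) * exp (- \<kappa> * Im z0) \<le> S * cmod (1 - \<i> * \<epsilon> * z0)"
      unfolding gb using den(1)[OF z0] nz[OF z0] S0 by (simp add: divide_le_eq split: if_splits)
    also have "cmod (1 - \<i> * \<epsilon> * z0) \<le> 1 + \<epsilon> * cmod z0"
      using norm_triangle_ineq4[of 1 "\<i> * \<epsilon> * z0"] e by (simp add: norm_mult)
    finally show ?thesis using S0 by simp
  qed
  have "cmod (h z0) * exp (- \<kappa> * Im z0) \<le> S"
  proof (rule field_le_epsilon)
    fix e :: real assume e: "e > 0"
    define \<epsilon> where "\<epsilon> = e / (S * (cmod z0 + 1))"
    have pos: "S * (cmod z0 + 1) > 0" using S0 by (simp add: add_nonneg_pos)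
    then have "\<epsilon> > 0" unfolding \<epsilon>_def using e by simp
    have "S * (\<epsilon> * cmod z0) \<le> S * (\<epsilon> * (cmod z0 + 1))" using \<open>\<epsilon>>0\<close> S0 by simp
    also have "\<dots> = \<epsilon> * (S * (cmod z0 + 1))" by (simp only: mult_ac)
    also have "\<dots> = e" unfolding \<epsilon>_def by (rule nonzero_divide_eq_eq[THEN iffD1, symmetric]) (use pos in auto)
    finally show "cmod (h z0) * exp (- \<kappa> * Im z0) \<le> S + e" using bd[OF \<open>\<epsilon>>0\<close>] by (simp add: algebra_simps)
  qed
  then show ?thesis by (simp add: exp_minus field_simps)
qed

lemma phragmen_lindelof:
  assumes h: "exp_type_bound \<kappa> A h" and S: "\<And>t::real. cmod (h (of_real t)) \<le> S" and S0: "S > 0"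
  shows "exp_type_bound \<kappa> S h"
  unfolding exp_type_bound_def
proof (intro conjI allI)
  have hol: "h holomorphic_on UNIV" and A: "\<And>z. cmod (h z) \<le> A * exp (\<kappa> * \<bar>Im z\<bar>)"
    using h by (auto simp: exp_type_bound_def)
  show "h holomorphic_on UNIV" by fact
  fix z
  show "cmod (h z) \<le> S * exp (\<kappa> * \<bar>Im z\<bar>)"
  proof (cases "Im z \<ge> 0")
    case True
    then show ?thesis using phragmen_lindelof_upper[OF hol A S S0] by simp
  next
    case False
    have "(\<lambda>z. h (- z)) holomorphic_on UNIV"
      using holomorphic_on_compose_gen[of uminus UNIV h UNIV] hol
        holomorphic_on_minus[OF holomorphic_on_ident] by (simp add: o_def)
    moreover have "cmod (h (- z)) \<le> A * exp (\<kappa> * \<bar>Im z\<bar>)" for z using A[of "-z"] by simp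
    moreover have "cmod (h (- of_real t)) \<le> S" for t :: real using S[of "-t"] by simp
    ultimately show ?thesis
      using phragmen_lindelof_upper[of "\<lambda>z. h (- z)" A \<kappa> S "- z"] S0 False by simp
  qed
qed

section \<open>Comparison of node polynomials with the sine\<close>

lemma cmod_sin_squared: "(cmod (sin z))\<^sup>2 = (sin (Re z))\<^sup>2 + (sinh (Im z))\<^sup>2"
proof -
  have "Re (sin z) = sin (Re z) * cosh (Im z)" "Im (sin z) = cos (Re z) * sinh (Im z)"
    by (simp_all add: Re_sin Im_sin cosh_def sinh_def field_simps)
  then have "(cmod (sin z))\<^sup>2 = (sin (Re z))\<^sup>2 * (cosh (Im z))\<^sup>2 + (cos (Re z))\<^sup>2 * (sinh (Im z))\<^sup>2"
    by (simp add: cmod_power2 power_mult_distrib)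
  also have "\<dots> = (sin (Re z))\<^sup>2 * ((sinh (Im z))\<^sup>2 + 1) + (1 - (sin (Re z))\<^sup>2) * (sinh (Im z))\<^sup>2"
    by (simp add: cosh_square_eq cos_squared_eq)
  also have "\<dots> = (sin (Re z))\<^sup>2 + (sinh (Im z))\<^sup>2" by (simp add: algebra_simps)
  finally show ?thesis .
qed

text \<open>
  The circle meets the real axis half-way between two integers. Near the axis the bound comes
  from the real part of the argument, further away from $\sinh$ of the imaginary part.
\<close>

lemma sin_lower_bound_circle:
  assumes z: "cmod z = real R + 1/2"
  shows "exp (pi * \<bar>Im z\<bar>) \<le> 8 * cmod (sin (of_real pi * z))"
proof (cases "\<bar>Im z\<bar> \<ge> 1/4")
  case True
  define t where "t = pi * \<bar>Im z\<bar>"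
  have t: "3/4 \<le> t" unfolding t_def using True pi_gt3 mult_mono[of 3 pi "1/4" "\<bar>Im z\<bar>"] by simp
  have "(sinh t)\<^sup>2 = (sinh (pi * Im z))\<^sup>2" unfolding t_def by (cases "Im z \<ge> 0") (auto simp: abs_if)
  also have "\<dots> \<le> (cmod (sin (of_real pi * z)))\<^sup>2" by (simp add: cmod_sin_squared)
  finally have 1: "sinh t \<le> cmod (sin (of_real pi * z))" using power2_le_imp_le by fastforce
  have "1 + 2 * t \<le> exp (2 * t)" by (rule exp_ge_add_one_self)
  then have "2 \<le> exp (2 * t)" using t by linarith
  then have "2 \<le> exp t * exp t" by (simp flip: exp_add)
  then have "2 * exp (- t) \<le> exp t * exp t * exp (-t)" by (intro mult_right_mono) auto
  also have "\<dots> = exp t" by (simp add: mult.assoc flip: exp_add)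
  finally have "2 * exp (- t) \<le> exp t" .
  moreover have "8 * sinh t = 4 * exp t - 4 * exp (- t)" by (simp add: sinh_def)
  ultimately have "exp t \<le> 8 * sinh t" using exp_gt_zero[of t] by linarith
  then show ?thesis using 1 unfolding t_def by linarith
next
  case False
  define a where "a = \<bar>Re z\<bar>"
  have "a\<^sup>2 + (Im z)\<^sup>2 = (real R + 1/2)\<^sup>2" unfolding a_def z[symmetric] by (simp add: cmod_power2)
  moreover have "(Im z)\<^sup>2 \<le> (1/4)\<^sup>2" using False by (intro power2_le_iff_abs_le[THEN iffD2]) auto
  ultimately have "(real R + 1/4)\<^sup>2 \<le> a\<^sup>2" by (simp add: power2_eq_square algebra_simps)
  then have a1: "real R + 1/4 \<le> a" using power2_le_imp_le[of _ a] by (simp add: a_def)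
  have a2: "a \<le> real R + 1/2" using abs_Re_le_cmod[of z] z by (simp add: a_def)
  define s where "s = a - real R"
  have s: "1/4 \<le> s" "s \<le> 1/2" using a1 a2 by (auto simp: s_def)
  have "sin (pi/6) \<le> sin (pi * s)" using s pi_gt_zero by (intro sin_monotone_2pi_le) (auto simp: field_simps)
  then have s2: "1/2 \<le> sin (pi * s)" by (simp add: sin_30)
  have "pi * a = pi * s + real R * pi" by (simp add: s_def algebra_simps)
  then have "\<bar>sin (pi * a)\<bar> = \<bar>sin (pi * s)\<bar>"
    by (simp only: sin_add) (simp add: abs_mult power_abs sin_npi cos_npi)
  then have "(1/2)\<^sup>2 \<le> (sin (pi * a))\<^sup>2" using s2 by (intro abs_le_square_iff[THEN iffD1]) auto
  also have "(sin (pi * a))\<^sup>2 = (sin (pi * Re z))\<^sup>2" unfolding a_def by (cases "Re z \<ge> 0") (auto simp: abs_if)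
  also have "\<dots> \<le> (cmod (sin (of_real pi * z)))\<^sup>2" by (simp add: cmod_sin_squared)
  finally have 1: "1/2 \<le> cmod (sin (of_real pi * z))" using power2_le_imp_le norm_ge_zero by blast
  have "pi * \<bar>Im z\<bar> \<le> 1" using False pi_less_4 mult_mono[of pi 4 "\<bar>Im z\<bar>" "1/4"] by simp
  then have "exp (pi * \<bar>Im z\<bar>) \<le> exp 1" by simp
  also have "\<dots> \<le> 4" using exp_le by simp
  finally show ?thesis using 1 by linarith
qed

text \<open>
  The omitted factors satisfy $|1 - z^2/k^2| \le e^{|z|^2/k^2}$ and $\sum_{k > N} 1/k^2 \le
  1/N$, so a partial product with $N \ge |z|^2$ factors loses at most a factor $e$.
\<close>

lemma sin_le_partial_product:
  assumes N: "(cmod z)\<^sup>2 \<le> real N" "N \<ge> 1"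
  shows "cmod (sin (of_real pi * z)) \<le> exp 1 * pi * cmod z * (\<Prod>k=1..N. cmod (1 - z\<^sup>2 / of_nat k ^ 2))"
proof (rule tendsto_upperbound[OF tendsto_norm[OF sin_product_formula_complex[of z]]])
  define q where "q = (\<lambda>k::nat. cmod (1 - z\<^sup>2 / of_nat k ^ 2))"
  have tail: "(\<Prod>k=1..n. q k) \<le> (\<Prod>k=1..N. q k) * exp ((cmod z)\<^sup>2 * (1/N - 1/n))" if "n \<ge> N" for n
    using that
  proof (induction n rule: dec_induct)
    case base then show ?case by simp
  next
    case (step n)
    have n0: "n \<ge> 1" using step N by linarith
    have "q (Suc n) \<le> 1 + (cmod z)\<^sup>2 / (real (Suc n))\<^sup>2"
      unfolding q_def using norm_triangle_ineq4[of 1 "z\<^sup>2 / of_nat (Suc n) ^ 2"]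
      by (simp add: norm_divide norm_power del: of_nat_Suc)
    also have "\<dots> \<le> exp ((cmod z)\<^sup>2 / (real (Suc n))\<^sup>2)" by (rule exp_ge_add_one_self)
    also have "\<dots> \<le> exp ((cmod z)\<^sup>2 * (1/n - 1/Suc n))"
    proof -
      have "1 / (real (Suc n))\<^sup>2 \<le> 1/n - 1/Suc n" using n0 by (simp add: divide_simps power2_eq_square)
      from mult_left_mono[OF this, of "(cmod z)\<^sup>2"] show ?thesis by simp
    qed
    finally have "(\<Prod>k=1..n. q k) * q (Suc n) \<le> ((\<Prod>k=1..N. q k) * exp ((cmod z)\<^sup>2 * (1/N - 1/n))) * exp ((cmod z)\<^sup>2 * (1/n - 1/Suc n))"
      using step.IH by (intro mult_mono) (auto simp: q_def intro!: prod_nonneg mult_nonneg_nonneg)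
    also have "\<dots> = (\<Prod>k=1..N. q k) * exp ((cmod z)\<^sup>2 * (1/N - 1/Suc n))"
      by (simp add: mult.assoc right_diff_distrib flip: exp_add)
    finally show ?case by (simp add: atLeastAtMostSuc_conv mult_ac del: of_nat_Suc)
  qed
  have "cmod (of_real pi * z * (\<Prod>k=1..n. 1 - z\<^sup>2 / of_nat k ^ 2)) \<le> exp 1 * pi * cmod z * (\<Prod>k=1..N. q k)"
    if "n \<ge> N" for n
  proof -
    have "(cmod z)\<^sup>2 * (1/N - 1/n) \<le> (cmod z)\<^sup>2 * (1/N)" by (intro mult_left_mono) auto
    also have "\<dots> \<le> 1" using N by simp
    finally have "exp ((cmod z)\<^sup>2 * (1/N - 1/n)) \<le> exp 1" by simp
    then have "(\<Prod>k=1..n. q k) \<le> (\<Prod>k=1..N. q k) * exp 1"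
      using tail[OF that] by (smt (verit, best) mult_left_mono norm_ge_zero prod_nonneg q_def)
    then have "pi * cmod z * (\<Prod>k=1..n. q k) \<le> pi * cmod z * ((\<Prod>k=1..N. q k) * exp 1)"
      by (intro mult_left_mono) auto
    then show ?thesis by (simp add: norm_mult prod_norm[symmetric] q_def mult_ac)
  qed
  then show "\<forall>\<^sub>F n in sequentially. cmod (of_real pi * z * (\<Prod>k=1..n. 1 - z\<^sup>2 / of_nat k ^ 2))
      \<le> exp 1 * pi * cmod z * (\<Prod>k=1..N. cmod (1 - z\<^sup>2 / of_nat k ^ 2))"
    unfolding q_def by (auto simp: eventually_at_top_linorder)
qed simp

lemma prod_int_symmetric:
  fixes f :: "int \<Rightarrow> 'a::comm_monoid_mult"
  shows "(\<Prod>k\<in>{-int N..int N}. f k) = f 0 * (\<Prod>k=1..N. f (int k) * f (- int k))"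
proof (induction N)
  case (Suc N)
  have "{-int (Suc N)..int (Suc N)} = insert (int (Suc N)) (insert (- int (Suc N)) {-int N..int N})" by auto
  then show ?case using Suc by (simp add: mult_ac atLeastAtMostSuc_conv)
qed auto

lemma integer_product_lower_bound:
  assumes N: "(cmod z)\<^sup>2 \<le> real N" "N \<ge> 1"
  shows "(fact N)\<^sup>2 * cmod (sin (of_real pi * z))
    \<le> exp 1 * pi * (cmod z + N) * (\<Prod>k\<in>{1 - int N..int N}. cmod (z - of_int k))"
proof -
  have "{-int N..int N} = insert (- int N) {1 - int N..int N}" using N by auto
  then have "cmod (z + of_nat N) * (\<Prod>k\<in>{1 - int N..int N}. cmod (z - of_int k)) = (\<Prod>k\<in>{-int N..int N}. cmod (z - of_int k))"
    by simp
  also have "\<dots> = cmod z * (\<Prod>k=1..N. cmod (z - of_nat k) * cmod (z + of_nat k))"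
    by (subst prod_int_symmetric) simp
  also have "(\<Prod>k=1..N. cmod (z - of_nat k) * cmod (z + of_nat k)) = (\<Prod>k=1..N. (real k)\<^sup>2 * cmod (1 - z\<^sup>2 / of_nat k ^ 2))"
  proof (intro prod.cong refl)
    fix k assume "k \<in> {1..N}"
    then have k: "(of_nat k :: complex) \<noteq> 0" by auto
    have "- ((z - of_nat k) * (z + of_nat k)) = of_nat k ^ 2 * (1 - z\<^sup>2 / of_nat k ^ 2)"
      using k by (simp add: field_simps power2_eq_square)
    from arg_cong[OF this, of cmod] show "cmod (z - of_nat k) * cmod (z + of_nat k) = (real k)\<^sup>2 * cmod (1 - z\<^sup>2 / of_nat k ^ 2)"
      by (simp only: norm_minus_cancel norm_mult norm_power norm_of_nat)
  qed
  also have "\<dots> = (fact N)\<^sup>2 * (\<Prod>k=1..N. cmod (1 - z\<^sup>2 / of_nat k ^ 2))"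
    by (simp add: prod.distrib fact_prod prod_power_distrib)
  finally have eq: "cmod (z + of_nat N) * (\<Prod>k\<in>{1 - int N..int N}. cmod (z - of_int k))
     = cmod z * ((fact N)\<^sup>2 * (\<Prod>k=1..N. cmod (1 - z\<^sup>2 / of_nat k ^ 2)))" .
  have "(fact N)\<^sup>2 * cmod (sin (of_real pi * z)) \<le> (fact N)\<^sup>2 * (exp 1 * pi * cmod z * (\<Prod>k=1..N. cmod (1 - z\<^sup>2 / of_nat k ^ 2)))"
    by (intro mult_left_mono sin_le_partial_product[OF N]) auto
  also have "\<dots> = exp 1 * pi * (cmod (z + of_nat N) * (\<Prod>k\<in>{1 - int N..int N}. cmod (z - of_int k)))"
    unfolding eq by (simp add: mult_ac)
  also have "\<dots> \<le> exp 1 * pi * ((cmod z + N) * (\<Prod>k\<in>{1 - int N..int N}. cmod (z - of_int k)))"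
    using norm_triangle_ineq[of z "of_nat N"] by (intro mult_left_mono mult_right_mono prod_nonneg) auto
  finally show ?thesis by (simp add: mult_ac)
qed

text \<open>
  Sets of uniform density $m/T$, presented as $m$ nodes in each interval of length $T$. The
  blocks carry no order of the nodes, and all estimates depend on the set through $T$, $m$ and
  $\delta$ only.
\<close>

definition node_blocks :: "real \<Rightarrow> nat \<Rightarrow> real \<Rightarrow> (int \<Rightarrow> real set) \<Rightarrow> bool" where
  "node_blocks T m \<delta> Y \<longleftrightarrow>
     (\<forall>j. Y j \<subseteq> {T * of_int j..<T * (of_int j + 1)} \<and> finite (Y j) \<and> card (Y j) = m) \<and>
     (\<forall>a\<in>\<Union>(range Y). \<forall>b\<in>\<Union>(range Y). a \<noteq> b \<longrightarrow> \<delta> \<le> \<bar>a - b\<bar>)"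

text \<open>
  The blocks used for the interpolation on the disc of radius $R + 1/2$. The two unit blocks
  that the circle crosses on the real axis are left out, so that no node is close to the
  circle. Blocks up to $(R+1)^2$, far outside the disc, are kept because a partial product of
  the sine with about $R^2$ factors already has, up to a constant, the full exponential growth
  of the sine on the circle.
\<close>

definition skip_blocks :: "nat \<Rightarrow> int set" where
  "skip_blocks R = {- int ((R+1)\<^sup>2)..int ((R+1)\<^sup>2)} - {int R, - int R - 1}"

lemma cmod_diff_real_mono:
  "\<bar>Re z - a\<bar> \<le> \<bar>Re z - b\<bar> \<Longrightarrow> cmod (z - of_real a) \<le> cmod (z - of_real b)"
  by (simp add: cmod_def abs_le_square_iff)

lemma node_product_upper:
  assumes Y: "node_blocks 1 m \<delta> Y" and x: "0 \<le> x" "x \<le> 1" and N: "N = (R+1)\<^sup>2"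
  shows "cmod (\<Prod>l\<in>skip_blocks R. \<Prod>y\<in>Y l. of_real x - of_real y) \<le> ((real N + 1)\<^sup>2 * (fact N)\<^sup>2) ^ m"
proof -
  have Yl: "Y l \<subseteq> {of_int l..<of_int l + 1}" "finite (Y l)" "card (Y l) = m" for l
    using Y by (auto simp: node_blocks_def)
  have "cmod (\<Prod>l\<in>skip_blocks R. \<Prod>y\<in>Y l. of_real x - of_real y) = (\<Prod>l\<in>skip_blocks R. \<Prod>y\<in>Y l. \<bar>x - y\<bar>)"
    by (simp flip: prod_norm of_real_diff)
  also have "\<dots> \<le> (\<Prod>l\<in>skip_blocks R. (of_int \<bar>l\<bar> + 1) ^ m)"
  proof (intro prod_mono conjI prod_nonneg)
    fix l assume "l \<in> skip_blocks R"
    have "(\<Prod>y\<in>Y l. \<bar>x - y\<bar>) \<le> (\<Prod>y\<in>Y l. of_int \<bar>l\<bar> + 1)"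
      using Yl(1)[of l] x by (intro prod_mono) force
    then show "(\<Prod>y\<in>Y l. \<bar>x - y\<bar>) \<le> (of_int \<bar>l\<bar> + 1) ^ m" using Yl(3) by simp
  qed auto
  also have "\<dots> \<le> (\<Prod>l\<in>{- int N..int N}. (of_int \<bar>l\<bar> + 1) ^ m)"
    unfolding skip_blocks_def N by (intro prod_mono2) auto
  also have "\<dots> = (\<Prod>k=1..N. (real k + 1) ^ m * (real k + 1) ^ m)" by (simp add: prod_int_symmetric)
  also have "\<dots> = ((\<Prod>k=1..N. real k + 1)\<^sup>2) ^ m"
    by (simp add: prod.distrib prod_power_distrib power2_eq_square power_mult_distrib)
  also have "(\<Prod>k=1..N. real k + 1) = (real N + 1) * fact N"
    by (induction N) (auto simp: algebra_simps)
  finally show ?thesis by (simp add: power_mult_distrib)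
qed

text \<open>
  In a block on the right of $\mathrm{Re} z$ every node is at least as far from $z$ as the
  left end of the block, and symmetrically on the left. Replacing the nodes by these end
  points exhausts the integers from $1 - N$ to $N$ once each, apart from the block containing
  $\mathrm{Re} z$; nodes of that block are at distance at least $1$ from $z$ because the
  blocks where the circle meets the axis are omitted. The omission costs a factor $(3 ho)^2$
  for each of the $m$ nodes of a block.
\<close>

lemma node_product_lower:
  assumes Y: "node_blocks 1 m \<delta> Y" and R: "R \<ge> 1" and N: "N = (R+1)\<^sup>2" and \<rho>: "\<rho> = real R + 1/2"
    and z: "cmod z = \<rho>"
  shows "((fact N)\<^sup>2 * cmod (sin (of_real pi * z))) ^ m
    \<le> (exp 1 * pi * (\<rho> + N) * (3 * \<rho>)\<^sup>2) ^ m * cmod (\<Prod>l\<in>skip_blocks R. \<Prod>y\<in>Y l. z - of_real y)"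
proof -
  have Yl: "Y l \<subseteq> {of_int l..<of_int l + 1}" "finite (Y l)" "card (Y l) = m" for l
    using Y by (auto simp: node_blocks_def)
  have NR: "R + 1 \<le> N" unfolding N by (simp add: power2_eq_square)
  have rho: "\<rho> \<ge> 3/2" using R \<rho> by simp
  have Rez: "\<bar>Re z\<bar> \<le> \<rho>" using abs_Re_le_cmod[of z] z by simp
  define c where "c = \<lceil>Re z\<rceil> - 1"
  have c: "of_int c < Re z" "Re z \<le> of_int c + 1" unfolding c_def by linarith+
  have cR: "- int R - 1 \<le> c" "c \<le> int R" using c Rez \<rho> by linarith+
  \<comment> \<open>$\mathrm{Re} z$ lies in $(c, c+1]$; blocks on the left of this interval are
    represented by their right end points, blocks on its right by their left end points.\<close>
  define \<sigma> where "\<sigma> = (\<lambda>l::int. if c < l then l else l + 1)"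
  define q where "q = (\<lambda>l. if l = c then 1 else cmod (z - of_int (\<sigma> l)))"
  define Q where "Q = (\<Prod>k\<in>{1 - int N..int N}. cmod (z - of_int k))"
  have "bij_betw \<sigma> ({- int N..int N} - {c}) {1 - int N..int N}"
    by (rule bij_betwI[where g = "\<lambda>k. if c < k - 1 \<or> c + 1 = k then k else k - 1"])
       (use cR NR in \<open>auto simp: \<sigma>_def split: if_splits\<close>)
  then have "Q = (\<Prod>l\<in>{- int N..int N} - {c}. cmod (z - of_int (\<sigma> l)))"
    unfolding Q_def using prod.reindex_bij_betw[of \<sigma> _ _ "\<lambda>k. cmod (z - of_int k)"] by metis
  also have "\<dots> = (\<Prod>l\<in>{- int N..int N} - {c}. q l)" by (intro prod.cong) (auto simp: q_def)
  also have "\<dots> = (\<Prod>l\<in>{- int N..int N}. q l)" by (intro prod.mono_neutral_left) (auto simp: q_def)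
  also have "\<dots> = (\<Prod>l\<in>skip_blocks R. q l) * (\<Prod>l\<in>{int R, - int R - 1}. q l)"
    unfolding skip_blocks_def N[symmetric] using NR by (intro prod.subset_diff) auto
  also have "\<dots> \<le> (\<Prod>l\<in>skip_blocks R. q l) * (3 * \<rho>)\<^sup>2"
  proof (intro mult_left_mono prod_nonneg)
    have qle: "q l \<le> 3 * \<rho>" if "l \<in> {int R, - int R - 1}" for l
    proof (cases "l = c")
      case False
      have "\<bar>\<sigma> l\<bar> \<le> int R + 1" using that by (auto simp: \<sigma>_def)
      then have "\<bar>of_int (\<sigma> l)\<bar> \<le> real R + 1" by linarith
      moreover have "cmod (z - of_int (\<sigma> l)) \<le> cmod z + \<bar>of_int (\<sigma> l)\<bar>"
        using norm_triangle_ineq4[of z "of_int (\<sigma> l)"] by simp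
      ultimately show ?thesis using False z \<rho> rho by (simp add: q_def)
    qed (use rho in \<open>simp add: q_def\<close>)
    have "(\<Prod>l\<in>{int R, - int R - 1}. q l) \<le> (\<Prod>l\<in>{int R, - int R - 1}. 3 * \<rho>)"
      by (intro prod_mono conjI qle) (auto simp: q_def)
    also have "\<dots> = (3 * \<rho>)\<^sup>2" by (simp add: power2_eq_square)
    finally show "(\<Prod>l\<in>{int R, - int R - 1}. q l) \<le> (3 * \<rho>)\<^sup>2" .
  qed (auto simp: q_def)
  finally have Q: "Q \<le> (3 * \<rho>)\<^sup>2 * (\<Prod>l\<in>skip_blocks R. q l)" by (simp add: mult_ac)
  have qy: "q l \<le> cmod (z - of_real y)" if l: "l \<in> skip_blocks R" and y: "y \<in> Y l" for l y
  proof -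
    have yl: "of_int l \<le> y" "y < of_int l + 1" using Yl(1)[of l] y by auto
    consider "l = c" | "c < l" | "l < c" by linarith
    then show ?thesis
    proof cases
      case 1
      have "c \<noteq> int R" "c \<noteq> - int R - 1" using l 1 by (auto simp: skip_blocks_def)
      then have "- int R \<le> c" "c + 1 \<le> int R" using cR by auto
      then have "\<bar>Re z\<bar> \<le> real R" using c by linarith
      then have "(Re z)\<^sup>2 \<le> (real R)\<^sup>2" by (metis abs_le_square_iff abs_of_nat)
      moreover have "(Re z)\<^sup>2 + (Im z)\<^sup>2 = (real R + 1/2)\<^sup>2" using z \<rho> by (metis cmod_power2)
      ultimately have "1\<^sup>2 \<le> (Im z)\<^sup>2" using R by (simp add: power2_eq_square algebra_simps)
      then have "1 \<le> \<bar>Im (z - of_real y)\<bar>" using abs_le_square_iff[of 1 "Im z"] by simp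
      then show ?thesis using abs_Im_le_cmod[of "z - of_real y"] 1 by (simp add: q_def)
    next
      case 2
      then have "Re z \<le> of_int l" using c by linarith
      then have "\<bar>Re z - of_int l\<bar> \<le> \<bar>Re z - y\<bar>" using yl by linarith
      from cmod_diff_real_mono[OF this] show ?thesis using 2 by (simp add: q_def \<sigma>_def)
    next
      case 3
      then have "of_int (l + 1) \<le> Re z" using c by linarith
      then have "\<bar>Re z - of_int (l + 1)\<bar> \<le> \<bar>Re z - y\<bar>" using yl by simp
      from cmod_diff_real_mono[OF this] show ?thesis using 3 by (simp add: q_def \<sigma>_def)
    qed
  qed
  have "(\<Prod>l\<in>skip_blocks R. q l) ^ m = (\<Prod>l\<in>skip_blocks R. \<Prod>y\<in>Y l. q l)"
    by (simp add: prod_power_distrib Yl)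
  also have "\<dots> \<le> (\<Prod>l\<in>skip_blocks R. \<Prod>y\<in>Y l. cmod (z - of_real y))"
    by (intro prod_mono conjI prod_nonneg qy) (auto simp: q_def)
  also have "\<dots> = cmod (\<Prod>l\<in>skip_blocks R. \<Prod>y\<in>Y l. z - of_real y)" by (simp add: prod_norm)
  finally have low: "(\<Prod>l\<in>skip_blocks R. q l) ^ m \<le> cmod (\<Prod>l\<in>skip_blocks R. \<Prod>y\<in>Y l. z - of_real y)" .
  have rN: "\<rho>\<^sup>2 \<le> real N"
  proof -
    have "\<rho>\<^sup>2 \<le> (real R + 1)\<^sup>2" unfolding \<rho> by (intro power_mono) auto
    then show ?thesis unfolding N by (simp add: add.commute)
  qed
  have "(fact N)\<^sup>2 * cmod (sin (of_real pi * z)) \<le> exp 1 * pi * (\<rho> + N) * Q"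
    using integer_product_lower_bound[of z N] rN z NR unfolding Q_def by simp
  also have "\<dots> \<le> exp 1 * pi * (\<rho> + N) * ((3 * \<rho>)\<^sup>2 * (\<Prod>l\<in>skip_blocks R. q l))"
    using Q rho by (intro mult_left_mono) auto
  finally have "((fact N)\<^sup>2 * cmod (sin (of_real pi * z))) ^ m \<le> (exp 1 * pi * (\<rho> + N) * (3 * \<rho>)\<^sup>2 * (\<Prod>l\<in>skip_blocks R. q l)) ^ m"
    by (intro power_mono) (auto simp: mult.assoc)
  also have "\<dots> = (exp 1 * pi * (\<rho> + N) * (3 * \<rho>)\<^sup>2) ^ m * (\<Prod>l\<in>skip_blocks R. q l) ^ m"
    by (simp only: power_mult_distrib)
  also have "\<dots> \<le> (exp 1 * pi * (\<rho> + N) * (3 * \<rho>)\<^sup>2) ^ m * cmod (\<Prod>l\<in>skip_blocks R. \<Prod>y\<in>Y l. z - of_real y)"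
    using rho by (intro mult_left_mono low) auto
  finally show ?thesis .
qed

section \<open>Sampling in the supremum norm\<close>

lemma exists_small_gaussian_factor:
  fixes \<tau> c :: real
  assumes "\<tau> > 0"
  obtains R :: nat where "R \<ge> 1" "c * (real R + 1) ^ k * exp (- \<tau> * (real R + 1/2) / 2) \<le> 1/2"
proof -
  have "filterlim (\<lambda>R::nat. (\<tau>/2) * (real R + 1)) at_top sequentially"
    using assms by real_asymp
  from filterlim_compose[OF tendsto_power_div_exp_0 this, of k]
  have "(\<lambda>R::nat. ((\<tau>/2) * (real R + 1)) ^ k / exp ((\<tau>/2) * (real R + 1))) \<longlonglongrightarrow> 0" .
  from tendsto_mult_left[OF this, of "c * exp (\<tau>/4) * (2/\<tau>) ^ k"]
  have "(\<lambda>R::nat. c * exp (\<tau>/4) * (2/\<tau>) ^ k * (((\<tau>/2) * (real R + 1)) ^ k / exp ((\<tau>/2) * (real R + 1)))) \<longlonglongrightarrow> 0"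
    by simp
  moreover have "c * exp (\<tau>/4) * (2/\<tau>) ^ k * (((\<tau>/2) * (real R + 1)) ^ k / exp ((\<tau>/2) * (real R + 1)))
     = c * (real R + 1) ^ k * exp (- \<tau> * (real R + 1/2) / 2)" for R :: nat
  proof -
    have e: "exp (\<tau>/4) / exp ((\<tau>/2) * (real R + 1)) = exp (- \<tau> * (real R + 1/2) / 2)"
      by (simp add: algebra_simps flip: exp_diff)
    have p: "(2/\<tau>) ^ k * ((\<tau>/2) * (real R + 1)) ^ k = (real R + 1) ^ k"
    proof -
      have "(2/\<tau>) * ((\<tau>/2) * (real R + 1)) = real R + 1" using assms by simp
      then show ?thesis by (simp only: power_mult_distrib[symmetric])
    qed
    show ?thesis unfolding e[symmetric] p[symmetric] by (simp add: mult_ac)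
  qed
  ultimately have "(\<lambda>R::nat. c * (real R + 1) ^ k * exp (- \<tau> * (real R + 1/2) / 2)) \<longlonglongrightarrow> 0" by simp
  then have "\<forall>\<^sub>F R::nat in sequentially. c * (real R + 1) ^ k * exp (- \<tau> * (real R + 1/2) / 2) < 1/2"
    by (rule order_tendstoD) simp
  then obtain R0 where "\<And>R::nat. R \<ge> R0 \<Longrightarrow> c * (real R + 1) ^ k * exp (- \<tau> * (real R + 1/2) / 2) < 1/2"
    by (auto simp: eventually_at_top_linorder)
  then show thesis using that[of "max 1 R0"] by (meson less_imp_le max.cobounded1 max.cobounded2)
qed

text \<open>
  The core of the sampling theorem. The constant $1/2$ in front of the growth constant $H$ is
  what allows this term to be absorbed later; it is reached by taking the radius of the disc
  large.
\<close>

lemma local_interpolation_estimate: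
  assumes \<delta>: "\<delta> > 0" and \<kappa>: "0 \<le> \<kappa>" "\<kappa> < pi * m"
  obtains C where "C \<ge> 0"
    "\<And>Y x h H s. node_blocks 1 m \<delta> Y \<Longrightarrow> exp_type_bound \<kappa> H h \<Longrightarrow> 0 \<le> s \<Longrightarrow>
       (\<And>y. y \<in> \<Union>(range Y) \<Longrightarrow> cmod (h (of_real y)) \<le> s) \<Longrightarrow> 0 \<le> x \<Longrightarrow> x \<le> 1 \<Longrightarrow>
       cmod (h (of_real x)) \<le> C * s + H / 2"
proof -
  define \<tau> where "\<tau> = pi * m - \<kappa>"
  have \<tau>: "\<tau> > 0" unfolding \<tau>_def using \<kappa> by simp
  obtain R :: nat where R: "R \<ge> 1"
    and small: "(exp \<tau> * (576 * exp 1 * pi) ^ m) * (real R + 1) ^ (8 * m) * exp (- \<tau> * (real R + 1/2) / 2) \<le> 1/2"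
    using exists_small_gaussian_factor[OF \<tau>] by metis
  define N where "N = (R+1)\<^sup>2"
  define \<rho> where "\<rho> = real R + 1/2"
  \<comment> \<open>On the circle $|e^{-\alpha z^2}| \le e^{-\tau \rho/2 + \tau |\mathrm{Im}
    z|}$: with this $\alpha$ the growth of the Gaussian is exactly the gap $\tau$ between
    $\kappa$ and $\pi m$.\<close>
  define \<alpha> where "\<alpha> = \<tau> / (2 * \<rho>)"
  define c where "c = (real N + 1)\<^sup>2 * (exp 1 * pi * (\<rho> + N) * (3 * \<rho>)\<^sup>2)"
  define K0 where "K0 = (8 * c) ^ m"
  define n where "n = m * card (skip_blocks R)"
  define C where "C = exp \<tau> * ((1 + K0) * (n * ((\<rho> + N + 1) / \<delta>) ^ (n - 1)))"
  have rho: "\<rho> \<ge> 3/2" using R unfolding \<rho>_def by simp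
  have c0: "c \<ge> 0" unfolding c_def using rho by simp
  have K00: "K0 \<ge> 0" unfolding K0_def using c0 by simp
  have \<alpha>: "0 < \<alpha>" "\<alpha> \<le> \<tau>" unfolding \<alpha>_def using \<tau> rho by (auto simp: field_simps)
  have cle: "c \<le> 72 * exp 1 * pi * (real R + 1) ^ 8"
  proof -
    define t where "t = real R + 1"
    have t: "t \<ge> 1" "real N = t\<^sup>2" "\<rho> \<le> t" unfolding t_def N_def \<rho>_def by auto
    have t2: "1 \<le> t\<^sup>2" "t \<le> t\<^sup>2" using t self_le_power[of t 2] by auto
    have "c \<le> (2 * t\<^sup>2)\<^sup>2 * (exp 1 * pi * (2 * t\<^sup>2) * (3 * t)\<^sup>2)"
      unfolding c_def using t t2 rho by (intro mult_mono power_mono order_refl) auto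
    also have "\<dots> = 72 * exp 1 * pi * t ^ 8" by (simp add: power_mult_distrib flip: power_add power_mult)
    finally show ?thesis unfolding t_def .
  qed
  have K0small: "exp \<tau> * (K0 * exp (- \<tau> * \<rho> / 2)) \<le> 1/2"
  proof -
    have "K0 \<le> ((576 * exp 1 * pi) * (real R + 1) ^ 8) ^ m"
      unfolding K0_def using cle c0 by (intro power_mono) (auto simp: mult_ac)
    also have "\<dots> = (576 * exp 1 * pi) ^ m * (real R + 1) ^ (8 * m)" by (simp add: power_mult_distrib power_mult)
    finally have "exp \<tau> * (K0 * exp (- \<tau> * \<rho> / 2)) \<le> exp \<tau> * (((576 * exp 1 * pi) ^ m * (real R + 1) ^ (8 * m)) * exp (- \<tau> * \<rho> / 2))"
      by (intro mult_left_mono mult_right_mono) auto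
    also have "\<dots> \<le> 1/2" using small unfolding \<rho>_def by (simp add: mult_ac)
    finally show ?thesis .
  qed
  show thesis
  proof (rule that[of C])
    show "C \<ge> 0" unfolding C_def using K00 rho \<delta> by simp
  next
    fix Y and h :: "complex \<Rightarrow> complex" and x H s :: real
    assume Y: "node_blocks 1 m \<delta> Y" and h: "exp_type_bound \<kappa> H h" and s: "0 \<le> s"
      and node: "\<And>y. y \<in> \<Union>(range Y) \<Longrightarrow> cmod (h (of_real y)) \<le> s" and x: "0 \<le> x" "x \<le> 1"
    have Yl: "Y l \<subseteq> {of_int l..<of_int l + 1}" "finite (Y l)" "card (Y l) = m" for l
      using Y by (auto simp: node_blocks_def)
    have sep: "\<delta> \<le> \<bar>a - b\<bar>" if "a \<in> \<Union>(range Y)" "b \<in> \<Union>(range Y)" "a \<noteq> b" for a b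
      using Y that by (auto simp: node_blocks_def)
    have hol: "h holomorphic_on UNIV" and hb: "cmod (h z) \<le> H * exp (\<kappa> * \<bar>Im z\<bar>)" for z
      using h by (auto simp: exp_type_bound_def)
    have H0: "H \<ge> 0" using order_trans[OF norm_ge_zero hb[of 0]] by simp
    define u where "u = (\<lambda>z::complex. h z * exp (- \<alpha> * z\<^sup>2))"
    define A where "A = (complex_of_real ` (\<Union>l\<in>skip_blocks R. Y l))"
    define K where "K = (\<lambda>z. K0 * exp (- pi * m * \<bar>Im z\<bar>))"
    have finS: "finite (skip_blocks R)" unfolding skip_blocks_def by simp
    have disj: "Y i \<inter> Y j = {}" if "i \<noteq> j" for i j
    proof -
      have "\<lfloor>y\<rfloor> = l" if "y \<in> Y l" for y l using Yl(1)[of l] that by (intro floor_unique) auto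
      then show ?thesis using that by blast
    qed
    have cardA: "card A = n"
    proof -
      have "card A = card (\<Union>l\<in>skip_blocks R. Y l)" unfolding A_def by (intro card_image) (auto simp: inj_on_def)
      also have "\<dots> = (\<Sum>l\<in>skip_blocks R. card (Y l))"
        using finS disj Yl by (intro card_UN_disjoint) auto
      finally show ?thesis by (simp add: Yl n_def mult.commute)
    qed
    have prodA: "(\<Prod>a\<in>A. z - a) = (\<Prod>l\<in>skip_blocks R. \<Prod>y\<in>Y l. z - of_real y)" for z
    proof -
      have "(\<Prod>a\<in>A. z - a) = (\<Prod>y\<in>(\<Union>l\<in>skip_blocks R. Y l). z - of_real y)"
        unfolding A_def by (subst prod.reindex) (auto simp: inj_on_def)
      also have "\<dots> = (\<Prod>l\<in>skip_blocks R. \<Prod>y\<in>Y l. z - of_real y)"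
        using finS disj Yl by (intro prod.UNION_disjoint) auto
      finally show ?thesis .
    qed
    have sinpos: "cmod (sin (of_real pi * z)) > 0" if "cmod z = \<rho>" for z
      using sin_lower_bound_circle[of z R] that unfolding \<rho>_def by (smt (verit) exp_gt_zero)
    have gauss: "cmod (exp (- \<alpha> * z\<^sup>2)) = exp (- \<alpha> * ((Re z)\<^sup>2 - (Im z)\<^sup>2))" for z :: complex
      by (simp add: norm_exp_eq_Re power2_eq_square)
    have "cmod (u (of_real x)) \<le> K0 * exp (- \<tau> * \<rho> / 2) * H + (1 + K0) * (card A * ((\<rho> + N + 1) / \<delta>) ^ (card A - 1)) * s"
    proof (rule lagrange_disc_bound[where u = u and A = A and x = "of_real x" and K = K and \<delta> = \<delta> and \<rho> = \<rho>])
      show "u holomorphic_on UNIV" unfolding u_def by (intro holomorphic_intros hol)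
      show "finite A" unfolding A_def using finS Yl by auto
      show "\<delta> \<le> dist a b" if ab: "a \<in> A" "b \<in> A" "a \<noteq> b" for a b
      proof -
        obtain a' b' where "a = of_real a'" "b = of_real b'" "a' \<in> \<Union>(range Y)" "b' \<in> \<Union>(range Y)"
          using ab(1,2) unfolding A_def by blast
        then show ?thesis using sep[of a' b'] ab(3) by (simp add: dist_of_real dist_real_def)
      qed
      show "\<delta> > 0" by fact
      show "cmod (u a) \<le> s" if a: "a \<in> A" for a
      proof -
        obtain y where y: "a = of_real y" "y \<in> \<Union>(range Y)" using a unfolding A_def by auto
        have "cmod (u a) = cmod (h a) * exp (- \<alpha> * y\<^sup>2)" unfolding u_def norm_mult gauss y by simp
        also have "\<dots> \<le> s * 1" using node[OF y(2)] s \<alpha> unfolding y(1) by (intro mult_mono) auto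
        finally show ?thesis by simp
      qed
      show "0 \<le> s" by fact
      show "cmod (of_real x) \<le> \<rho>" using x rho by simp
      show "cmod (z - a) \<le> \<rho> + N + 1" if a: "a \<in> A" and z: "cmod z \<le> \<rho>" for a z
      proof -
        obtain y l where y: "a = of_real y" "y \<in> Y l" "l \<in> skip_blocks R" using a unfolding A_def by auto
        have "\<bar>l\<bar> \<le> int N" using y(3) unfolding skip_blocks_def N_def by auto
        then have "\<bar>of_int l :: real\<bar> \<le> real N" by linarith
        then have "\<bar>y\<bar> \<le> N + 1" using Yl(1)[of l] y(2) by (auto simp: subset_iff)
        then show ?thesis using norm_triangle_ineq4[of z a] z y(1) by simp
      qed
      show "\<rho> > 0" using rho by simp
      fix z assume z: "cmod z = \<rho>"
      have low: "((fact N)\<^sup>2 * cmod (sin (of_real pi * z))) ^ m \<le> (exp 1 * pi * (\<rho> + N) * (3 * \<rho>)\<^sup>2) ^ m * cmod (\<Prod>a\<in>A. z - a)"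
        unfolding prodA by (rule node_product_lower[OF Y R N_def \<rho>_def z])
      show "(\<Prod>a\<in>A. z - a) \<noteq> 0"
      proof
        assume "(\<Prod>a\<in>A. z - a) = 0"
        then have "((fact N)\<^sup>2 * cmod (sin (of_real pi * z))) ^ m \<le> 0" using low by simp
        moreover have "((fact N)\<^sup>2 * cmod (sin (of_real pi * z))) ^ m > 0" using sinpos[OF z] by (intro zero_less_power mult_pos_pos) auto
        ultimately show False by simp
      qed
      show "cmod (\<Prod>a\<in>A. of_real x - a) \<le> K z * cmod (\<Prod>a\<in>A. z - a)"
      proof -
        define e where "e = exp (pi * \<bar>Im z\<bar>)"
        have e: "e > 0" "e \<le> 8 * cmod (sin (of_real pi * z))"
          unfolding e_def using sin_lower_bound_circle[of z R] z \<rho>_def by auto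
        have "cmod (\<Prod>a\<in>A. of_real x - a) * e ^ m \<le> ((real N + 1)\<^sup>2 * (fact N)\<^sup>2) ^ m * (8 * cmod (sin (of_real pi * z))) ^ m"
          unfolding prodA using e by (intro mult_mono node_product_upper[OF Y x N_def] power_mono) auto
        also have "\<dots> = (8 * (real N + 1)\<^sup>2) ^ m * ((fact N)\<^sup>2 * cmod (sin (of_real pi * z))) ^ m"
          by (simp add: power_mult_distrib mult_ac)
        also have "\<dots> \<le> (8 * (real N + 1)\<^sup>2) ^ m * ((exp 1 * pi * (\<rho> + N) * (3 * \<rho>)\<^sup>2) ^ m * cmod (\<Prod>a\<in>A. z - a))"
          by (intro mult_left_mono low) auto
        also have "\<dots> = K0 * cmod (\<Prod>a\<in>A. z - a)"
        proof -
          have "(8 * a) ^ m * (b ^ m * p) = (8 * (a * b)) ^ m * p" for a b p :: real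
            by (simp add: power_mult_distrib)
          then show ?thesis unfolding K0_def c_def .
        qed
        finally have "cmod (\<Prod>a\<in>A. of_real x - a) \<le> K0 / e ^ m * cmod (\<Prod>a\<in>A. z - a)"
          using e by (simp add: field_simps)
        moreover have "K z = K0 / e ^ m"
          unfolding K_def e_def by (simp add: exp_minus divide_inverse mult_ac flip: exp_of_nat_mult)
        ultimately show ?thesis by simp
      qed
      show "0 \<le> K z \<and> K z \<le> K0" unfolding K_def using K00 by (simp add: mult_left_le)
      show "K z * cmod (u z) \<le> K0 * exp (- \<tau> * \<rho> / 2) * H"
      proof -
        define b where "b = \<bar>Im z\<bar>"
        have b: "0 \<le> b" "b \<le> \<rho>" unfolding b_def using abs_Im_le_cmod[of z] z by auto
        have "(Re z)\<^sup>2 + b\<^sup>2 = \<rho>\<^sup>2" using z unfolding b_def by (metis cmod_power2 power2_abs)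
        then have "(Re z)\<^sup>2 - (Im z)\<^sup>2 = \<rho>\<^sup>2 - 2 * b\<^sup>2" unfolding b_def by simp
        then have "cmod (exp (- \<alpha> * z\<^sup>2)) = exp (- \<alpha> * (\<rho>\<^sup>2 - 2 * b\<^sup>2))" unfolding gauss by simp
        also have "\<dots> \<le> exp (- \<tau> * \<rho> / 2 + \<tau> * b)"
        proof -
          have "\<alpha> * b\<^sup>2 \<le> \<alpha> * (\<rho> * b)" using b \<alpha> by (intro mult_left_mono) (auto simp: power2_eq_square mult_right_mono)
          moreover have "\<alpha> * (\<rho> * b) = \<tau> * b / 2" "\<alpha> * \<rho>\<^sup>2 = \<tau> * \<rho> / 2"
            unfolding \<alpha>_def using rho by (auto simp: field_simps power2_eq_square)
          ultimately show ?thesis by (simp add: algebra_simps)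
        qed
        finally have "cmod (u z) \<le> (H * exp (\<kappa> * b)) * exp (- \<tau> * \<rho> / 2 + \<tau> * b)"
          unfolding u_def norm_mult using hb[of z] H0 unfolding b_def by (intro mult_mono) auto
        then have "K z * cmod (u z) \<le> K z * ((H * exp (\<kappa> * b)) * exp (- \<tau> * \<rho> / 2 + \<tau> * b))"
          by (rule mult_left_mono) (use K00 in \<open>simp add: K_def\<close>)
        also have "\<dots> = K0 * H * (exp (- pi * m * b) * exp (\<kappa> * b) * exp (- \<tau> * \<rho> / 2 + \<tau> * b))"
          unfolding K_def b_def by (simp add: mult_ac)
        also have "exp (- pi * m * b) * exp (\<kappa> * b) * exp (- \<tau> * \<rho> / 2 + \<tau> * b) = exp (- \<tau> * \<rho> / 2)"
          unfolding \<tau>_def by (simp add: algebra_simps flip: exp_add)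
        finally show ?thesis by (simp add: mult_ac)
      qed
    qed
    moreover have "cmod (h (of_real x)) \<le> exp \<tau> * cmod (u (of_real x))"
    proof -
      have "x\<^sup>2 \<le> 1" using x by (simp add: power_le_one)
      then have "\<alpha> * x\<^sup>2 \<le> \<tau> * 1" using \<alpha> by (intro mult_mono) auto
      then have "1 \<le> exp \<tau> * exp (- \<alpha> * x\<^sup>2)" by (simp flip: exp_add)
      then have "cmod (h (of_real x)) * 1 \<le> cmod (h (of_real x)) * (exp \<tau> * exp (- \<alpha> * x\<^sup>2))" by (intro mult_left_mono) auto
      then show ?thesis unfolding u_def norm_mult gauss by (simp add: mult_ac)
    qed
    ultimately have "cmod (h (of_real x)) \<le> exp \<tau> * (K0 * exp (- \<tau> * \<rho> / 2) * H + (1 + K0) * (n * ((\<rho> + N + 1) / \<delta>) ^ (n - 1)) * s)"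
      unfolding cardA by (meson exp_ge_zero mult_left_mono order_trans)
    also have "\<dots> = C * s + (exp \<tau> * (K0 * exp (- \<tau> * \<rho> / 2))) * H" unfolding C_def by (simp add: algebra_simps)
    also have "\<dots> \<le> C * s + (1/2) * H" using mult_right_mono[OF K0small H0] by simp
    finally show "cmod (h (of_real x)) \<le> C * s + H / 2" by simp
  qed
qed

lemma node_blocks_affine:
  assumes Y: "node_blocks T m \<delta> Y" and T: "T > 0"
  shows "node_blocks 1 m (\<delta> / T) (\<lambda>j. (\<lambda>y. y / T - of_int n) ` Y (j + n))"
  unfolding node_blocks_def
proof (intro conjI allI ballI impI)
  fix j
  have Yj: "Y (j + n) \<subseteq> {T * of_int (j + n)..<T * (of_int (j + n) + 1)}" "finite (Y (j + n))" "card (Y (j + n)) = m"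
    using Y unfolding node_blocks_def by blast+
  show "(\<lambda>y. y / T - of_int n) ` Y (j + n) \<subseteq> {1 * of_int j..<1 * (of_int j + 1)}"
    using Yj(1) T by (auto simp: field_simps subset_iff)
  show "finite ((\<lambda>y. y / T - of_int n) ` Y (j + n))" using Yj(2) by simp
  have "inj_on (\<lambda>y. y / T - of_int n) (Y (j + n))" using T by (auto simp: inj_on_def)
  then show "card ((\<lambda>y. y / T - of_int n) ` Y (j + n)) = m" using Yj(3) by (simp add: card_image)
next
  fix a b
  assume a: "a \<in> (\<Union>j. (\<lambda>y. y / T - of_int n) ` Y (j + n))"
    and b: "b \<in> (\<Union>j. (\<lambda>y. y / T - of_int n) ` Y (j + n))" and "a \<noteq> b"
  obtain a' where a': "a' \<in> \<Union>(range Y)" "a = a' / T - n" using a by blast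
  obtain b' where b': "b' \<in> \<Union>(range Y)" "b = b' / T - n" using b by blast
  have "a' \<noteq> b'" using a' b' \<open>a \<noteq> b\<close> by auto
  then have "\<delta> \<le> \<bar>a' - b'\<bar>" using Y a' b' by (auto simp: node_blocks_def)
  then have "\<delta> / T \<le> \<bar>a' - b'\<bar> / T" using T by (simp add: divide_right_mono)
  also have "\<dots> = \<bar>a - b\<bar>" using a' b' T by (simp flip: diff_divide_distrib)
  finally show "\<delta> / T \<le> \<bar>a - b\<bar>" .
qed

lemma exp_type_bound_affine:
  assumes "exp_type_bound \<kappa> A h" and "T > 0"
  shows "exp_type_bound (\<kappa> * T) A (\<lambda>z. h (of_real T * z + of_real c))"
  unfolding exp_type_bound_def
proof (intro conjI allI)
  have h: "h holomorphic_on UNIV" "\<And>z. cmod (h z) \<le> A * exp (\<kappa> * \<bar>Im z\<bar>)"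
    using assms by (auto simp: exp_type_bound_def)
  have "(\<lambda>z. of_real T * z + of_real c) holomorphic_on UNIV" by (intro holomorphic_intros)
  from holomorphic_on_compose_gen[OF this h(1)]
  show "(\<lambda>z. h (of_real T * z + of_real c)) holomorphic_on UNIV" by (simp add: o_def)
  fix z show "cmod (h (of_real T * z + of_real c)) \<le> A * exp (\<kappa> * T * \<bar>Im z\<bar>)"
    using h(2)[of "of_real T * z + of_real c"] \<open>T > 0\<close> by (simp add: abs_mult mult_ac)
qed

text \<open>
  With $S = \sup_{\mathbb{R}} |h|$, the Phragmen--Lindelof principle allows the growth
  constant $H = S + e$ for every $e > 0$, and the local estimate, translated to all unit
  intervals, gives $S \le C s + (S + e)/2$.
\<close>

lemma sup_norm_sampling_unit_blocks:
  assumes \<delta>: "\<delta> > 0" and \<kappa>: "0 \<le> \<kappa>" "\<kappa> < pi * m"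
  obtains C where "C \<ge> 0"
    "\<And>Y A h s x. node_blocks 1 m \<delta> Y \<Longrightarrow> exp_type_bound \<kappa> A h \<Longrightarrow> 0 \<le> s \<Longrightarrow>
       (\<And>y. y \<in> \<Union>(range Y) \<Longrightarrow> cmod (h (of_real y)) \<le> s) \<Longrightarrow> cmod (h (of_real x)) \<le> C * s"
proof -
  obtain C where C: "C \<ge> 0" and loc:
    "\<And>Y x h H s. node_blocks 1 m \<delta> Y \<Longrightarrow> exp_type_bound \<kappa> H h \<Longrightarrow> 0 \<le> s \<Longrightarrow>
       (\<And>y. y \<in> \<Union>(range Y) \<Longrightarrow> cmod (h (of_real y)) \<le> s) \<Longrightarrow> 0 \<le> x \<Longrightarrow> x \<le> 1 \<Longrightarrow>
       cmod (h (of_real x)) \<le> C * s + H / 2"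
    using local_interpolation_estimate[OF assms] by metis
  show thesis
  proof (rule that[of "2 * C"])
    fix Y and h :: "complex \<Rightarrow> complex" and A s x :: real
    assume Y: "node_blocks 1 m \<delta> Y" and h: "exp_type_bound \<kappa> A h" and s: "0 \<le> s"
      and node: "\<And>y. y \<in> \<Union>(range Y) \<Longrightarrow> cmod (h (of_real y)) \<le> s"
    have step: "cmod (h (of_real x)) \<le> C * s + H / 2" if H: "exp_type_bound \<kappa> H h" for H x
    proof -
      define n where "n = \<lfloor>x\<rfloor>"
      have "cmod (h (of_real 1 * of_real (x - n) + of_real n)) \<le> C * s + H / 2"
      proof (rule loc[where h = "\<lambda>z. h (of_real 1 * z + of_real n)" and x = "x - n", OF node_blocks_affine[OF Y zero_less_one, of n, simplified] _ s])
        show "exp_type_bound \<kappa> H (\<lambda>z. h (of_real 1 * z + of_real n))"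
          using exp_type_bound_affine[OF H, of 1 n] by simp
        show "cmod (h (of_real 1 * of_real y + of_real n)) \<le> s"
          if y: "y \<in> \<Union>(range (\<lambda>j. (\<lambda>y. y - of_int n) ` Y (j + n)))" for y
        proof -
          have "y + n \<in> \<Union>(range Y)" using y by auto
          from node[OF this] show ?thesis by simp
        qed
        show "0 \<le> x - n" "x - n \<le> 1" unfolding n_def by linarith+
      qed
      then show ?thesis by simp
    qed
    define S where "S = (SUP x. cmod (h (of_real x)))"
    have bdd: "bdd_above (range (\<lambda>x. cmod (h (of_real x))))"
      using h by (intro bdd_aboveI2[of _ _ A]) (auto simp: exp_type_bound_def dest!: spec[of _ "of_real _"])
    have le: "cmod (h (of_real x)) \<le> S" for x unfolding S_def by (rule cSUP_upper[OF _ bdd]) simp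
    have S0: "S \<ge> 0" using order_trans[OF norm_ge_zero le] .
    have "S \<le> 2 * C * s + e" if e: "e > 0" for e
    proof -
      have "exp_type_bound \<kappa> (S + e) h"
        by (rule phragmen_lindelof[OF h]) (use le S0 e in \<open>auto intro: add_increasing2\<close>)
      then have "S \<le> C * s + (S + e) / 2" unfolding S_def by (intro cSUP_least step) auto
      then have "S \<le> 2 * (C * s) + e" by argo
      then show ?thesis by (simp add: mult.assoc)
    qed
    then have "S \<le> 2 * C * s" by (rule field_le_epsilon)
    then show "cmod (h (of_real x)) \<le> 2 * C * s" using le order_trans by blast
  qed (use C in simp)
qed

definition csinc :: "complex \<Rightarrow> complex" where
  "csinc z = (if z = 0 then 1 else sin z / z)"

lemma csinc_holomorphic: "csinc holomorphic_on UNIV"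
proof -
  have "deriv sin (0::complex) = cos 0" by (rule DERIV_imp_deriv) (rule DERIV_sin)
  then have "csinc = (\<lambda>z. if z = 0 then deriv sin 0 else (sin z - sin 0) / (z - 0))"
    by (auto simp: csinc_def)
  then show ?thesis using pole_lemma_open[of sin UNIV 0] holomorphic_on_sin by simp
qed

lemma cmod_sin_le: "cmod (sin z) \<le> exp \<bar>Im z\<bar>"
proof -
  have "(sin (Re z))\<^sup>2 \<le> 1" by (simp add: abs_square_le_1)
  then have "(cmod (sin z))\<^sup>2 \<le> (cosh (Im z))\<^sup>2" by (simp add: cmod_sin_squared cosh_square_eq)
  then have "cmod (sin z) \<le> cosh (Im z)" by (rule power2_le_imp_le) simp
  also have "\<dots> \<le> exp \<bar>Im z\<bar>" by (cases "Im z \<ge> 0") (auto simp: cosh_def)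
  finally show ?thesis .
qed

lemma csinc_exp_type:
  obtains K where "exp_type_bound 1 K csinc"
proof -
  have "compact (csinc ` cball 0 1)"
    by (intro compact_continuous_image holomorphic_on_imp_continuous_on holomorphic_on_subset[OF csinc_holomorphic]) auto
  then obtain K where K: "\<And>z. cmod z \<le> 1 \<Longrightarrow> cmod (csinc z) \<le> K"
    by (force simp: bounded_iff dest!: compact_imp_bounded)
  have "cmod (csinc z) \<le> max 1 K * exp \<bar>Im z\<bar>" for z
  proof (cases "cmod z \<le> 1")
    case True
    then have "cmod (csinc z) \<le> max 1 K * 1" using K[OF True] by simp
    also have "\<dots> \<le> max 1 K * exp \<bar>Im z\<bar>" by (intro mult_left_mono) auto
    finally show ?thesis .
  next
    case False
    then have "cmod (csinc z) \<le> cmod (sin z)"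
      by (auto simp: csinc_def norm_divide divide_le_eq mult_le_cancel_left1)
    also have "\<dots> \<le> 1 * exp \<bar>Im z\<bar>" using cmod_sin_le by simp
    also have "\<dots> \<le> max 1 K * exp \<bar>Im z\<bar>" by (intro mult_right_mono) auto
    finally show ?thesis .
  qed
  then show thesis using that csinc_holomorphic by (auto simp: exp_type_bound_def)
qed

lemma csinc_real_decay: "(1 + t\<^sup>2) * (cmod (csinc (of_real t)))\<^sup>2 \<le> 2"
proof (cases "t = 0")
  case False
  have "(sin t)\<^sup>2 \<le> 1" by (simp add: abs_square_le_1)
  moreover have "(sin t)\<^sup>2 \<le> t\<^sup>2" using abs_sin_x_le_abs_x[of t] by (simp add: abs_le_square_iff)
  then have "(sin t)\<^sup>2 / t\<^sup>2 \<le> 1" using False by (simp add: divide_le_eq)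
  moreover have "(1 + t\<^sup>2) * (cmod (csinc (of_real t)))\<^sup>2 = (sin t)\<^sup>2 / t\<^sup>2 + (sin t)\<^sup>2"
    using False by (simp add: csinc_def norm_divide power_divide field_simps sin_of_real)
  ultimately show ?thesis by linarith
qed (simp add: csinc_def)

text \<open>
  The strict inequality $\kappa T < \pi m$ leaves room to multiply $E$ by a function of small
  exponential type $ au$ that is $1$ at $x$ and decays like $1/|y - x|$ on the real line,
  which localizes the supremum norm estimate at $x$.
\<close>

lemma weighted_pointwise_sampling:
  assumes T: "T > 0" and \<delta>: "\<delta> > 0" and \<kappa>: "0 \<le> \<kappa>" "\<kappa> * T < pi * m"
  obtains C where "C \<ge> 0"
    "\<And>Y A E s x. node_blocks T m \<delta> Y \<Longrightarrow> exp_type_bound \<kappa> A E \<Longrightarrow> 0 \<le> s \<Longrightarrow>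
       (\<And>y. y \<in> \<Union>(range Y) \<Longrightarrow> (cmod (E (of_real y)))\<^sup>2 \<le> s * (1 + (y - x)\<^sup>2)) \<Longrightarrow>
       (cmod (E (of_real x)))\<^sup>2 \<le> C * s"
proof -
  \<comment> \<open>Half of the available gap, so that the product still has type less than $\pi
    m/T$.\<close>
  define \<tau> where "\<tau> = (pi * m / T - \<kappa>) / 2"
  have \<tau>: "\<tau> > 0" "0 \<le> (\<kappa> + \<tau>) * T" "(\<kappa> + \<tau>) * T < pi * m"
    unfolding \<tau>_def using \<kappa> T by (auto simp: field_simps intro!: add_nonneg_nonneg)
  define c where "c = 2 * max 1 (1 / \<tau>\<^sup>2)"
  have c: "c \<ge> 0" unfolding c_def by simp
  obtain K where K: "exp_type_bound 1 K csinc" by (rule csinc_exp_type)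
  obtain C where C: "C \<ge> 0" and sup:
    "\<And>Y A h s x. node_blocks 1 m (\<delta> / T) Y \<Longrightarrow> exp_type_bound ((\<kappa> + \<tau>) * T) A h \<Longrightarrow> 0 \<le> s \<Longrightarrow>
       (\<And>y. y \<in> \<Union>(range Y) \<Longrightarrow> cmod (h (of_real y)) \<le> s) \<Longrightarrow> cmod (h (of_real x)) \<le> C * s"
    using sup_norm_sampling_unit_blocks[OF _ \<tau>(2,3), of "\<delta> / T"] \<delta> T by (metis divide_pos_pos)
  show thesis
  proof (rule that[of "C\<^sup>2 * c"])
    fix Y and E :: "complex \<Rightarrow> complex" and A s x :: real
    assume Y: "node_blocks T m \<delta> Y" and E: "exp_type_bound \<kappa> A E" and s: "0 \<le> s"
      and node: "\<And>y. y \<in> \<Union>(range Y) \<Longrightarrow> (cmod (E (of_real y)))\<^sup>2 \<le> s * (1 + (y - x)\<^sup>2)"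
    define g where "g = (\<lambda>z. E z * csinc (of_real \<tau> * z + of_real (- \<tau> * x)))"
    have g: "exp_type_bound (\<kappa> + \<tau>) (A * K) g"
    proof -
      have 1: "exp_type_bound \<tau> K (\<lambda>z. csinc (of_real \<tau> * z + of_real (- \<tau> * x)))"
        using exp_type_bound_affine[OF K \<tau>(1), of "- \<tau> * x"] by simp
      have "cmod (g z) \<le> (A * K) * exp ((\<kappa> + \<tau>) * \<bar>Im z\<bar>)" for z
      proof -
        have "cmod (g z) \<le> (A * exp (\<kappa> * \<bar>Im z\<bar>)) * (K * exp (\<tau> * \<bar>Im z\<bar>))"
          unfolding g_def norm_mult using E 1 unfolding exp_type_bound_def
          by (intro mult_mono) (auto intro: order_trans[OF norm_ge_zero])
        moreover have "exp ((\<kappa> + \<tau>) * \<bar>Im z\<bar>) = exp (\<kappa> * \<bar>Im z\<bar>) * exp (\<tau> * \<bar>Im z\<bar>)"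
          by (simp add: distrib_right exp_add)
        ultimately show ?thesis by (simp add: mult_ac)
      qed
      moreover have "g holomorphic_on UNIV"
        using E 1 unfolding g_def exp_type_bound_def by (intro holomorphic_intros) auto
      ultimately show ?thesis by (simp add: exp_type_bound_def)
    qed
    have gy: "cmod (g (of_real y)) \<le> sqrt (s * c)" if y: "y \<in> \<Union>(range Y)" for y
    proof -
      define q where "q = (cmod (csinc (of_real (\<tau> * (y - x)))))\<^sup>2"
      have q: "(1 + (\<tau> * (y - x))\<^sup>2) * q \<le> 2" unfolding q_def by (rule csinc_real_decay)
      have "1 + (y - x)\<^sup>2 \<le> max 1 (1 / \<tau>\<^sup>2) * (1 + (\<tau> * (y - x))\<^sup>2)"
      proof -
        have "(1 / \<tau>\<^sup>2) * (\<tau>\<^sup>2 * (y - x)\<^sup>2) \<le> max 1 (1 / \<tau>\<^sup>2) * (\<tau>\<^sup>2 * (y - x)\<^sup>2)" by (intro mult_right_mono) auto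
        then show ?thesis using \<tau>(1) by (simp add: power_mult_distrib distrib_left)
      qed
      then have "(1 + (y - x)\<^sup>2) * q \<le> (max 1 (1 / \<tau>\<^sup>2) * (1 + (\<tau> * (y - x))\<^sup>2)) * q"
        by (intro mult_right_mono) (auto simp: q_def)
      also have "\<dots> \<le> max 1 (1 / \<tau>\<^sup>2) * 2" unfolding mult.assoc by (intro mult_left_mono q) auto
      finally have qc: "(1 + (y - x)\<^sup>2) * q \<le> c" unfolding c_def by simp
      have "(cmod (g (of_real y)))\<^sup>2 = (cmod (E (of_real y)))\<^sup>2 * q"
        unfolding g_def q_def norm_mult power_mult_distrib
        by (simp add: algebra_simps)
      also have "\<dots> \<le> s * (1 + (y - x)\<^sup>2) * q" by (intro mult_right_mono node[OF y]) (auto simp: q_def)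
      also have "\<dots> \<le> s * c" unfolding mult.assoc by (intro mult_left_mono qc s)
      finally show ?thesis by (rule real_le_rsqrt)
    qed
    have "cmod (g (of_real T * of_real (x / T) + of_real 0)) \<le> C * sqrt (s * c)"
    proof (rule sup[where h = "\<lambda>z. g (of_real T * z + of_real 0)" and x = "x / T", OF node_blocks_affine[OF Y T, of 0, simplified] exp_type_bound_affine[OF g T]])
      fix y assume "y \<in> \<Union>(range (\<lambda>j. (\<lambda>y. y / T) ` Y j))"
      then have "T * y \<in> \<Union>(range Y)" using T by auto
      from gy[OF this] show "cmod (g (of_real T * of_real y + of_real 0)) \<le> sqrt (s * c)" by simp
    qed (use s c in simp)
    moreover have "of_real T * of_real (x / T) + of_real 0 = (of_real x :: complex)" using T by simp
    ultimately have "cmod (g (of_real x)) \<le> C * sqrt (s * c)" by simp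
    moreover have "g (of_real x) = E (of_real x)" by (simp add: g_def csinc_def)
    ultimately have "(cmod (E (of_real x)))\<^sup>2 \<le> (C * sqrt (s * c))\<^sup>2" by (intro power_mono) auto
    then show "(cmod (E (of_real x)))\<^sup>2 \<le> C\<^sup>2 * c * s" using s c by (simp add: power_mult_distrib mult_ac)
  qed (use c in simp)
qed

section \<open>Fourier inversion and entire extension\<close>

definition gauss_kernel :: "real \<Rightarrow> real \<Rightarrow> real" where
  "gauss_kernel n s = n * exp (- (2 * pi * n * s)\<^sup>2 / 2)"

text \<open>
  The Fourier transform of a Gaussian, read off from the characteristic function of the
  standard normal distribution.
\<close>

lemma gaussian_fourier:
  assumes n: "n > 0"
  shows "(LINT \<xi>|lborel. iexp (2 * pi * s * \<xi>) * of_real (std_normal_density (\<xi> / n))) = of_real (gauss_kernel n s)"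
proof -
  have "(LINT \<xi>|lborel. iexp (2 * pi * s * \<xi>) * of_real (std_normal_density (\<xi> / n)))
      = n *\<^sub>R (LINT u|lborel. iexp (2 * pi * s * (0 + n * u)) * of_real (std_normal_density ((0 + n * u) / n)))"
    using lborel_integral_real_affine[of n "\<lambda>\<xi>. iexp (2 * pi * s * \<xi>) * of_real (std_normal_density (\<xi> / n))" 0] n by simp
  also have "(LINT u|lborel. iexp (2 * pi * s * (0 + n * u)) * of_real (std_normal_density ((0 + n * u) / n)))
      = (LINT u|lborel. std_normal_density u *\<^sub>R iexp (2 * pi * n * s * u))"
    using n by (intro Bochner_Integration.integral_cong) (auto simp: scaleR_conv_of_real mult_ac)
  also have "\<dots> = char std_normal_distribution (2 * pi * n * s)"
    unfolding char_def by (subst integral_density) (auto simp: normal_density_nonneg)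
  also have "\<dots> = of_real (exp (- (2 * pi * n * s)\<^sup>2 / 2))" by (simp add: char_std_normal_distribution)
  finally show ?thesis by (simp add: gauss_kernel_def scaleR_conv_of_real)
qed

lemma std_normal_density_le: "0 \<le> std_normal_density u" "std_normal_density u \<le> 1"
proof -
  have "1 \<le> sqrt (2 * pi)" using pi_gt3 by simp
  then show "std_normal_density u \<le> 1" unfolding std_normal_density_def by (intro mult_le_one) (auto simp: divide_le_eq)
qed (simp add: normal_density_nonneg)

lemma integrable_gaussian_scaled:
  assumes "n > 0" shows "integrable lborel (\<lambda>\<xi>. std_normal_density (\<xi> / n))"
proof -
  have "integrable lborel (\<lambda>\<xi>. std_normal_density (0 + (1 / n) * \<xi>))"
    using assms by (intro lborel_integrable_real_affine integrable_normal_density) auto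
  then show ?thesis by simp
qed

lemma fourier_kernel_iexp:
  "exp (- 2 * complex_of_real pi * \<i> * complex_of_real (t * \<xi>)) = iexp (- 2 * pi * t * \<xi>)"
  by (simp add: mult_ac)

lemma fourier_integral_measurable [measurable]:
  assumes [measurable]: "g \<in> borel_measurable borel"
  shows "fourier_integral g \<in> borel_measurable borel"
  unfolding fourier_integral_def by measurable

lemma cmod_fourier_integral_le:
  "cmod (fourier_integral g \<xi>) \<le> (LINT t|lborel. cmod (g t))"
  unfolding fourier_integral_def fourier_kernel_iexp
  by (rule order_trans[OF integral_norm_bound]) (simp add: norm_mult)

lemma multiplication_formula_gaussian:
  assumes g: "integrable lborel g" and n: "n > 0"
  shows "(LINT \<xi>|lborel. fourier_integral g \<xi> * (iexp (2 * pi * x * \<xi>) * of_real (std_normal_density (\<xi> / n))))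
       = (LINT t|lborel. g t * of_real (gauss_kernel n (x - t)))"
proof -
  have [measurable]: "g \<in> borel_measurable borel" using g by auto
  define \<Phi> where "\<Phi> = (\<lambda>t \<xi>. (g t * iexp (- 2 * pi * t * \<xi>)) * (iexp (2 * pi * x * \<xi>) * of_real (std_normal_density (\<xi> / n))))"
  have [measurable]: "case_prod \<Phi> \<in> borel_measurable (lborel \<Otimes>\<^sub>M lborel)"
    unfolding \<Phi>_def by measurable
  have nrm: "cmod (\<Phi> t \<xi>) = cmod (g t) * std_normal_density (\<xi> / n)" for t \<xi>
    unfolding \<Phi>_def by (simp add: norm_mult std_normal_density_le)
  have "integrable (lborel \<Otimes>\<^sub>M lborel) (case_prod \<Phi>)"
  proof (rule lborel_pair.Fubini_integrable)
    show "integrable lborel (\<lambda>t. LINT \<xi>|lborel. cmod (case (t, \<xi>) of (t, \<xi>) \<Rightarrow> \<Phi> t \<xi>))"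
      using g by (simp add: nrm)
    show "AE t in lborel. integrable lborel (\<lambda>\<xi>. case (t, \<xi>) of (t, \<xi>) \<Rightarrow> \<Phi> t \<xi>)"
    proof (rule AE_I2)
      fix t
      have "integrable lborel (\<Phi> t)"
      proof (rule Bochner_Integration.integrable_bound)
        show "integrable lborel (\<lambda>\<xi>. cmod (g t) * std_normal_density (\<xi> / n))" using integrable_gaussian_scaled[OF n] by simp
        show "\<Phi> t \<in> borel_measurable lborel" unfolding \<Phi>_def by measurable
      qed (auto simp: nrm std_normal_density_le)
      then show "integrable lborel (\<lambda>\<xi>. case (t, \<xi>) of (t, \<xi>) \<Rightarrow> \<Phi> t \<xi>)" by simp
    qed
  qed measurable
  then have swap: "(LINT \<xi>|lborel. LINT t|lborel. \<Phi> t \<xi>) = (LINT t|lborel. LINT \<xi>|lborel. \<Phi> t \<xi>)"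
    by (rule lborel_pair.Fubini_integral)
  have "(LINT t|lborel. \<Phi> t \<xi>) = fourier_integral g \<xi> * (iexp (2 * pi * x * \<xi>) * of_real (std_normal_density (\<xi> / n)))" for \<xi>
    unfolding \<Phi>_def fourier_integral_def fourier_kernel_iexp by (rule integral_mult_left_zero)
  moreover have "(LINT \<xi>|lborel. \<Phi> t \<xi>) = g t * of_real (gauss_kernel n (x - t))" for t
  proof -
    have "\<Phi> t \<xi> = g t * (iexp (2 * pi * (x - t) * \<xi>) * of_real (std_normal_density (\<xi> / n)))" for \<xi>
      unfolding \<Phi>_def by (simp add: algebra_simps flip: exp_add)
    then show ?thesis using gaussian_fourier[OF n, of "x - t"] by simp
  qed
  ultimately show ?thesis using swap by simp
qed

text \<open>
  Away from its centre the kernel is dominated by an integrable function that tends to $0$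
  like $1/n$. This uniform decay replaces boundedness of the function in the approximate
  identity below.
\<close>

lemma gauss_kernel_le: "n \<ge> 1 \<Longrightarrow> \<bar>s\<bar> \<ge> 1 \<Longrightarrow> gauss_kernel n s \<le> (2 / (1 + s\<^sup>2)) / n"
proof -
  assume n: "n \<ge> 1" and s: "\<bar>s\<bar> \<ge> 1"
  have s2: "1 \<le> s\<^sup>2" using abs_le_square_iff[of 1 s] s by simp
  define a where "a = n\<^sup>2 * s\<^sup>2"
  have a: "a > 0" unfolding a_def using n s2 by (intro mult_pos_pos) auto
  have "a \<le> (2 * pi * n * s)\<^sup>2 / 2"
  proof -
    have "1\<^sup>2 \<le> pi\<^sup>2" using pi_gt3 by (intro power_mono) auto
    then have "1 * a \<le> 2 * pi\<^sup>2 * a" using a by (intro mult_right_mono) auto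
    then show ?thesis unfolding a_def by (simp add: power_mult_distrib)
  qed
  then have "exp (- (2 * pi * n * s)\<^sup>2 / 2) \<le> exp (- a)" by simp
  also have "\<dots> = 1 / exp a" by (simp add: exp_minus divide_inverse)
  also have "\<dots> \<le> 1 / a"
  proof (rule divide_left_mono)
    show "a \<le> exp a" using exp_ge_add_one_self[of a] by linarith
  qed (use a in auto)
  finally have "gauss_kernel n s \<le> n * (1 / a)" unfolding gauss_kernel_def using n by (intro mult_left_mono) auto
  also have "\<dots> = (1 / s\<^sup>2) / n" unfolding a_def using n by (simp add: power2_eq_square)
  also have "\<dots> \<le> (2 / (1 + s\<^sup>2)) / n"
    using s2 n by (intro divide_right_mono) (auto simp: divide_simps)
  finally show ?thesis .
qed

lemma integrable_inverse_square: "integrable lborel (\<lambda>t::real. 1 / (1 + t\<^sup>2))"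
  using integrable_inverse_1_plus_square by (simp add: set_integrable_def divide_inverse)

lemma integrable_mult_square_integrable:
  fixes k :: "real \<Rightarrow> real"
  assumes f: "square_integrable f" and k: "k \<in> borel_measurable borel" "integrable lborel (\<lambda>t. (k t)\<^sup>2)"
  shows "integrable lborel (\<lambda>t. f t * of_real (k t))"
proof (rule Bochner_Integration.integrable_bound)
  have [measurable]: "f \<in> borel_measurable borel" using f by (simp add: square_integrable_def)
  show "integrable lborel (\<lambda>t. (cmod (f t))\<^sup>2 + (k t)\<^sup>2)" using f k by (simp add: square_integrable_def)
  show "(\<lambda>t. f t * of_real (k t)) \<in> borel_measurable lborel" using k(1) by measurable
  have "cmod (f t) * \<bar>k t\<bar> \<le> (cmod (f t))\<^sup>2 + (k t)\<^sup>2" for t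
  proof -
    have "2 * (cmod (f t) * \<bar>k t\<bar>) \<le> (cmod (f t))\<^sup>2 + (k t)\<^sup>2"
      using sum_squares_bound[of "cmod (f t)" "\<bar>k t\<bar>"] by (simp add: mult.assoc)
    moreover have "0 \<le> cmod (f t) * \<bar>k t\<bar>" by simp
    ultimately show ?thesis by linarith
  qed
  then show "AE t in lborel. norm (f t * of_real (k t)) \<le> norm ((cmod (f t))\<^sup>2 + (k t)\<^sup>2)"
    by (simp add: norm_mult)
qed

lemma gauss_kernel_eq_normal: "gauss_kernel n s = n * sqrt (2 * pi) * std_normal_density (2 * pi * n * s)"
  by (simp add: gauss_kernel_def std_normal_density_def)

lemma square_integrable_gauss_kernel:
  assumes n: "n > 0"
  shows "integrable lborel (\<lambda>t. (gauss_kernel n (x - t))\<^sup>2)"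
proof (rule Bochner_Integration.integrable_bound)
  have "integrable lborel (\<lambda>t. std_normal_density (2 * pi * n * x + (- (2 * pi * n)) * t))"
    using n by (intro lborel_integrable_real_affine integrable_normal_density) auto
  then have "integrable lborel (\<lambda>t. std_normal_density (2 * pi * n * (x - t)))" by (simp add: algebra_simps)
  then show "integrable lborel (\<lambda>t. n * gauss_kernel n (x - t))"
    unfolding gauss_kernel_eq_normal by simp
  show "(\<lambda>t. (gauss_kernel n (x - t))\<^sup>2) \<in> borel_measurable lborel"
    unfolding gauss_kernel_def by measurable
  have "0 \<le> gauss_kernel n s" "gauss_kernel n s \<le> n" for s
    using n unfolding gauss_kernel_def by (auto simp: mult_le_cancel_left1)
  then show "AE t in lborel. norm ((gauss_kernel n (x - t))\<^sup>2) \<le> norm (n * gauss_kernel n (x - t))"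
    using n by (auto simp: power2_eq_square abs_mult intro!: mult_right_mono)
qed

lemma gaussian_normalization: "(LINT u|lborel. exp (- (2 * pi * u)\<^sup>2 / 2)) = std_normal_density 0"
proof -
  have "(LINT u|lborel. std_normal_density (0 + (2 * pi) * u)) = 1 / (2 * pi)"
    using lborel_integral_real_affine[of "2 * pi" std_normal_density 0] by (simp add: field_simps)
  then have "(LINT u|lborel. sqrt (2 * pi) * std_normal_density (2 * pi * u)) = sqrt (2 * pi) / (2 * pi)" by simp
  moreover have "sqrt (2 * pi) * std_normal_density (2 * pi * u) = exp (- (2 * pi * u)\<^sup>2 / 2)" for u
    by (simp add: std_normal_density_def)
  moreover have "sqrt w / w = 1 / sqrt w" if "w > 0" for w :: real
    using that by (simp add: divide_simps)
  then have "sqrt (2 * pi) / (2 * pi) = std_normal_density 0" by (simp only: std_normal_density_def) simp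
  ultimately show ?thesis by simp
qed

text \<open>
  A continuous square integrable function need not be bounded. Near $x$ it is, and dominated
  convergence applies after rescaling; the part at distance more than $1$ from $x$ is $O(1/n)$
  by the decay of the kernel.
\<close>

lemma gaussian_approximate_identity:
  assumes cont: "continuous_on UNIV f" and f: "square_integrable f"
  shows "(\<lambda>i. LINT t|lborel. f t * of_real (gauss_kernel (real (Suc i)) (x - t))) \<longlonglongrightarrow> f x * of_real (std_normal_density 0)"
proof -
  have [measurable]: "f \<in> borel_measurable borel" using cont by (rule borel_measurable_continuous_onI)
  have [measurable]: "gauss_kernel n \<in> borel_measurable borel" for n unfolding gauss_kernel_def by measurable
  define I where "I = {x - 1..x + 1}"
  define near where "near = (\<lambda>i. LINT t|lborel. indicator I t *\<^sub>R (f t * of_real (gauss_kernel (real (Suc i)) (x - t))))"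
  define far where "far = (\<lambda>i. LINT t|lborel. indicator (- I) t *\<^sub>R (f t * of_real (gauss_kernel (real (Suc i)) (x - t))))"
  have int: "integrable lborel (\<lambda>t. f t * of_real (gauss_kernel (real (Suc i)) (x - t)))" for i
    by (intro integrable_mult_square_integrable[OF f] square_integrable_gauss_kernel) auto
  have split: "(LINT t|lborel. f t * of_real (gauss_kernel (real (Suc i)) (x - t))) = near i + far i" for i
  proof -
    have "near i + far i = (LINT t|lborel. indicator I t *\<^sub>R (f t * of_real (gauss_kernel (real (Suc i)) (x - t)))
        + indicator (- I) t *\<^sub>R (f t * of_real (gauss_kernel (real (Suc i)) (x - t))))"
      unfolding near_def far_def I_def
      by (intro Bochner_Integration.integral_add[symmetric] integrable_mult_indicator int) auto
    also have "\<dots> = (LINT t|lborel. f t * of_real (gauss_kernel (real (Suc i)) (x - t)))"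
      by (intro Bochner_Integration.integral_cong) (auto simp: indicator_def)
    finally show ?thesis by simp
  qed
  have "near \<longlonglongrightarrow> f x * of_real (std_normal_density 0)"
  proof -
    have "bounded (f ` I)" unfolding I_def
      by (intro compact_imp_bounded compact_continuous_image continuous_on_subset[OF cont]) auto
    then obtain M where M: "\<And>t. t \<in> I \<Longrightarrow> cmod (f t) \<le> M" by (auto simp: bounded_iff)
    define q where "q = (\<lambda>u::real. exp (- (2 * pi * u)\<^sup>2 / 2))"
    have [measurable]: "q \<in> borel_measurable borel" unfolding q_def by measurable
    have qint: "integrable lborel q"
    \<comment> \<open>Non-integrable functions have integral $0$ by convention, whereas this
      integral is positive.\<close>
    proof (rule ccontr)
      assume "\<not> integrable lborel q"
      then have "(LINT u|lborel. q u) = 0" by (rule not_integrable_integral_eq)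
      then show False using gaussian_normalization unfolding q_def by (simp add: std_normal_density_def)
    qed
    define h where "h = (\<lambda>i u. indicator I (x + (1 / real (Suc i)) * u) *\<^sub>R (f (x + (1 / real (Suc i)) * u) * of_real (q u)))"
    have "near i = (LINT u|lborel. h i u)" for i
    proof -
      define n where "n = real (Suc i)"
      have n: "n > 0" by (simp add: n_def)
      have gk: "gauss_kernel n (x - (x + (1 / n) * u)) = n * q u" for u
        unfolding gauss_kernel_def q_def using n by (simp add: power_mult_distrib)
      have "near i = (1 / n) *\<^sub>R (LINT u|lborel. indicator I (x + (1 / n) * u) *\<^sub>R (f (x + (1 / n) * u) * of_real (gauss_kernel n (x - (x + (1 / n) * u)))))"
        unfolding near_def n_def[symmetric]
        using lborel_integral_real_affine[of "1 / n" "\<lambda>t. indicator I t *\<^sub>R (f t * of_real (gauss_kernel n (x - t)))" x] n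
        by simp
      also have "\<dots> = (LINT u|lborel. (1 / n) *\<^sub>R (indicator I (x + (1 / n) * u) *\<^sub>R (f (x + (1 / n) * u) * of_real (n * q u))))"
        unfolding gk by (rule integral_scaleR_right[symmetric])
      also have "\<dots> = (LINT u|lborel. h i u)"
        unfolding h_def n_def[symmetric] using n
        by (intro Bochner_Integration.integral_cong) (auto simp: scaleR_conv_of_real)
      finally show ?thesis .
    qed
    then have "near = (\<lambda>i. LINT u|lborel. h i u)" by (rule ext)
    moreover have "(\<lambda>i. LINT u|lborel. h i u) \<longlonglongrightarrow> (LINT u|lborel. f x * of_real (q u))"
    proof (rule integral_dominated_convergence)
      show "integrable lborel (\<lambda>u. M * q u)" using qint by simp
      have "M \<ge> 0" using order_trans[OF norm_ge_zero M[of x]] by (simp add: I_def)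
      then have "norm (h i u) \<le> M * q u" for i u
        using M[of "x + (1 / real (Suc i)) * u"]
        by (cases "x + (1 / real (Suc i)) * u \<in> I") (auto simp: h_def norm_mult q_def intro!: mult_right_mono)
      then show "AE u in lborel. norm (h i u) \<le> M * q u" for i by simp
      show "AE u in lborel. (\<lambda>i. h i u) \<longlonglongrightarrow> f x * of_real (q u)"
      proof (rule AE_I2)
        fix u
        have l: "(\<lambda>i. x + (1 / real (Suc i)) * u) \<longlonglongrightarrow> x" by real_asymp
        have "isCont f x" using cont by (simp add: continuous_on_eq_continuous_at)
        then have 1: "(\<lambda>i. f (x + (1 / real (Suc i)) * u) * of_real (q u)) \<longlonglongrightarrow> f x * of_real (q u)"
          by (intro tendsto_mult isCont_tendsto_compose[OF _ l]) auto
        have "\<forall>\<^sub>F i in sequentially. x + (1 / real (Suc i)) * u \<in> {x - 1<..<x + 1}"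
          by (rule topological_tendstoD[OF l]) auto
        then have "\<forall>\<^sub>F i in sequentially. f (x + (1 / real (Suc i)) * u) * of_real (q u) = h i u"
          by eventually_elim (auto simp: h_def I_def)
        with 1 show "(\<lambda>i. h i u) \<longlonglongrightarrow> f x * of_real (q u)" by (rule Lim_transform_eventually)
      qed
      show "h i \<in> borel_measurable lborel" for i unfolding h_def I_def by measurable
    qed simp
    moreover have "(LINT u|lborel. f x * of_real (q u)) = f x * of_real (std_normal_density 0)"
      using gaussian_normalization unfolding q_def by simp
    ultimately show ?thesis by (simp only:)
  qed
  moreover have "far \<longlonglongrightarrow> 0"
  proof -
    define k where "k = (\<lambda>t. 2 / (1 + (x - t)\<^sup>2))"
    have k2: "integrable lborel (\<lambda>t. (k t)\<^sup>2)"
    proof (rule Bochner_Integration.integrable_bound)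
      have "integrable lborel (\<lambda>t. 1 / (1 + (x + (-1) * t)\<^sup>2))"
        by (intro lborel_integrable_real_affine[OF integrable_inverse_square]) auto
      then have "integrable lborel (\<lambda>t. 1 / (1 + (x - t)\<^sup>2))" by simp
      then show "integrable lborel (\<lambda>t. 4 * (1 / (1 + (x - t)\<^sup>2)))" by (rule integrable_mult_right)
      show "AE t in lborel. norm ((k t)\<^sup>2) \<le> norm (4 * (1 / (1 + (x - t)\<^sup>2)))"
      proof (rule AE_I2)
        fix t :: real
        define w where "w = 1 + (x - t)\<^sup>2"
        have "w \<ge> 1" by (simp add: w_def)
        then have "4 / (w * w) \<le> 4 / w" by (intro divide_left_mono) auto
        then show "norm ((k t)\<^sup>2) \<le> norm (4 * (1 / (1 + (x - t)\<^sup>2)))"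
          using \<open>w \<ge> 1\<close> unfolding k_def w_def[symmetric] by (simp add: power2_eq_square abs_mult)
      qed
      show "(\<lambda>t. (k t)\<^sup>2) \<in> borel_measurable lborel" unfolding k_def by measurable
    qed
    have km: "k \<in> borel_measurable borel" unfolding k_def by measurable
    have fk: "integrable lborel (\<lambda>t. f t * of_real (k t))" by (rule integrable_mult_square_integrable[OF f km k2])
    define J where "J = (LINT t|lborel. cmod (f t * of_real (k t)))"
    have "cmod (far i) \<le> J / real (Suc i)" for i
    proof -
      have "cmod (far i) \<le> (LINT t|lborel. cmod (indicator (- I) t *\<^sub>R (f t * of_real (gauss_kernel (real (Suc i)) (x - t)))))"
        unfolding far_def by (rule integral_norm_bound)
      also have "\<dots> \<le> (LINT t|lborel. cmod (f t * of_real (k t)) / real (Suc i))"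
      proof (intro integral_mono)
        show "integrable lborel (\<lambda>t. cmod (indicator (- I) t *\<^sub>R (f t * of_real (gauss_kernel (real (Suc i)) (x - t)))))"
          unfolding I_def by (intro integrable_norm integrable_mult_indicator int) auto
        show "integrable lborel (\<lambda>t. cmod (f t * of_real (k t)) / real (Suc i))"
          using integrable_norm[OF fk] by simp
        fix t
        have k0: "k t \<ge> 0" by (simp add: k_def)
        have g0: "gauss_kernel (real (Suc i)) (x - t) \<ge> 0" by (simp add: gauss_kernel_def)
        show "cmod (indicator (- I) t *\<^sub>R (f t * of_real (gauss_kernel (real (Suc i)) (x - t)))) \<le> cmod (f t * of_real (k t)) / real (Suc i)"
        proof (cases "t \<in> I")
          case False
          then have "\<bar>x - t\<bar> \<ge> 1" by (auto simp: I_def)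
          then have "gauss_kernel (real (Suc i)) (x - t) \<le> k t / real (Suc i)"
            using gauss_kernel_le[of "real (Suc i)" "x - t"] unfolding k_def by simp
          then have "cmod (f t) * gauss_kernel (real (Suc i)) (x - t) \<le> cmod (f t) * (k t / real (Suc i))"
            by (rule mult_left_mono) simp
          then show ?thesis using False k0 g0 by (simp add: norm_mult del: of_nat_Suc)
        qed (simp add: k0)
      qed
      finally show ?thesis unfolding J_def by (simp del: of_nat_Suc)
    qed
    moreover have "(\<lambda>i. J / real (Suc i)) \<longlonglongrightarrow> 0" by real_asymp
    ultimately show ?thesis by (intro Lim_null_comparison[of far]) auto
  qed
  ultimately have "(\<lambda>i. near i + far i) \<longlonglongrightarrow> f x * of_real (std_normal_density 0) + 0" by (rule tendsto_add)
  then show ?thesis by (simp only: split add_0_right)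
qed

text \<open>
  The multiplication formula with a Gaussian multiplier is applied to the truncations of $f$;
  letting first the truncation and then the width of the Gaussian tend to infinity gives the
  inversion formula. The support condition makes $F$ integrable, so that the right-hand side
  converges absolutely.
\<close>

lemma L2_fourier_inversion:
  assumes cont: "continuous_on UNIV f" and ft: "L2_fourier f F"
    and supp: "AE \<xi> in lborel. \<xi> \<notin> {- b..b} \<longrightarrow> F \<xi> = 0"
  shows "integrable lborel (\<lambda>\<xi>. F \<xi> * of_real (indicator {- b..b} \<xi>))" (is ?A)
    and "f x = (LINT \<xi>|lborel. F \<xi> * of_real (indicator {- b..b} \<xi>) * iexp (2 * pi * x * \<xi>))" (is ?B)
proof -
  have f: "square_integrable f" and F: "square_integrable F"
    and lim: "(\<lambda>m::nat. \<integral>\<^sup>+ \<xi>. ennreal ((cmod (fourier_integral (\<lambda>t. indicator {- real m..real m} t * f t) \<xi> - F \<xi>))\<^sup>2) \<partial>lborel) \<longlonglongrightarrow> 0"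
    using ft by (auto simp: L2_fourier_def)
  have [measurable]: "f \<in> borel_measurable borel" "F \<in> borel_measurable borel"
    using f F by (auto simp: square_integrable_def)
  define G where "G = (\<lambda>\<xi>. F \<xi> * of_real (indicator {- b..b} \<xi>))"
  have GF: "AE \<xi> in lborel. F \<xi> = G \<xi>" using supp by eventually_elim (auto simp: G_def indicator_def)
  have ind2: "integrable lborel (\<lambda>t. (indicator {a..c} t :: real)\<^sup>2)" for a c :: real
  proof -
    have "integrable lborel (indicator {a..c} :: real \<Rightarrow> real)"
      by (intro integrable_real_indicator) (auto simp: emeasure_lborel_Icc_eq)
    moreover have "(\<lambda>t. (indicator {a..c} t :: real)\<^sup>2) = indicator {a..c}" by (auto simp: indicator_def)
    ultimately show ?thesis by simp
  qed
  have Gint: "integrable lborel G" unfolding G_def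
    by (rule integrable_mult_square_integrable[OF F _ ind2]) simp
  then show ?A by (simp add: G_def)
  have [measurable]: "G \<in> borel_measurable borel" using Gint by auto
  define g where "g = (\<lambda>m t. indicator {- real m..real m} t * f t)"
  have gint: "integrable lborel (g m)" for m
  proof -
    have "integrable lborel (\<lambda>t. f t * of_real (indicator {- real m..real m} t))"
      by (rule integrable_mult_square_integrable[OF f _ ind2]) simp
    moreover have "(\<lambda>t. f t * of_real (indicator {- real m..real m} t)) = g m"
      by (auto simp: g_def indicator_def)
    ultimately show ?thesis by simp
  qed
  have [measurable]: "g m \<in> borel_measurable borel" for m using gint by auto
  have eq: "(LINT \<xi>|lborel. G \<xi> * (iexp (2 * pi * x * \<xi>) * of_real (std_normal_density (\<xi> / n)))) = (LINT t|lborel. f t * of_real (gauss_kernel n (x - t)))"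
    if n: "n > 0" for n
  proof -
    have [measurable]: "gauss_kernel n \<in> borel_measurable borel" unfolding gauss_kernel_def by measurable
    define \<phi> where "\<phi> = (\<lambda>\<xi>. iexp (2 * pi * x * \<xi>) * of_real (std_normal_density (\<xi> / n)))"
    have [measurable]: "\<phi> \<in> borel_measurable borel" unfolding \<phi>_def by measurable
    have nphi: "cmod (\<phi> \<xi>) = std_normal_density (\<xi> / n)" for \<xi> by (simp add: \<phi>_def norm_mult std_normal_density_le)
    have phile: "cmod (\<phi> \<xi>) \<le> 1" for \<xi> unfolding nphi by (rule std_normal_density_le)
    have phiint: "integrable lborel \<phi>"
      using integrable_gaussian_scaled[OF n] by (rule Bochner_Integration.integrable_bound) (auto simp: nphi)
    have i1: "integrable lborel (\<lambda>\<xi>. fourier_integral (g m) \<xi> * \<phi> \<xi>)" for m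
    proof (rule Bochner_Integration.integrable_bound)
      show "integrable lborel (\<lambda>\<xi>. (LINT t|lborel. cmod (g m t)) * cmod (\<phi> \<xi>))" using integrable_norm[OF phiint] by simp
    qed (auto simp: norm_mult intro!: mult_right_mono order_trans[OF cmod_fourier_integral_le])
    have i2: "integrable lborel (\<lambda>\<xi>. G \<xi> * \<phi> \<xi>)"
      using Gint by (rule Bochner_Integration.integrable_bound) (auto simp: norm_mult mult_left_le phile)
    define d where "d = (\<lambda>m. (LINT \<xi>|lborel. fourier_integral (g m) \<xi> * \<phi> \<xi>) - (LINT \<xi>|lborel. G \<xi> * \<phi> \<xi>))"
    define B where "B = (\<integral>\<^sup>+\<xi>. (ennreal (cmod (\<phi> \<xi>)))\<^sup>2 \<partial>lborel)"
    have Bfin: "B < \<infinity>"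
    proof -
      have "B \<le> (\<integral>\<^sup>+\<xi>. ennreal (cmod (\<phi> \<xi>)) \<partial>lborel)" unfolding B_def
        by (intro nn_integral_mono) (auto simp: ennreal_power power2_eq_square mult_left_le phile ennreal_mult[symmetric] intro!: ennreal_leI)
      also have "\<dots> < \<infinity>" using phiint by (simp add: integrable_iff_bounded)
      finally show ?thesis .
    qed
    have dle: "ennreal ((cmod (d m))\<^sup>2) \<le> (\<integral>\<^sup>+ \<xi>. ennreal ((cmod (fourier_integral (g m) \<xi> - F \<xi>))\<^sup>2) \<partial>lborel) * B" for m
    proof -
      have "d m = (LINT \<xi>|lborel. fourier_integral (g m) \<xi> * \<phi> \<xi> - G \<xi> * \<phi> \<xi>)"
        unfolding d_def by (rule Bochner_Integration.integral_diff[symmetric, OF i1 i2])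
      then have "ennreal (cmod (d m)) \<le> (\<integral>\<^sup>+ \<xi>. ennreal (cmod (fourier_integral (g m) \<xi> * \<phi> \<xi> - G \<xi> * \<phi> \<xi>)) \<partial>lborel)"
        using integral_norm_bound_ennreal[OF Bochner_Integration.integrable_diff[OF i1 i2]] by simp
      also have "\<dots> = (\<integral>\<^sup>+ \<xi>. ennreal (cmod (fourier_integral (g m) \<xi> - G \<xi>)) * ennreal (cmod (\<phi> \<xi>)) \<partial>lborel)"
        by (simp add: norm_mult flip: left_diff_distrib ennreal_mult)
      finally have "(ennreal (cmod (d m)))\<^sup>2 \<le> (\<integral>\<^sup>+ \<xi>. ennreal (cmod (fourier_integral (g m) \<xi> - G \<xi>)) * ennreal (cmod (\<phi> \<xi>)) \<partial>lborel)\<^sup>2"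
        by (intro power_mono) auto
      also have "\<dots> \<le> (\<integral>\<^sup>+ \<xi>. (ennreal (cmod (fourier_integral (g m) \<xi> - G \<xi>)))\<^sup>2 \<partial>lborel) * B"
        unfolding B_def by (rule Cauchy_Schwarz_nn_integral) auto
      also have "(\<integral>\<^sup>+ \<xi>. (ennreal (cmod (fourier_integral (g m) \<xi> - G \<xi>)))\<^sup>2 \<partial>lborel) = (\<integral>\<^sup>+ \<xi>. ennreal ((cmod (fourier_integral (g m) \<xi> - F \<xi>))\<^sup>2) \<partial>lborel)"
        using GF by (intro nn_integral_cong_AE) (auto simp: ennreal_power)
      finally show ?thesis by (simp add: ennreal_power)
    qed
    have "(\<lambda>m. B * (\<integral>\<^sup>+ \<xi>. ennreal ((cmod (fourier_integral (g m) \<xi> - F \<xi>))\<^sup>2) \<partial>lborel)) \<longlonglongrightarrow> B * 0"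
      using lim Bfin unfolding g_def by (intro ennreal_tendsto_cmult) auto
    then have lim0: "(\<lambda>m. B * (\<integral>\<^sup>+ \<xi>. ennreal ((cmod (fourier_integral (g m) \<xi> - F \<xi>))\<^sup>2) \<partial>lborel)) \<longlonglongrightarrow> 0"
      by simp
    have "(\<lambda>m. ennreal ((cmod (d m))\<^sup>2)) \<longlonglongrightarrow> 0"
      by (rule tendsto_sandwich[OF always_eventually always_eventually tendsto_const lim0])
         (simp, use dle in \<open>simp only: mult.commute[of B] simp_thms\<close>)
    then have "(\<lambda>m. (cmod (d m))\<^sup>2) \<longlonglongrightarrow> 0" by (subst (asm) ennreal_0[symmetric], subst (asm) tendsto_ennreal_iff) auto
    then have "d \<longlonglongrightarrow> 0" by (simp add: tendsto_norm_zero_iff)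
    then have L: "(\<lambda>m. LINT \<xi>|lborel. fourier_integral (g m) \<xi> * \<phi> \<xi>) \<longlonglongrightarrow> (LINT \<xi>|lborel. G \<xi> * \<phi> \<xi>)"
      unfolding d_def by (simp add: LIM_zero_iff)
    have "(LINT \<xi>|lborel. fourier_integral (g m) \<xi> * \<phi> \<xi>) = (LINT t|lborel. g m t * of_real (gauss_kernel n (x - t)))" for m
      unfolding \<phi>_def by (rule multiplication_formula_gaussian[OF gint n])
    moreover have "(\<lambda>m. LINT t|lborel. g m t * of_real (gauss_kernel n (x - t))) \<longlonglongrightarrow> (LINT t|lborel. f t * of_real (gauss_kernel n (x - t)))"
    proof (rule integral_dominated_convergence)
      have "integrable lborel (\<lambda>t. f t * of_real (gauss_kernel n (x - t)))"
        by (intro integrable_mult_square_integrable[OF f] square_integrable_gauss_kernel n) auto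
      then show "integrable lborel (\<lambda>t. cmod (f t * of_real (gauss_kernel n (x - t))))" by (rule integrable_norm)
      show "AE t in lborel. (\<lambda>m. g m t * of_real (gauss_kernel n (x - t))) \<longlonglongrightarrow> f t * of_real (gauss_kernel n (x - t))"
      proof (rule AE_I2)
        fix t
        have "\<forall>\<^sub>F m in sequentially. f t * of_real (gauss_kernel n (x - t)) = g m t * of_real (gauss_kernel n (x - t))"
          using eventually_ge_at_top[of "nat \<lceil>\<bar>t\<bar>\<rceil>"]
        proof eventually_elim
          case (elim m)
          then have "\<bar>t\<bar> \<le> real m" by linarith
          then show ?case by (auto simp: g_def indicator_def)
        qed
        then show "(\<lambda>m. g m t * of_real (gauss_kernel n (x - t))) \<longlonglongrightarrow> f t * of_real (gauss_kernel n (x - t))"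
          by (rule Lim_transform_eventually[OF tendsto_const])
      qed
      show "AE t in lborel. norm (g m t * of_real (gauss_kernel n (x - t))) \<le> cmod (f t * of_real (gauss_kernel n (x - t)))" for m
        by (auto simp: g_def indicator_def norm_mult)
    qed measurable
    ultimately show ?thesis using L LIMSEQ_unique unfolding \<phi>_def by fastforce
  qed
  have "(\<lambda>i. LINT \<xi>|lborel. G \<xi> * (iexp (2 * pi * x * \<xi>) * of_real (std_normal_density (\<xi> / real (Suc i))))) \<longlonglongrightarrow> (LINT \<xi>|lborel. G \<xi> * (iexp (2 * pi * x * \<xi>) * of_real (std_normal_density 0)))"
  proof (rule integral_dominated_convergence)
    show "integrable lborel (\<lambda>\<xi>. cmod (G \<xi>))" using Gint by (rule integrable_norm)
    show "AE \<xi> in lborel. norm (G \<xi> * (iexp (2 * pi * x * \<xi>) * of_real (std_normal_density (\<xi> / real (Suc i))))) \<le> cmod (G \<xi>)" for i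
      by (auto simp: norm_mult std_normal_density_le mult_left_le)
    show "AE \<xi> in lborel. (\<lambda>i. G \<xi> * (iexp (2 * pi * x * \<xi>) * of_real (std_normal_density (\<xi> / real (Suc i))))) \<longlonglongrightarrow> G \<xi> * (iexp (2 * pi * x * \<xi>) * of_real (std_normal_density 0))"
    proof (intro AE_I2 tendsto_mult tendsto_const tendsto_of_real)
      fix \<xi> :: real
      have "(\<lambda>i. \<xi> / real (Suc i)) \<longlonglongrightarrow> 0" by real_asymp
      then show "(\<lambda>i. std_normal_density (\<xi> / real (Suc i))) \<longlonglongrightarrow> std_normal_density 0"
        unfolding std_normal_density_def by (intro tendsto_intros) auto
    qed
  qed measurable
  then have "(\<lambda>i. LINT t|lborel. f t * of_real (gauss_kernel (real (Suc i)) (x - t))) \<longlonglongrightarrow> (LINT \<xi>|lborel. G \<xi> * (iexp (2 * pi * x * \<xi>) * of_real (std_normal_density 0)))"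
    by (subst (asm) eq) simp_all
  from LIMSEQ_unique[OF this gaussian_approximate_identity[OF cont f]]
  have "f x * of_real (std_normal_density 0) = (LINT \<xi>|lborel. G \<xi> * iexp (2 * pi * x * \<xi>)) * of_real (std_normal_density 0)"
    by (auto simp flip: mult.assoc)
  moreover have "std_normal_density 0 \<noteq> 0" by (simp add: std_normal_density_def)
  ultimately show ?B unfolding G_def by simp
qed

text \<open>
  The inversion formula continues to complex arguments because the spectrum is bounded.
  Expanding the exponential and integrating termwise gives the power series of the extension.
\<close>

lemma PW_imp_entire:
  assumes f: "f \<in> PW \<Omega>" and \<Omega>: "\<Omega> > 0"
  obtains E A where "exp_type_bound (pi * \<Omega>) A E" "\<And>t::real. E (of_real t) = f t"
proof -
  obtain F where cont: "continuous_on UNIV f" and ft: "L2_fourier f F"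
    and supp0: "AE \<xi> in lborel. \<xi> \<notin> {- \<Omega> / 2..\<Omega> / 2} \<longrightarrow> F \<xi> = 0"
    using f by (auto simp: PW_def)
  define b where "b = \<Omega> / 2"
  have b: "b > 0" using \<Omega> by (simp add: b_def)
  have supp: "AE \<xi> in lborel. \<xi> \<notin> {- b..b} \<longrightarrow> F \<xi> = 0" using supp0 by (simp add: b_def)
  define G where "G = (\<lambda>\<xi>. F \<xi> * of_real (indicator {- b..b} \<xi>))"
  have Gint: "integrable lborel G" unfolding G_def by (rule L2_fourier_inversion(1)[OF cont ft supp])
  have [measurable]: "G \<in> borel_measurable borel" using Gint by auto
  have G0: "G \<xi> = 0" if "\<bar>\<xi>\<bar> > b" for \<xi> using that by (auto simp: G_def indicator_def)
  have rep: "f x = (LINT \<xi>|lborel. G \<xi> * iexp (2 * pi * x * \<xi>))" for x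
    unfolding G_def by (rule L2_fourier_inversion(2)[OF cont ft supp])
  define A where "A = (LINT \<xi>|lborel. cmod (G \<xi>))"
  define c where "c = (\<lambda>\<xi>::real. 2 * complex_of_real pi * \<i> * of_real \<xi>)"
  have [measurable]: "c \<in> borel_measurable borel" unfolding c_def by measurable
  define E where "E = (\<lambda>z. LINT \<xi>|lborel. G \<xi> * exp (c \<xi> * z))"
  have "E holomorphic_on ball 0 r" for r
  proof (rule power_series_holomorphic)
    fix w :: complex
    define M where "M = 2 * pi * b * cmod w"
    have M0: "M \<ge> 0" unfolding M_def using b by simp
    define a where "a = (\<lambda>n \<xi>. G \<xi> * ((c \<xi> * w) ^ n /\<^sub>R fact n))"
    have an: "cmod (a n \<xi>) \<le> cmod (G \<xi>) * (M ^ n /\<^sub>R fact n)" for n \<xi>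
    proof (cases "\<bar>\<xi>\<bar> \<le> b")
      case True
      have "cmod (c \<xi> * w) = 2 * pi * \<bar>\<xi>\<bar> * cmod w" unfolding c_def by (simp add: norm_mult)
      also have "\<dots> \<le> M" unfolding M_def using True by (intro mult_right_mono mult_left_mono) auto
      finally have "cmod (c \<xi> * w) ^ n \<le> M ^ n" by (intro power_mono) auto
      then show ?thesis unfolding a_def by (auto simp: norm_mult norm_power intro!: mult_left_mono)
    qed (simp add: a_def G0)
    have aint: "integrable lborel (a n)" for n
    proof (rule Bochner_Integration.integrable_bound)
      show "integrable lborel (\<lambda>\<xi>. cmod (G \<xi>) * (M ^ n /\<^sub>R fact n))" using integrable_norm[OF Gint] by simp
      show "a n \<in> borel_measurable lborel" unfolding a_def by measurable
      show "AE \<xi> in lborel. norm (a n \<xi>) \<le> norm (cmod (G \<xi>) * (M ^ n /\<^sub>R fact n))"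
        using an M0 by auto
    qed
    have "(\<lambda>n. integral\<^sup>L lborel (a n)) sums (LINT \<xi>|lborel. (\<Sum>n. a n \<xi>))"
    proof (rule sums_integral[OF aint])
      show "AE \<xi> in lborel. summable (\<lambda>n. norm (a n \<xi>))"
      proof (rule AE_I2, rule summable_comparison_test'[where N = 0])
        fix \<xi> :: real
        show "summable (\<lambda>n. cmod (G \<xi>) * (M ^ n /\<^sub>R fact n))"
          by (intro summable_mult summable_exp_generic)
        show "norm (norm (a n \<xi>)) \<le> cmod (G \<xi>) * (M ^ n /\<^sub>R fact n)" for n using an by simp
      qed
      show "summable (\<lambda>n. LINT \<xi>|lborel. norm (a n \<xi>))"
      proof (rule summable_comparison_test'[where N = 0])
        show "summable (\<lambda>n. A * (M ^ n /\<^sub>R fact n))" by (intro summable_mult summable_exp_generic)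
        fix n
        have "(LINT \<xi>|lborel. norm (a n \<xi>)) \<le> (LINT \<xi>|lborel. cmod (G \<xi>) * (M ^ n /\<^sub>R fact n))"
          using integrable_norm[OF Gint] by (intro integral_mono an integrable_norm[OF aint]) simp
        then show "norm (LINT \<xi>|lborel. norm (a n \<xi>)) \<le> A * (M ^ n /\<^sub>R fact n)"
          by (simp add: A_def integral_nonneg_AE)
      qed
    qed
    moreover have "(\<Sum>n. a n \<xi>) = G \<xi> * exp (c \<xi> * w)" for \<xi>
    proof -
      have "a n \<xi> = G \<xi> * ((c \<xi> * w) ^ n /\<^sub>R fact n)" for n by (simp add: a_def)
      then have "(\<lambda>n. a n \<xi>) sums (G \<xi> * exp (c \<xi> * w))"
        by (simp only:) (intro sums_mult exp_converges)
      then show ?thesis by (rule sums_unique[symmetric])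
    qed
    moreover have "integral\<^sup>L lborel (a n) = (LINT \<xi>|lborel. G \<xi> * (c \<xi> ^ n /\<^sub>R fact n)) * (w - 0) ^ n" for n
    proof -
      have "a n = (\<lambda>\<xi>. G \<xi> * (c \<xi> ^ n /\<^sub>R fact n) * (w - 0) ^ n)"
        by (auto simp: a_def power_mult_distrib)
      then show ?thesis by simp
    qed
    ultimately show "(\<lambda>n. (LINT \<xi>|lborel. G \<xi> * (c \<xi> ^ n /\<^sub>R fact n)) * (w - 0) ^ n) sums E w"
      unfolding E_def by simp
  qed
  then have hol: "E holomorphic_on UNIV"
    by (metis holomorphic_on_open open_UNIV UNIV_I open_ball centre_in_ball dist_0_norm mem_ball less_add_one)
  have "cmod (E z) \<le> A * exp (pi * \<Omega> * \<bar>Im z\<bar>)" for z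
  proof -
    have le: "cmod (G \<xi> * exp (c \<xi> * z)) \<le> cmod (G \<xi>) * exp (pi * \<Omega> * \<bar>Im z\<bar>)" for \<xi>
    proof (cases "\<bar>\<xi>\<bar> \<le> b")
      case True
      have "Re (c \<xi> * z) = - (2 * pi * \<xi> * Im z)" by (simp add: c_def)
      also have "\<dots> \<le> \<bar>2 * pi * \<xi> * Im z\<bar>" by linarith
      also have "\<dots> = 2 * pi * \<bar>\<xi>\<bar> * \<bar>Im z\<bar>" by (simp add: abs_mult)
      also have "\<dots> \<le> 2 * pi * b * \<bar>Im z\<bar>" using True by (intro mult_right_mono mult_left_mono) auto
      finally have "Re (c \<xi> * z) \<le> pi * \<Omega> * \<bar>Im z\<bar>" by (simp add: b_def)
      then show ?thesis by (simp add: norm_mult norm_exp_eq_Re mult_left_mono)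
    qed (simp add: G0)
    have i: "integrable lborel (\<lambda>\<xi>. cmod (G \<xi>) * exp (pi * \<Omega> * \<bar>Im z\<bar>))" using integrable_norm[OF Gint] by simp
    have i2: "integrable lborel (\<lambda>\<xi>. G \<xi> * exp (c \<xi> * z))"
      using i by (rule Bochner_Integration.integrable_bound) (use le in auto)
    have "cmod (E z) \<le> (LINT \<xi>|lborel. cmod (G \<xi> * exp (c \<xi> * z)))" unfolding E_def by (rule integral_norm_bound)
    also have "\<dots> \<le> (LINT \<xi>|lborel. cmod (G \<xi>) * exp (pi * \<Omega> * \<bar>Im z\<bar>))"
      by (intro integral_mono integrable_norm i2 i le)
    finally show ?thesis by (simp add: A_def)
  qed
  with hol have "exp_type_bound (pi * \<Omega>) A E" by (simp add: exp_type_bound_def)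
  moreover have "E (of_real t) = f t" for t unfolding rep E_def c_def by (simp add: mult_ac)
  ultimately show thesis by (rule that)
qed

section \<open>Sampling inequalities in the mean square\<close>

definition band_limited :: "real \<Rightarrow> (real \<Rightarrow> complex) \<Rightarrow> bool" where
  "band_limited \<kappa> h \<longleftrightarrow> (\<exists>E A. exp_type_bound \<kappa> A E \<and> (\<forall>t. E (of_real t) = h t))"

lemma band_limited_diff:
  assumes "band_limited \<kappa> f" "band_limited \<kappa> g"
  shows "band_limited \<kappa> (\<lambda>t. f t - g t)"
proof -
  obtain E A E' A' where E: "exp_type_bound \<kappa> A E" "\<And>t. E (of_real t) = f t"
    and E': "exp_type_bound \<kappa> A' E'" "\<And>t. E' (of_real t) = g t"
    using assms by (auto simp: band_limited_def)
  have "exp_type_bound \<kappa> (A + A') (\<lambda>z. E z - E' z)"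
    unfolding exp_type_bound_def
  proof (intro conjI allI)
    show "(\<lambda>z. E z - E' z) holomorphic_on UNIV"
      using E(1) E'(1) by (intro holomorphic_intros) (auto simp: exp_type_bound_def)
    fix z
    have "cmod (E z - E' z) \<le> cmod (E z) + cmod (E' z)" by (rule norm_triangle_ineq4)
    also have "\<dots> \<le> A * exp (\<kappa> * \<bar>Im z\<bar>) + A' * exp (\<kappa> * \<bar>Im z\<bar>)"
      using E(1) E'(1) by (intro add_mono) (auto simp: exp_type_bound_def)
    finally show "cmod (E z - E' z) \<le> (A + A') * exp (\<kappa> * \<bar>Im z\<bar>)" by (simp add: algebra_simps)
  qed
  then show ?thesis unfolding band_limited_def using E(2) E'(2) by (intro exI[of _ "\<lambda>z. E z - E' z"]) auto
qed

lemma band_limited_measurable: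
  assumes "band_limited \<kappa> h" shows "h \<in> borel_measurable borel"
proof -
  obtain E A where E: "exp_type_bound \<kappa> A E" "\<And>t. E (of_real t) = h t"
    using assms by (auto simp: band_limited_def)
  have "continuous_on UNIV E" using E(1) by (auto simp: exp_type_bound_def intro: holomorphic_on_imp_continuous_on)
  then have "continuous_on UNIV (\<lambda>t::real. E (of_real t))"
    by (intro continuous_on_compose2[of UNIV E UNIV of_real] continuous_intros) auto
  then show ?thesis using E(2) by (simp add: borel_measurable_continuous_onI)
qed

text \<open>
  Each term of the weighted sum is at most the whole sum, which may thus serve as the bound
  $s$ in the pointwise estimate.
\<close>

lemma pointwise_sampling_sum:
  assumes T: "T > 0" and \<delta>: "\<delta> > 0" and \<kappa>: "0 \<le> \<kappa>" "\<kappa> * T < pi * m"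
  obtains C :: real where "C > 0"
    "\<And>Y h x. node_blocks T m \<delta> Y \<Longrightarrow> band_limited \<kappa> h \<Longrightarrow>
       ennreal ((cmod (h x))\<^sup>2) \<le> ennreal C * (\<integral>\<^sup>+y. ennreal ((cmod (h y))\<^sup>2 / (1 + (y - x)\<^sup>2)) \<partial>count_space (\<Union>(range Y)))"
proof -
  obtain C where C: "C \<ge> 0" and pt:
    "\<And>Y A E s x. node_blocks T m \<delta> Y \<Longrightarrow> exp_type_bound \<kappa> A E \<Longrightarrow> 0 \<le> s \<Longrightarrow>
       (\<And>y. y \<in> \<Union>(range Y) \<Longrightarrow> (cmod (E (of_real y)))\<^sup>2 \<le> s * (1 + (y - x)\<^sup>2)) \<Longrightarrow>
       (cmod (E (of_real x)))\<^sup>2 \<le> C * s"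
    using weighted_pointwise_sampling[OF assms] by metis
  show thesis
  proof (rule that[of "C + 1"])
    fix Y h x assume Y: "node_blocks T m \<delta> Y" and h: "band_limited \<kappa> h"
    obtain E A where E: "exp_type_bound \<kappa> A E" "\<And>t. E (of_real t) = h t"
      using h by (auto simp: band_limited_def)
    define S where "S = (\<integral>\<^sup>+y. ennreal ((cmod (h y))\<^sup>2 / (1 + (y - x)\<^sup>2)) \<partial>count_space (\<Union>(range Y)))"
    have "ennreal ((cmod (h x))\<^sup>2) \<le> ennreal (C + 1) * S"
    proof (cases S)
      case (real s)
      have "(cmod (E (of_real x)))\<^sup>2 \<le> C * s"
      proof (rule pt[OF Y E(1) real(1)])
        fix y assume y: "y \<in> \<Union>(range Y)"
        have "ennreal ((cmod (h y))\<^sup>2 / (1 + (y - x)\<^sup>2)) \<le> S" unfolding S_def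
          using y by (intro nn_integral_ge_point)
        then have "(cmod (h y))\<^sup>2 / (1 + (y - x)\<^sup>2) \<le> s" using real by simp
        then show "(cmod (E (of_real y)))\<^sup>2 \<le> s * (1 + (y - x)\<^sup>2)" unfolding E(2)
          by (simp add: pos_divide_le_eq add_pos_nonneg)
      qed
      also have "\<dots> \<le> (C + 1) * s" using real by (intro mult_right_mono) auto
      finally have "ennreal ((cmod (h x))\<^sup>2) \<le> ennreal ((C + 1) * s)" unfolding E(2) by (rule ennreal_leI)
      also have "\<dots> = ennreal (C + 1) * S" unfolding real using C real by (intro ennreal_mult) auto
      finally show ?thesis .
    qed (use C in \<open>simp add: ennreal_mult_top\<close>)
    then show "ennreal ((cmod (h x))\<^sup>2) \<le> ennreal (C + 1) * (\<integral>\<^sup>+y. ennreal ((cmod (h y))\<^sup>2 / (1 + (y - x)\<^sup>2)) \<partial>count_space (\<Union>(range Y)))"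
      by (simp add: S_def)
  qed (use C in simp)
qed

lemma nn_integral_inverse_square_shift:
  "(\<integral>\<^sup>+x. ennreal (1 / (1 + (a - x)\<^sup>2)) \<partial>lborel) = (\<integral>\<^sup>+t. ennreal (1 / (1 + t\<^sup>2)) \<partial>lborel)"
  by (subst nn_integral_real_affine[of "\<lambda>t. ennreal (1 / (1 + t\<^sup>2))" "-1" a]) auto

lemma inverse_square_mass:
  obtains W :: real where "W > 0" "(\<integral>\<^sup>+t. ennreal (1 / (1 + t\<^sup>2)) \<partial>lborel) \<le> ennreal W"
proof -
  have "(\<integral>\<^sup>+t. ennreal (1 / (1 + t\<^sup>2)) \<partial>lborel) = ennreal (LINT t|lborel. 1 / (1 + t\<^sup>2))"
    using integrable_inverse_square by (intro nn_integral_eq_integral) auto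
  also have "\<dots> \<le> ennreal (max 1 (LINT t|lborel. 1 / (1 + t\<^sup>2)))" by (intro ennreal_leI) auto
  finally show thesis by (intro that[of "max 1 (LINT t|lborel. 1 / (1 + t\<^sup>2))"]) auto
qed

text \<open>
  The lower sampling inequality: integrate the weighted pointwise estimate, using that the
  weight has finite mass.
\<close>

lemma norm_sampling:
  assumes T: "T > 0" and \<delta>: "\<delta> > 0" and \<kappa>: "0 \<le> \<kappa>" "\<kappa> * T < pi * m"
  obtains C :: real where "C > 0"
    "\<And>Y h. node_blocks T m \<delta> Y \<Longrightarrow> band_limited \<kappa> h \<Longrightarrow>
       (\<integral>\<^sup>+x. ennreal ((cmod (h x))\<^sup>2) \<partial>lborel) \<le> ennreal C * (\<integral>\<^sup>+y. ennreal ((cmod (h y))\<^sup>2) \<partial>count_space (\<Union>(range Y)))"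
proof -
  obtain C where C: "C > 0" and pt: "\<And>Y h x. node_blocks T m \<delta> Y \<Longrightarrow> band_limited \<kappa> h \<Longrightarrow>
       ennreal ((cmod (h x))\<^sup>2) \<le> ennreal C * (\<integral>\<^sup>+y. ennreal ((cmod (h y))\<^sup>2 / (1 + (y - x)\<^sup>2)) \<partial>count_space (\<Union>(range Y)))"
    by (rule pointwise_sampling_sum[OF assms]) (rule that; blast)
  obtain W :: real where W: "W > 0" "(\<integral>\<^sup>+t. ennreal (1 / (1 + t\<^sup>2)) \<partial>lborel) \<le> ennreal W"
    by (rule inverse_square_mass)
  show thesis
  proof (rule that[of "C * W"])
    fix Y h assume Y: "node_blocks T m \<delta> Y" and h: "band_limited \<kappa> h"
    note [measurable] = band_limited_measurable[OF h]
    define N where "N = \<Union>(range Y)"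
    have "countable N" 
    proof -
      have "countable (Y j)" for j using Y by (auto simp: node_blocks_def intro: countable_finite)
      then show ?thesis unfolding N_def by (intro countable_UN) auto
    qed
    have "(\<integral>\<^sup>+x. ennreal ((cmod (h x))\<^sup>2) \<partial>lborel)
        \<le> (\<integral>\<^sup>+x. ennreal C * (\<integral>\<^sup>+y. ennreal ((cmod (h y))\<^sup>2 / (1 + (y - x)\<^sup>2)) \<partial>count_space N) \<partial>lborel)"
      unfolding N_def by (intro nn_integral_mono pt Y h)
    also have "\<dots> = (\<integral>\<^sup>+x. (\<integral>\<^sup>+y. ennreal C * ennreal ((cmod (h y))\<^sup>2 / (1 + (y - x)\<^sup>2)) \<partial>count_space N) \<partial>lborel)"
      by (simp add: nn_integral_cmult)
    also have "\<dots> = (\<integral>\<^sup>+y. (\<integral>\<^sup>+x. ennreal C * ennreal ((cmod (h y))\<^sup>2 / (1 + (y - x)\<^sup>2)) \<partial>lborel) \<partial>count_space N)"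
      using \<open>countable N\<close> by (intro nn_integral_count_space_nn_integral) auto
    also have "\<dots> \<le> (\<integral>\<^sup>+y. ennreal (C * W) * ennreal ((cmod (h y))\<^sup>2) \<partial>count_space N)"
    proof (rule nn_integral_mono)
      fix y
      have "(\<integral>\<^sup>+x. ennreal C * ennreal ((cmod (h y))\<^sup>2 / (1 + (y - x)\<^sup>2)) \<partial>lborel)
          = (\<integral>\<^sup>+x. (ennreal C * ennreal ((cmod (h y))\<^sup>2)) * ennreal (1 / (1 + (y - x)\<^sup>2)) \<partial>lborel)"
        by (simp add: mult.assoc flip: ennreal_mult)
      also have "\<dots> = (ennreal C * ennreal ((cmod (h y))\<^sup>2)) * (\<integral>\<^sup>+t. ennreal (1 / (1 + t\<^sup>2)) \<partial>lborel)"
        by (simp add: nn_integral_cmult nn_integral_inverse_square_shift)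
      also have "\<dots> \<le> (ennreal C * ennreal ((cmod (h y))\<^sup>2)) * ennreal W" using W by (intro mult_left_mono) auto
      also have "\<dots> = ennreal (C * W) * ennreal ((cmod (h y))\<^sup>2)" using C W by (simp add: mult_ac ennreal_mult)
      finally show "(\<integral>\<^sup>+x. ennreal C * ennreal ((cmod (h y))\<^sup>2 / (1 + (y - x)\<^sup>2)) \<partial>lborel) \<le> ennreal (C * W) * ennreal ((cmod (h y))\<^sup>2)" .
    qed
    also have "\<dots> = ennreal (C * W) * (\<integral>\<^sup>+y. ennreal ((cmod (h y))\<^sup>2) \<partial>count_space N)"
      by (simp add: nn_integral_cmult)
    finally show "(\<integral>\<^sup>+x. ennreal ((cmod (h x))\<^sup>2) \<partial>lborel) \<le> ennreal (C * W) * (\<integral>\<^sup>+y. ennreal ((cmod (h y))\<^sup>2) \<partial>count_space (\<Union>(range Y)))"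
      by (simp add: N_def)
  qed (use C W in simp)
qed

lemma nn_integral_periodize:
  fixes g :: "real \<Rightarrow> ennreal"
  assumes [measurable]: "g \<in> borel_measurable borel"
  shows "(\<integral>\<^sup>+s. indicator {0..<1} s * (\<integral>\<^sup>+j. g (of_int j + s) \<partial>count_space UNIV) \<partial>lborel) = (\<integral>\<^sup>+u. g u \<partial>lborel)"
proof -
  have "(\<integral>\<^sup>+s. indicator {0..<1} s * (\<integral>\<^sup>+j. g (of_int j + s) \<partial>count_space UNIV) \<partial>lborel)
      = (\<integral>\<^sup>+s. (\<integral>\<^sup>+j. indicator {0..<1} s * g (of_int j + s) \<partial>count_space (UNIV :: int set)) \<partial>lborel)"
    by (simp add: nn_integral_cmult)
  also have "\<dots> = (\<integral>\<^sup>+j. (\<integral>\<^sup>+s. indicator {0..<1} s * g (of_int j + s) \<partial>lborel) \<partial>count_space (UNIV :: int set))"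
    by (intro nn_integral_count_space_nn_integral) auto
  also have "\<dots> = (\<integral>\<^sup>+j. (\<integral>\<^sup>+u. indicator {0..<1} (u - of_int j) * g u \<partial>lborel) \<partial>count_space (UNIV :: int set))"
  proof (rule nn_integral_cong)
    fix j :: int
    show "(\<integral>\<^sup>+s. indicator {0..<1} s * g (of_int j + s) \<partial>lborel) = (\<integral>\<^sup>+u. indicator {0..<1} (u - of_int j) * g u \<partial>lborel)"
      using nn_integral_real_affine[of "\<lambda>u. indicator {0..<1} (u - of_int j) * g u" 1 "of_int j"] by simp
  qed
  also have "\<dots> = (\<integral>\<^sup>+u. (\<integral>\<^sup>+j. indicator {0..<1} (u - of_int j) * g u \<partial>count_space (UNIV :: int set)) \<partial>lborel)"
    by (intro nn_integral_count_space_nn_integral[symmetric]) auto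
  also have "\<dots> = (\<integral>\<^sup>+u. g u \<partial>lborel)"
  proof (rule nn_integral_cong)
    fix u :: real
    have "u - of_int j \<in> {0..<1} \<longleftrightarrow> j = \<lfloor>u\<rfloor>" for j :: int by (auto simp: floor_eq_iff) linarith+
    then have "indicator {0..<1} (u - of_int j) * g u = g u * indicator {\<lfloor>u\<rfloor>} j" for j
      by (auto simp: indicator_def)
    then show "(\<integral>\<^sup>+j. indicator {0..<1} (u - of_int j) * g u \<partial>count_space (UNIV :: int set)) = g u"
      by (simp add: nn_integral_cmult)
  qed
  finally show ?thesis .
qed

text \<open>
  The shifted lattices $T(\mathbb{Z} + s)$, $0 \le s < 1$, are one-node block systems with the
  same parameters. Averaging the pointwise estimate over $s$ turns the sum over the lattice
  into an integral.
\<close>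

lemma pointwise_local_L2_bound:
  assumes \<kappa>: "\<kappa> > 0"
  obtains C :: real where "C > 0"
    "\<And>h x. band_limited \<kappa> h \<Longrightarrow>
       ennreal ((cmod (h x))\<^sup>2) \<le> ennreal C * (\<integral>\<^sup>+t. ennreal ((cmod (h t))\<^sup>2 / (1 + (t - x)\<^sup>2)) \<partial>lborel)"
proof -
  define T where "T = 1 / \<kappa>"
  have T: "T > 0" "\<kappa> * T < pi * real 1" unfolding T_def using \<kappa> pi_gt3 by auto
  obtain C where C: "C > 0" and pt: "\<And>Y h x. node_blocks T 1 T Y \<Longrightarrow> band_limited \<kappa> h \<Longrightarrow>
       ennreal ((cmod (h x))\<^sup>2) \<le> ennreal C * (\<integral>\<^sup>+y. ennreal ((cmod (h y))\<^sup>2 / (1 + (y - x)\<^sup>2)) \<partial>count_space (\<Union>(range Y)))"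
    by (rule pointwise_sampling_sum[OF T(1) T(1) less_imp_le[OF \<kappa>] T(2)]) (rule that; blast)
  show thesis
  proof (rule that[of "C * \<kappa>"])
    fix h x assume h: "band_limited \<kappa> h"
    note [measurable] = band_limited_measurable[OF h]
    define g where "g = (\<lambda>t. ennreal ((cmod (h t))\<^sup>2 / (1 + (t - x)\<^sup>2)))"
    have [measurable]: "g \<in> borel_measurable borel" unfolding g_def by measurable
    have one: "ennreal ((cmod (h x))\<^sup>2) \<le> ennreal C * (\<integral>\<^sup>+j. g (T * (of_int j + s)) \<partial>count_space UNIV)"
      if s: "s \<in> {0..<1}" for s
    proof -
      define Y where "Y = (\<lambda>j::int. {T * (of_int j + s)})"
      have sep: "T \<le> \<bar>T * (of_int i + s) - T * (of_int j + s)\<bar>" if "i \<noteq> j" for i j :: int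
      proof -
        have "1 \<le> \<bar>i - j\<bar>" using that by simp
        then have "1 \<le> \<bar>of_int i - of_int j :: real\<bar>" by linarith
        then have "T * 1 \<le> T * \<bar>of_int i - of_int j\<bar>" using T by (intro mult_left_mono) auto
        also have "\<dots> = \<bar>T * (of_int i + s) - T * (of_int j + s)\<bar>" using T by (simp add: abs_mult flip: right_diff_distrib)
        finally show ?thesis by simp
      qed
      have "node_blocks T 1 T Y"
        unfolding node_blocks_def
      proof (intro conjI allI ballI impI)
        show "Y j \<subseteq> {T * of_int j..<T * (of_int j + 1)}" for j using s T by (auto simp: Y_def)
        fix a b assume "a \<in> \<Union>(range Y)" "b \<in> \<Union>(range Y)" "a \<noteq> b"
        then obtain i j where "a = T * (of_int i + s)" "b = T * (of_int j + s)" "i \<noteq> j" by (auto simp: Y_def)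
        then show "T \<le> \<bar>a - b\<bar>" using sep by simp
      qed (auto simp: Y_def)
      from pt[OF this h, of x]
      have "ennreal ((cmod (h x))\<^sup>2) \<le> ennreal C * (\<integral>\<^sup>+y. g y \<partial>count_space (\<Union>(range Y)))" by (simp add: g_def)
      also have "(\<integral>\<^sup>+y. g y \<partial>count_space (\<Union>(range Y))) = (\<integral>\<^sup>+j. g (T * (of_int j + s)) \<partial>count_space UNIV)"
      proof (rule nn_integral_bij_count_space[symmetric])
        have "inj (\<lambda>j::int. T * (of_int j + s))" using T by (auto simp: inj_on_def)
        then show "bij_betw (\<lambda>j::int. T * (of_int j + s)) UNIV (\<Union>(range Y))" by (auto simp: bij_betw_def Y_def)
      qed
      finally show ?thesis .
    qed
    have "ennreal ((cmod (h x))\<^sup>2) = (\<integral>\<^sup>+s. ennreal ((cmod (h x))\<^sup>2) * indicator {0..<1::real} s \<partial>lborel)"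
      by (simp add: nn_integral_cmult)
    also have "\<dots> \<le> (\<integral>\<^sup>+s. ennreal C * (indicator {0..<1} s * (\<integral>\<^sup>+j. g (T * (of_int j + s)) \<partial>count_space UNIV)) \<partial>lborel)"
      using one by (intro nn_integral_mono) (auto simp: indicator_def)
    also have "\<dots> = (\<integral>\<^sup>+s. indicator {0..<1} s * (\<integral>\<^sup>+j. ennreal C * g (T * (of_int j + s)) \<partial>count_space UNIV) \<partial>lborel)"
      by (intro nn_integral_cong) (simp add: nn_integral_cmult mult_ac)
    also have "\<dots> = (\<integral>\<^sup>+u. ennreal C * g (T * u) \<partial>lborel)"
      by (rule nn_integral_periodize[of "\<lambda>u. ennreal C * g (T * u)"]) measurable
    also have "\<dots> = ennreal C * (\<integral>\<^sup>+u. g (T * u) \<partial>lborel)" by (simp add: nn_integral_cmult)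
    also have "(\<integral>\<^sup>+u. g (T * u) \<partial>lborel) = ennreal \<kappa> * (\<integral>\<^sup>+t. g t \<partial>lborel)"
    proof -
      have "(\<integral>\<^sup>+u. g (T * u) \<partial>lborel) = ennreal \<bar>\<kappa>\<bar> * (\<integral>\<^sup>+u. g (T * (0 + \<kappa> * u)) \<partial>lborel)"
        using \<kappa> by (intro nn_integral_real_affine) auto
      then show ?thesis using \<kappa> by (simp add: T_def)
    qed
    also have "ennreal C * (ennreal \<kappa> * (\<integral>\<^sup>+t. g t \<partial>lborel)) = ennreal (C * \<kappa>) * (\<integral>\<^sup>+t. g t \<partial>lborel)"
      using C \<kappa> by (simp add: ennreal_mult mult_ac)
    finally show "ennreal ((cmod (h x))\<^sup>2) \<le> ennreal (C * \<kappa>) * (\<integral>\<^sup>+t. ennreal ((cmod (h t))\<^sup>2 / (1 + (t - x)\<^sup>2)) \<partial>lborel)"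
      by (simp add: g_def)
  qed (use C \<kappa> in simp)
qed

text \<open>
  Each term is at most a multiple of its mean over $[x, x + \delta)$. These intervals are
  disjoint, so the sum is controlled by the integral.
\<close>

lemma separated_inverse_square_sum:
  assumes \<delta>: "\<delta> > 0"
  obtains K :: real where "K > 0"
    "\<And>X t. countable X \<Longrightarrow> (\<And>a b. a \<in> X \<Longrightarrow> b \<in> X \<Longrightarrow> a \<noteq> b \<Longrightarrow> \<delta> \<le> \<bar>a - b\<bar>) \<Longrightarrow>
       (\<integral>\<^sup>+x. ennreal (1 / (1 + (t - x)\<^sup>2)) \<partial>count_space X) \<le> ennreal K"
proof -
  obtain W :: real where W: "W > 0" "(\<integral>\<^sup>+t. ennreal (1 / (1 + t\<^sup>2)) \<partial>lborel) \<le> ennreal W"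
    by (rule inverse_square_mass)
  define c where "c = 2 + 2 * \<delta>\<^sup>2"
  have c: "c > 0" unfolding c_def by (simp add: add_pos_nonneg)
  show thesis
  proof (rule that[of "c / \<delta> * W"])
    fix X and t :: real assume "countable X" and sep: "\<And>a b. a \<in> X \<Longrightarrow> b \<in> X \<Longrightarrow> a \<noteq> b \<Longrightarrow> \<delta> \<le> \<bar>a - b\<bar>"
    define w where "w = (\<lambda>s::real. 1 / (1 + s\<^sup>2))"
    have [measurable]: "w \<in> borel_measurable borel" unfolding w_def by measurable
    have w0: "w s \<ge> 0" for s by (simp add: w_def)
    have comp: "w (t - x) \<le> c * w (t - u)" if "u \<in> {x..<x + \<delta>}" for u x
    proof -
      have "\<bar>u - x\<bar> \<le> \<delta>" using that by auto
      then have "(u - x)\<^sup>2 \<le> \<delta>\<^sup>2" using \<delta> by (metis abs_le_square_iff abs_of_pos)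
      have "(t - u)\<^sup>2 \<le> 2 * (t - x)\<^sup>2 + 2 * (u - x)\<^sup>2"
        using zero_le_power2[of "(t - x) + (u - x)"] by (simp add: power2_eq_square algebra_simps)
      then have "1 + (t - u)\<^sup>2 \<le> c + 2 * (t - x)\<^sup>2" using \<open>(u - x)\<^sup>2 \<le> \<delta>\<^sup>2\<close> unfolding c_def by simp
      also have "\<dots> \<le> c * (1 + (t - x)\<^sup>2)"
        using mult_right_mono[of 2 c "(t - x)\<^sup>2"] by (simp add: c_def algebra_simps)
      finally have 1: "1 + (t - u)\<^sup>2 \<le> c * (1 + (t - x)\<^sup>2)" .
      have "0 < 1 + (t - x)\<^sup>2" "0 < 1 + (t - u)\<^sup>2" by (simp_all add: add_pos_nonneg)
      then show ?thesis using 1 unfolding w_def by (simp add: divide_simps)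
    qed
    have "(\<integral>\<^sup>+x. ennreal (w (t - x)) \<partial>count_space X)
        \<le> (\<integral>\<^sup>+x. (\<integral>\<^sup>+u. ennreal (c / \<delta> * w (t - u)) * indicator {x..<x + \<delta>} u \<partial>lborel) \<partial>count_space X)"
    proof (rule nn_integral_mono)
      fix x
      have "ennreal (w (t - x)) = (\<integral>\<^sup>+u. ennreal (w (t - x) / \<delta>) * indicator {x..<x + \<delta>} u \<partial>lborel)"
        using \<delta> w0 by (simp add: nn_integral_cmult flip: ennreal_mult)
      also have "\<dots> \<le> (\<integral>\<^sup>+u. ennreal (c / \<delta> * w (t - u)) * indicator {x..<x + \<delta>} u \<partial>lborel)"
        using comp \<delta> by (intro nn_integral_mono) (auto simp: indicator_def divide_right_mono intro!: ennreal_leI)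
      finally show "ennreal (w (t - x)) \<le> (\<integral>\<^sup>+u. ennreal (c / \<delta> * w (t - u)) * indicator {x..<x + \<delta>} u \<partial>lborel)" .
    qed
    also have "\<dots> = (\<integral>\<^sup>+u. (\<integral>\<^sup>+x. ennreal (c / \<delta> * w (t - u)) * indicator {x..<x + \<delta>} u \<partial>count_space X) \<partial>lborel)"
      using \<open>countable X\<close> by (intro nn_integral_count_space_nn_integral[symmetric]) auto
    also have "\<dots> \<le> (\<integral>\<^sup>+u. ennreal (c / \<delta>) * ennreal (w (t - u)) \<partial>lborel)"
    proof (rule nn_integral_mono)
      fix u :: real
      have "(\<integral>\<^sup>+x. indicator {x..<x + \<delta>} u \<partial>count_space X) \<le> (1::ennreal)"
      proof (cases "\<exists>x0\<in>X. u \<in> {x0..<x0 + \<delta>}")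
        case True
        then obtain x0 where x0: "x0 \<in> X" "u \<in> {x0..<x0 + \<delta>}" by blast
        have "x = x0" if "x \<in> X" "u \<in> {x..<x + \<delta>}" for x
          using sep[of x x0] that x0 by (cases "x = x0") auto
        then have "(\<integral>\<^sup>+x. indicator {x..<x + \<delta>} u \<partial>count_space X) \<le> (\<integral>\<^sup>+x. indicator {x0} x \<partial>count_space X)"
          by (intro nn_integral_mono) (auto simp: indicator_def)
        also have "\<dots> = 1" using x0 by simp
        finally show ?thesis .
      next
        case False
        then have "(\<integral>\<^sup>+x. indicator {x..<x + \<delta>} u \<partial>count_space X) = (\<integral>\<^sup>+x. (0::ennreal) \<partial>count_space X)"
          by (intro nn_integral_cong) (auto simp: indicator_def)
        then show ?thesis by simp
      qed
      then have "ennreal (c / \<delta> * w (t - u)) * (\<integral>\<^sup>+x. indicator {x..<x + \<delta>} u \<partial>count_space X) \<le> ennreal (c / \<delta> * w (t - u)) * 1"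
        by (intro mult_left_mono) auto
      then show "(\<integral>\<^sup>+x. ennreal (c / \<delta> * w (t - u)) * indicator {x..<x + \<delta>} u \<partial>count_space X) \<le> ennreal (c / \<delta>) * ennreal (w (t - u))"
        using ennreal_mult[of "c / \<delta>" "w (t - u)"] c \<delta> w0[of "t - u"] by (subst nn_integral_cmult) simp_all
    qed
    also have "\<dots> = ennreal (c / \<delta>) * (\<integral>\<^sup>+t. ennreal (w t) \<partial>lborel)"
      using nn_integral_inverse_square_shift[of t] by (simp add: nn_integral_cmult w_def)
    also have "\<dots> \<le> ennreal (c / \<delta>) * ennreal W" using W(2) unfolding w_def by (intro mult_left_mono) auto
    also have "\<dots> = ennreal (c / \<delta> * W)" using c \<delta> W by (intro ennreal_mult[symmetric]) auto
    finally show "(\<integral>\<^sup>+x. ennreal (1 / (1 + (t - x)\<^sup>2)) \<partial>count_space X) \<le> ennreal (c / \<delta> * W)" by (simp add: w_def)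
  qed (use c \<delta> W in simp)
qed

text \<open>
  Summing the local mean square bound over a separated set $X$ is harmless because the weights
  $1/(1 + (t - x)^2)$, $x \in X$, add up to a function of $t$ that is bounded in terms of the
  separation alone.
\<close>

lemma plancherel_polya_separated:
  assumes \<kappa>: "\<kappa> > 0" and \<delta>: "\<delta> > 0"
  obtains C :: real where "C > 0"
    "\<And>X h. countable X \<Longrightarrow> (\<And>a b. a \<in> X \<Longrightarrow> b \<in> X \<Longrightarrow> a \<noteq> b \<Longrightarrow> \<delta> \<le> \<bar>a - b\<bar>) \<Longrightarrow> band_limited \<kappa> h \<Longrightarrow>
       (\<integral>\<^sup>+x. ennreal ((cmod (h x))\<^sup>2) \<partial>count_space X) \<le> ennreal C * (\<integral>\<^sup>+t. ennreal ((cmod (h t))\<^sup>2) \<partial>lborel)"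
proof -
  obtain C where C: "C > 0" and pt: "\<And>h x. band_limited \<kappa> h \<Longrightarrow>
       ennreal ((cmod (h x))\<^sup>2) \<le> ennreal C * (\<integral>\<^sup>+t. ennreal ((cmod (h t))\<^sup>2 / (1 + (t - x)\<^sup>2)) \<partial>lborel)"
    by (rule pointwise_local_L2_bound[OF \<kappa>]) (rule that; blast)
  obtain K where K: "K > 0" and sum: "\<And>X t. countable X \<Longrightarrow> (\<And>a b. a \<in> X \<Longrightarrow> b \<in> X \<Longrightarrow> a \<noteq> b \<Longrightarrow> \<delta> \<le> \<bar>a - b\<bar>) \<Longrightarrow>
       (\<integral>\<^sup>+x. ennreal (1 / (1 + (t - x)\<^sup>2)) \<partial>count_space X) \<le> ennreal K"
    by (rule separated_inverse_square_sum[OF \<delta>]) (rule that; blast)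
  show thesis
  proof (rule that[of "C * K"])
    fix X h assume X: "countable X" and sep: "\<And>a b. a \<in> X \<Longrightarrow> b \<in> X \<Longrightarrow> a \<noteq> b \<Longrightarrow> \<delta> \<le> \<bar>a - b\<bar>"
      and h: "band_limited \<kappa> h"
    note [measurable] = band_limited_measurable[OF h]
    have "(\<integral>\<^sup>+x. ennreal ((cmod (h x))\<^sup>2) \<partial>count_space X)
       \<le> (\<integral>\<^sup>+x. ennreal C * (\<integral>\<^sup>+t. ennreal ((cmod (h t))\<^sup>2 / (1 + (t - x)\<^sup>2)) \<partial>lborel) \<partial>count_space X)"
      by (intro nn_integral_mono pt h)
    also have "\<dots> = (\<integral>\<^sup>+x. (\<integral>\<^sup>+t. ennreal C * ennreal ((cmod (h t))\<^sup>2 / (1 + (t - x)\<^sup>2)) \<partial>lborel) \<partial>count_space X)"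
      by (simp add: nn_integral_cmult)
    also have "\<dots> = (\<integral>\<^sup>+t. (\<integral>\<^sup>+x. ennreal C * ennreal ((cmod (h t))\<^sup>2 / (1 + (t - x)\<^sup>2)) \<partial>count_space X) \<partial>lborel)"
      using X by (intro nn_integral_count_space_nn_integral[symmetric]) auto
    also have "\<dots> \<le> (\<integral>\<^sup>+t. ennreal (C * K) * ennreal ((cmod (h t))\<^sup>2) \<partial>lborel)"
    proof (rule nn_integral_mono)
      fix t
      have "(\<integral>\<^sup>+x. ennreal C * ennreal ((cmod (h t))\<^sup>2 / (1 + (t - x)\<^sup>2)) \<partial>count_space X)
          = (\<integral>\<^sup>+x. (ennreal C * ennreal ((cmod (h t))\<^sup>2)) * ennreal (1 / (1 + (t - x)\<^sup>2)) \<partial>count_space X)"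
        by (simp add: mult.assoc flip: ennreal_mult)
      also have "\<dots> = (ennreal C * ennreal ((cmod (h t))\<^sup>2)) * (\<integral>\<^sup>+x. ennreal (1 / (1 + (t - x)\<^sup>2)) \<partial>count_space X)"
        by (simp add: nn_integral_cmult)
      also have "\<dots> \<le> (ennreal C * ennreal ((cmod (h t))\<^sup>2)) * ennreal K" using sum[OF X sep] by (intro mult_left_mono) auto
      also have "\<dots> = ennreal (C * K) * ennreal ((cmod (h t))\<^sup>2)" using C K by (simp add: mult_ac ennreal_mult)
      finally show "(\<integral>\<^sup>+x. ennreal C * ennreal ((cmod (h t))\<^sup>2 / (1 + (t - x)\<^sup>2)) \<partial>count_space X) \<le> ennreal (C * K) * ennreal ((cmod (h t))\<^sup>2)" .
    qed
    also have "\<dots> = ennreal (C * K) * (\<integral>\<^sup>+t. ennreal ((cmod (h t))\<^sup>2) \<partial>lborel)" by (simp add: nn_integral_cmult)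
    finally show "(\<integral>\<^sup>+x. ennreal ((cmod (h x))\<^sup>2) \<partial>count_space X) \<le> ennreal (C * K) * (\<integral>\<^sup>+t. ennreal ((cmod (h t))\<^sup>2) \<partial>lborel)" .
  qed (use C K in simp)
qed

section \<open>Folding and the toral distance\<close>

lemma fold_real_unique:
  fixes lam x m m' :: real and n n' :: int
  assumes "lam > 0" "m \<in> {- lam..<lam}" "x - m = 2 * lam * of_int n"
    "m' \<in> {- lam..<lam}" "x - m' = 2 * lam * of_int n'"
  shows "m = m'"
proof -
  have "2 * lam * of_int (n' - n) = m - m'" using assms by (simp add: algebra_simps)
  moreover have "\<bar>m - m'\<bar> < 2 * lam" using assms by auto
  ultimately have "2 * lam * \<bar>of_int (n' - n)\<bar> < 2 * lam * 1" using \<open>lam > 0\<close> by (metis abs_mult abs_of_pos mult_2 mult.right_neutral add_pos_pos)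
  then have "\<bar>of_int (n' - n) :: real\<bar> < 1" using \<open>lam > 0\<close> by simp
  then have "n' = n" by linarith
  then show ?thesis using assms by simp
qed

lemma fold_real_spec:
  assumes "lam > 0"
  shows "fold_real lam x \<in> {- lam..<lam} \<and> (\<exists>n::int. x - fold_real lam x = 2 * lam * of_int n)"
  unfolding fold_real_def
proof (rule theI')
  define n where "n = \<lfloor>(x + lam) / (2 * lam)\<rfloor>"
  have "of_int n \<le> (x + lam) / (2 * lam)" "(x + lam) / (2 * lam) < of_int n + 1" unfolding n_def by linarith+
  then have "2 * lam * of_int n \<le> x + lam" "x + lam < 2 * lam * (of_int n + 1)" using assms by (simp_all add: field_simps)
  then have "x - 2 * lam * of_int n \<in> {- lam..<lam}" by (simp add: algebra_simps)
  then have "x - 2 * lam * of_int n \<in> {- lam..<lam} \<and> (\<exists>k::int. x - (x - 2 * lam * of_int n) = 2 * lam * of_int k)"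
    by auto
  then show "\<exists>!m. m \<in> {- lam..<lam} \<and> (\<exists>n::int. x - m = 2 * lam * of_int n)"
    using fold_real_unique[OF assms] by blast
qed

lemma abs_fold_real_le:
  assumes "lam > 0" shows "\<bar>fold_real lam x\<bar> \<le> \<bar>x\<bar>"
proof (cases "x \<in> {- lam..<lam}")
  case True
  obtain n where "x - fold_real lam x = 2 * lam * of_int n" using fold_real_spec[OF assms] by blast
  then have "x = fold_real lam x"
    using fold_real_unique[OF assms True, of x 0] fold_real_spec[OF assms, of x] by force
  then show ?thesis by simp
next
  case False
  then have "lam \<le> \<bar>x\<bar>" by auto
  moreover have "\<bar>fold_real lam x\<bar> \<le> lam" using fold_real_spec[OF assms, of x] by auto
  ultimately show ?thesis by linarith
qed

lemma cmod_fold_complex_le: "lam > 0 \<Longrightarrow> cmod (fold_complex lam z) \<le> cmod z"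
  unfolding fold_complex_def cmod_def
  by (intro real_sqrt_le_mono add_mono) (simp_all add: abs_fold_real_le flip: abs_le_square_iff)

lemma fold_complex_congruent:
  assumes "lam > 0"
  obtains a b :: int where "z = fold_complex lam z + 2 * complex_of_real lam * Complex (of_int a) (of_int b)"
proof -
  obtain a b :: int where "Re z - fold_real lam (Re z) = 2 * lam * of_int a"
      "Im z - fold_real lam (Im z) = 2 * lam * of_int b"
    using fold_real_spec[OF assms] by blast
  then have "z = fold_complex lam z + 2 * complex_of_real lam * Complex (of_int a) (of_int b)"
    by (simp add: complex_eq_iff fold_complex_def)
  then show thesis by (rule that)
qed

lemma toral_dist_bdd: "bdd_below ((\<lambda>(a, b). cmod (z - w - 2 * complex_of_real lam * Complex (of_int a) (of_int b))) ` (UNIV :: (int \<times> int) set))"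
  by (intro bdd_belowI2[of _ 0]) auto

lemma toral_dist_le: "toral_dist lam z w \<le> cmod (z - w)"
proof -
  have "Complex 0 0 = 0" by (simp add: complex_eq_iff)
  then show ?thesis
    unfolding toral_dist_def using cINF_lower[OF toral_dist_bdd, of "(0, 0)" z w lam] by simp
qed

lemma toral_dist_nonneg: "toral_dist lam z w \<ge> 0"
  unfolding toral_dist_def by (intro cINF_greatest) auto

text \<open>
  The folded values differ from $z$ and $w$ by lattice points, so their toral distance is the
  distance of $z - w$ to the lattice $2 \lambda (\mathbb{Z} + i \mathbb{Z})$, whose nearest
  point is $0$ if $|z - w| < \lambda$.
\<close>

lemma le_toral_dist_fold:
  assumes lam: "lam > 0" and small: "cmod (z - w) < lam"
  shows "cmod (z - w) \<le> toral_dist lam (fold_complex lam z) (fold_complex lam w)"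
  unfolding toral_dist_def
proof (intro cINF_greatest, goal_cases)
  case (2 p)
  obtain a b where p: "p = (a, b)" by (cases p)
  obtain a1 b1 :: int where z: "z = fold_complex lam z + 2 * complex_of_real lam * Complex (of_int a1) (of_int b1)"
    using fold_complex_congruent[OF lam] by blast
  obtain a2 b2 :: int where w: "w = fold_complex lam w + 2 * complex_of_real lam * Complex (of_int a2) (of_int b2)"
    using fold_complex_congruent[OF lam] by blast
  define q where "q = z - w - 2 * complex_of_real lam * Complex (of_int (a + a1 - a2)) (of_int (b + b1 - b2))"
  have eq: "fold_complex lam z - fold_complex lam w - 2 * complex_of_real lam * Complex (of_int a) (of_int b) = q"
    unfolding q_def by (subst (2) z, subst (2) w) (simp add: complex_eq_iff algebra_simps)
  have key: "\<bar>u\<bar> \<le> \<bar>u - 2 * lam * of_int n\<bar>" if u: "\<bar>u\<bar> < lam" for u :: real and n :: int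
  proof (cases "n = 0")
    case False
    then have "1 \<le> \<bar>of_int n :: real\<bar>" by linarith
    then have "2 * lam * 1 \<le> 2 * lam * \<bar>of_int n\<bar>" using lam by (intro mult_left_mono) auto
    also have "\<dots> = \<bar>2 * lam * of_int n\<bar>" using lam by (simp add: abs_mult)
    finally show ?thesis using u by linarith
  qed simp
  have d: "\<bar>Re (z - w)\<bar> < lam" "\<bar>Im (z - w)\<bar> < lam"
    using small abs_Re_le_cmod[of "z - w"] abs_Im_le_cmod[of "z - w"] by linarith+
  have "\<bar>Re (z - w)\<bar> \<le> \<bar>Re (z - w) - 2 * lam * of_int (a + a1 - a2)\<bar>"
      "\<bar>Im (z - w)\<bar> \<le> \<bar>Im (z - w) - 2 * lam * of_int (b + b1 - b2)\<bar>"
    by (rule key[OF d(1)], rule key[OF d(2)])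
  moreover have "Re q = Re (z - w) - 2 * lam * of_int (a + a1 - a2)" "Im q = Im (z - w) - 2 * lam * of_int (b + b1 - b2)"
    by (simp_all add: q_def)
  ultimately have "\<bar>Re (z - w)\<bar> \<le> \<bar>Re q\<bar>" "\<bar>Im (z - w)\<bar> \<le> \<bar>Im q\<bar>" by simp_all
  then have "cmod (z - w) \<le> cmod q"
    unfolding cmod_def by (intro real_sqrt_le_mono add_mono) (simp_all flip: abs_le_square_iff)
  then show ?case by (simp add: p eq)
qed simp

section \<open>Separated sets of large lower density\<close>

lemma uniformly_separatedE:
  assumes "uniformly_separated X"
  obtains \<delta> where "\<delta> > 0" "\<And>a b. a \<in> X \<Longrightarrow> b \<in> X \<Longrightarrow> a \<noteq> b \<Longrightarrow> \<delta> \<le> \<bar>a - b\<bar>"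
proof -
  obtain \<delta> where d: "0 < ereal \<delta>" "ereal \<delta> < (INF x\<in>X. INF y\<in>X - {x}. ereal \<bar>x - y\<bar>)"
    using ereal_dense2 assms unfolding uniformly_separated_def by blast
  have "\<delta> \<le> \<bar>a - b\<bar>" if "a \<in> X" "b \<in> X" "a \<noteq> b" for a b
  proof -
    have "ereal \<delta> \<le> (INF x\<in>X. INF y\<in>X - {x}. ereal \<bar>x - y\<bar>)" using d(2) by simp
    also have "\<dots> \<le> (INF y\<in>X - {a}. ereal \<bar>a - y\<bar>)" using that by (intro INF_lower)
    also have "\<dots> \<le> ereal \<bar>a - b\<bar>" using that by (intro INF_lower) auto
    finally show ?thesis by simp
  qed
  then show thesis using that d(1) by simp
qed

lemma lower_Beurling_densityE:
  assumes "lower_Beurling_density X > ereal \<Omega>"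
  obtains c r0 where "c > \<Omega>" "r0 > 0"
    "\<And>r t. r \<ge> r0 \<Longrightarrow> c * (2 * r) < real (card (X \<inter> {t - r..t + r}))"
proof -
  obtain c where c: "ereal \<Omega> < ereal c" "ereal c < lower_Beurling_density X"
    using ereal_dense2[OF assms] by blast
  have "\<forall>\<^sub>F r in at_top. ereal c < (INF t::real. ereal (real (card (X \<inter> {t - r..t + r})) / (2 * r)))"
    by (rule le_Liminf_iff[THEN iffD1, OF order_refl, rule_format, OF c(2)[unfolded lower_Beurling_density_def]])
  then obtain r1 where r1: "\<And>r. r \<ge> r1 \<Longrightarrow> ereal c < (INF t::real. ereal (real (card (X \<inter> {t - r..t + r})) / (2 * r)))"
    by (auto simp: eventually_at_top_linorder)
  have "c * (2 * r) < real (card (X \<inter> {t - r..t + r}))" if r: "r \<ge> max 1 r1" for r t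
  proof -
    have "ereal c < ereal (real (card (X \<inter> {t - r..t + r})) / (2 * r))"
      using r1[of r] r by (meson INF_lower UNIV_I less_le_trans max.bounded_iff)
    then show ?thesis using r by (simp add: less_divide_eq)
  qed
  then show thesis using that[of c "max 1 r1"] c(1) by simp
qed

text \<open>
  The block length is chosen in terms of $N_0$ before the set $S$ is known: an interval of
  length $T$ has at least $(c - \Omega) T$ points more than $\Omega T$, with $c > \Omega$, and
  for large $T$ this surplus exceeds any number of deleted points.
\<close>

lemma node_blocks_avoiding:
  fixes N0 :: nat
  assumes \<Omega>: "\<Omega> > 0" and dens: "lower_Beurling_density X > ereal \<Omega>"
    and sep: "\<And>a b. a \<in> X \<Longrightarrow> b \<in> X \<Longrightarrow> a \<noteq> b \<Longrightarrow> \<delta> \<le> \<bar>a - b\<bar>"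
  obtains T m where "T > 0" "\<Omega> * T < real m"
    "\<And>S. finite S \<Longrightarrow> card S \<le> N0 \<Longrightarrow> \<exists>Y. node_blocks T m \<delta> Y \<and> \<Union>(range Y) \<subseteq> X - S"
proof -
  obtain c r0 where c: "c > \<Omega>" and r0: "r0 > 0"
    and count: "\<And>r t. r \<ge> r0 \<Longrightarrow> c * (2 * r) < real (card (X \<inter> {t - r..t + r}))"
    using lower_Beurling_densityE[OF dens] by metis
  \<comment> \<open>The surplus $(c - \Omega) 2r$ has to cover the $N_0$ deleted points, the
    right end point lost by passing to half-open blocks, and the rounding of $\Omega T$ to
    $m$.\<close>
  define r where "r = max r0 ((N0 + 3) / (2 * (c - \<Omega>)))"
  define T where "T = 2 * r"
  define m where "m = nat \<lceil>\<Omega> * T\<rceil> + 1"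
  have r: "r \<ge> r0" "r > 0" using r0 by (auto simp: r_def)
  have T: "T > 0" using r by (simp add: T_def)
  have gap: "real N0 + 3 \<le> (c - \<Omega>) * T"
  proof -
    have "(real N0 + 3) / (2 * (c - \<Omega>)) \<le> r" by (simp add: r_def)
    then show ?thesis using c by (simp add: T_def field_simps)
  qed
  have OT: "\<Omega> * T > 0" using \<Omega> T by simp
  have m: "\<Omega> * T < real m" "real m \<le> \<Omega> * T + 2" unfolding m_def using OT by linarith+
  have "\<exists>Y. node_blocks T m \<delta> Y \<and> \<Union>(range Y) \<subseteq> X - S" if S: "finite S" "card S \<le> N0" for S
  proof -
    have "\<exists>Z. Z \<subseteq> (X - S) \<inter> {T * of_int j..<T * (of_int j + 1)} \<and> finite Z \<and> card Z = m" for j :: int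
    proof -
      define t where "t = T * of_int j + r"
      define I where "I = X \<inter> {t - r..t + r}"
      have cI: "c * T < real (card I)" unfolding I_def T_def by (rule count[OF r(1)])
      have "c * T > 0" using c \<Omega> T by simp
      then have finI: "finite I" using cI by (metis card.infinite not_less_iff_gr_or_eq of_nat_0 order_less_trans)
      \<comment> \<open>The counting hypothesis is about closed intervals; removing the right
        end point makes the blocks half-open.\<close>
      define S' where "S' = insert (T * (of_int j + 1)) S"
      have S': "finite S'" "card S' \<le> N0 + 1" unfolding S'_def using S by (auto simp: card_insert_if)
      have "card I - card S' \<le> card (I - S')" by (rule diff_card_le_card_Diff[OF S'(1)])
      moreover have "real m + real N0 + 1 \<le> real (card I)"
        using cI gap m(2) by (simp add: algebra_simps)
      ultimately have "m \<le> card (I - S')" using S'(2) by linarith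
      then obtain Z where Z: "Z \<subseteq> I - S'" "card Z = m" "finite Z" by (rule obtain_subset_with_card_n)
      moreover have "I - S' \<subseteq> (X - S) \<inter> {T * of_int j..<T * (of_int j + 1)}"
        by (auto simp: I_def S'_def t_def T_def algebra_simps)
      ultimately show ?thesis by blast
    qed
    then have "\<forall>j. \<exists>Z. Z \<subseteq> (X - S) \<inter> {T * of_int j..<T * (of_int j + 1)} \<and> finite Z \<and> card Z = m" ..
    from choice[OF this] obtain Y where Y: "\<And>j::int. Y j \<subseteq> (X - S) \<inter> {T * of_int j..<T * (of_int j + 1)} \<and> finite (Y j) \<and> card (Y j) = m"
      by blast
    have sub: "\<Union>(range Y) \<subseteq> X - S" using Y by blast
    have "node_blocks T m \<delta> Y"
      unfolding node_blocks_def
    proof (intro conjI allI ballI impI)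
      show "Y j \<subseteq> {T * of_int j..<T * (of_int j + 1)}" "finite (Y j)" "card (Y j) = m" for j
        using Y[of j] by auto
      show "\<delta> \<le> \<bar>a - b\<bar>" if "a \<in> \<Union>(range Y)" "b \<in> \<Union>(range Y)" "a \<noteq> b" for a b
        using that sub by (intro sep) blast+
    qed
    with sub show ?thesis by blast
  qed
  then show thesis using that T m(1) by blast
qed

section \<open>Stability of folded sampling\<close>

lemma summable_on_iff_nn_integral_finite:
  fixes a :: "'i \<Rightarrow> real"
  assumes "\<And>k. a k \<ge> 0"
  shows "a summable_on UNIV \<longleftrightarrow> (\<integral>\<^sup>+k. ennreal (a k) \<partial>count_space UNIV) < \<infinity>"
proof -
  have "a summable_on UNIV \<longleftrightarrow> integrable (count_space UNIV) a"
    using summable_on_iff_abs_summable_on_real[of a UNIV] abs_summable_equivalent[of a UNIV]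
    by (simp add: Infinite_Set_Sum.abs_summable_on_def)
  also have "\<dots> \<longleftrightarrow> (\<integral>\<^sup>+k. ennreal (a k) \<partial>count_space UNIV) < \<infinity>"
    using assms by (simp add: integrable_iff_bounded)
  finally show ?thesis .
qed

lemma nn_integral_count_space_eq_infsum:
  fixes a :: "'i \<Rightarrow> real"
  assumes nn: "\<And>k. a k \<ge> 0" and "a summable_on UNIV"
  shows "(\<integral>\<^sup>+k. ennreal (a k) \<partial>count_space UNIV) = ennreal (\<Sum>\<^sub>\<infinity>k. a k)"
proof -
  have abs: "Infinite_Set_Sum.abs_summable_on a UNIV"
    using assms(2) summable_on_iff_abs_summable_on_real[of a UNIV] abs_summable_equivalent[of a UNIV] by blast
  then have "(\<integral>\<^sup>+k. ennreal (a k) \<partial>count_space UNIV) = ennreal (integral\<^sup>L (count_space UNIV) a)"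
    using nn by (intro nn_integral_eq_integral) (auto simp: Infinite_Set_Sum.abs_summable_on_def)
  also have "integral\<^sup>L (count_space UNIV) a = (\<Sum>\<^sub>\<infinity>k. a k)"
    using infsetsum_infsum[OF abs] by (simp add: infsetsum_def)
  finally show ?thesis .
qed

lemma nn_integral_eq_L2_norm:
  assumes "square_integrable h"
  shows "(\<integral>\<^sup>+t. ennreal ((cmod (h t))\<^sup>2) \<partial>lborel) = ennreal ((L2_norm h)\<^sup>2)"
proof -
  have "(\<integral>\<^sup>+t. ennreal ((cmod (h t))\<^sup>2) \<partial>lborel) = ennreal (LINT t|lborel. (cmod (h t))\<^sup>2)"
    using assms by (intro nn_integral_eq_integral) (auto simp: square_integrable_def)
  then show ?thesis by (simp add: L2_norm_def)
qed

lemma L2_norm_nonneg: "L2_norm h \<ge> 0"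
  by (simp add: L2_norm_def)

lemma square_integrable_diff:
  assumes f: "square_integrable f" and g: "square_integrable g"
  shows "square_integrable (\<lambda>t. f t - g t)"
    and "(L2_norm (\<lambda>t. f t - g t))\<^sup>2 \<le> 2 * (L2_norm f)\<^sup>2 + 2 * (L2_norm g)\<^sup>2"
proof -
  have m: "f \<in> borel_measurable lborel" "g \<in> borel_measurable lborel"
    and i: "integrable lborel (\<lambda>t. (cmod (f t))\<^sup>2)" "integrable lborel (\<lambda>t. (cmod (g t))\<^sup>2)"
    using f g by (auto simp: square_integrable_def)
  have le: "(cmod (f t - g t))\<^sup>2 \<le> 2 * (cmod (f t))\<^sup>2 + 2 * (cmod (g t))\<^sup>2" for t
  proof -
    have "(cmod (f t - g t))\<^sup>2 \<le> (cmod (f t) + cmod (g t))\<^sup>2"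
      by (intro power_mono norm_triangle_ineq4) auto
    also have "\<dots> \<le> 2 * (cmod (f t))\<^sup>2 + 2 * (cmod (g t))\<^sup>2"
      using sum_squares_bound[of "cmod (f t)" "cmod (g t)"] by (simp add: power2_sum)
    finally show ?thesis .
  qed
  have i2: "integrable lborel (\<lambda>t. 2 * (cmod (f t))\<^sup>2 + 2 * (cmod (g t))\<^sup>2)" using i by simp
  have i3: "integrable lborel (\<lambda>t. (cmod (f t - g t))\<^sup>2)"
    using i2 by (rule Bochner_Integration.integrable_bound) (use m le in \<open>auto simp: abs_of_nonneg\<close>)
  then show "square_integrable (\<lambda>t. f t - g t)" using m by (simp add: square_integrable_def)
  have "(LINT t|lborel. (cmod (f t - g t))\<^sup>2) \<le> (LINT t|lborel. 2 * (cmod (f t))\<^sup>2 + 2 * (cmod (g t))\<^sup>2)"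
    by (intro integral_mono i3 i2 le)
  then show "(L2_norm (\<lambda>t. f t - g t))\<^sup>2 \<le> 2 * (L2_norm f)\<^sup>2 + 2 * (L2_norm g)\<^sup>2"
    using i by (simp add: L2_norm_def)
qed

lemma PW_band_limited:
  assumes "f \<in> PW \<Omega>" "\<Omega> > 0"
  shows "band_limited (pi * \<Omega>) f" "square_integrable f"
proof -
  obtain E A where "exp_type_bound (pi * \<Omega>) A E" "\<And>t::real. E (of_real t) = f t"
    using PW_imp_entire[OF assms] by metis
  then show "band_limited (pi * \<Omega>) f" by (auto simp: band_limited_def)
  show "square_integrable f" using assms by (simp add: PW_def)
qed

lemma folded_sampling_in_ell2_torus:
  assumes lam: "lam > 0" and sq: "(\<lambda>k. (cmod (f (x k)))\<^sup>2) summable_on UNIV"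
  shows "folded_sampling lam x f \<in> ell2_torus lam"
proof -
  have "(\<lambda>k. (cmod (folded_sampling lam x f k))\<^sup>2) summable_on UNIV"
    using sq by (rule summable_on_comparison_test)
      (use lam in \<open>auto simp: folded_sampling_def intro!: power_mono cmod_fold_complex_le\<close>)
  moreover have "Re (folded_sampling lam x f k) \<in> {- lam..<lam} \<and> Im (folded_sampling lam x f k) \<in> {- lam..<lam}" for k
    using fold_real_spec[OF lam] by (simp add: folded_sampling_def fold_complex_def)
  ultimately show ?thesis by (simp add: ell2_torus_def)
qed

text \<open>
  Chebyshev's inequality for sums. The bound on the cardinality is the reason why the
  Lipschitz constant is uniform on bounded sets.
\<close>

lemma finitely_many_large_values:
  fixes a :: "'i \<Rightarrow> real"
  assumes M: "(\<integral>\<^sup>+k. ennreal ((a k)\<^sup>2) \<partial>count_space UNIV) \<le> ennreal M" and "M \<ge> 0"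
    and lam: "lam > 0" and a: "\<And>k. a k \<ge> 0"
  shows "finite {k. lam \<le> a k}" and "card {k. lam \<le> a k} \<le> nat \<lceil>M / lam\<^sup>2\<rceil>"
proof -
  define K where "K = {k. lam \<le> a k}"
  have "ennreal (lam\<^sup>2) * emeasure (count_space UNIV) K = (\<integral>\<^sup>+k. ennreal (lam\<^sup>2) * indicator K k \<partial>count_space UNIV)"
    by (simp add: nn_integral_cmult)
  also have "\<dots> \<le> (\<integral>\<^sup>+k. ennreal ((a k)\<^sup>2) \<partial>count_space UNIV)"
    using lam by (intro nn_integral_mono) (auto simp: indicator_def K_def intro!: ennreal_leI power_mono)
  also note M
  finally have le: "ennreal (lam\<^sup>2) * emeasure (count_space UNIV) K \<le> ennreal M" .
  have fin: "finite K"
  proof (rule ccontr)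
    assume "infinite K"
    then have "ennreal (lam\<^sup>2) * emeasure (count_space UNIV) K = \<infinity>" using lam by (simp add: ennreal_mult_top)
    then show False using le by (simp add: top_unique)
  qed
  then have "ennreal (lam\<^sup>2 * real (card K)) \<le> ennreal M"
    using le by (simp add: ennreal_mult ennreal_of_nat_eq_real_of_nat)
  then have "lam\<^sup>2 * real (card K) \<le> M" using \<open>M \<ge> 0\<close> by simp
  then have "real (card K) \<le> M / lam\<^sup>2" using lam by (simp add: field_simps)
  then have "card K \<le> nat \<lceil>M / lam\<^sup>2\<rceil>" by linarith
  with fin show "finite {k. lam \<le> a k}" "card {k. lam \<le> a k} \<le> nat \<lceil>M / lam\<^sup>2\<rceil>" by (simp_all add: K_def)
qed

lemma nn_integral_count_space_mono_set:
  fixes u :: "'i \<Rightarrow> ennreal"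
  assumes "A \<subseteq> B"
  shows "(\<integral>\<^sup>+y. u y \<partial>count_space A) \<le> (\<integral>\<^sup>+y. u y \<partial>count_space B)"
proof -
  have "(\<integral>\<^sup>+y. u y \<partial>count_space A) = (\<integral>\<^sup>+y. u y * indicator A y \<partial>count_space UNIV)"
    by (rule nn_integral_count_space_indicator) simp
  also have "\<dots> \<le> (\<integral>\<^sup>+y. u y * indicator B y \<partial>count_space UNIV)"
    using assms by (intro nn_integral_mono) (auto simp: indicator_def)
  also have "\<dots> = (\<integral>\<^sup>+y. u y \<partial>count_space B)"
    by (rule nn_integral_count_space_indicator[symmetric]) simp
  finally show ?thesis .
qed

lemma PW_samples_square_summable:
  assumes f: "f \<in> PW \<Omega>" and \<Omega>: "\<Omega> > 0" and inj: "inj x" and sep: "uniformly_separated (range x)"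
  shows "(\<lambda>k::int. (cmod (f (x k)))\<^sup>2) summable_on UNIV"
proof -
  obtain \<delta> where \<delta>: "\<delta> > 0" and sepd: "\<And>a b. a \<in> range x \<Longrightarrow> b \<in> range x \<Longrightarrow> a \<noteq> b \<Longrightarrow> \<delta> \<le> \<bar>a - b\<bar>"
    using uniformly_separatedE[OF sep] by metis
  have \<kappa>: "pi * \<Omega> > 0" using \<Omega> by simp
  obtain B where B: "B > 0" and bessel: "\<And>X h. countable X \<Longrightarrow> (\<And>a b. a \<in> X \<Longrightarrow> b \<in> X \<Longrightarrow> a \<noteq> b \<Longrightarrow> \<delta> \<le> \<bar>a - b\<bar>) \<Longrightarrow> band_limited (pi * \<Omega>) h \<Longrightarrow>
       (\<integral>\<^sup>+x. ennreal ((cmod (h x))\<^sup>2) \<partial>count_space X) \<le> ennreal B * (\<integral>\<^sup>+t. ennreal ((cmod (h t))\<^sup>2) \<partial>lborel)"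
    by (rule plancherel_polya_separated[OF \<kappa> \<delta>]) (rule that; blast)
  have "(\<integral>\<^sup>+k. ennreal ((cmod (f (x k)))\<^sup>2) \<partial>count_space UNIV) = (\<integral>\<^sup>+y. ennreal ((cmod (f y))\<^sup>2) \<partial>count_space (range x))"
    using inj by (intro nn_integral_bij_count_space inj_on_imp_bij_betw)
  also have "\<dots> \<le> ennreal B * ennreal ((L2_norm f)\<^sup>2)"
    using bessel[OF _ sepd PW_band_limited(1)[OF f \<Omega>]]
    unfolding nn_integral_eq_L2_norm[OF PW_band_limited(2)[OF f \<Omega>]] by simp
  also have "\<dots> < \<infinity>" by (simp add: ennreal_mult_less_top)
  finally show ?thesis by (subst summable_on_iff_nn_integral_finite) auto
qed

text \<open>
  Large differences occur at no more than $N_0$ samples, so a system of blocks that avoids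
  them sees only the samples where folding preserves distances.
\<close>

lemma folded_sampling_lower_bound:
  fixes \<Omega> lam R :: real and x :: "int \<Rightarrow> real"
  assumes \<Omega>: "\<Omega> > 0" and lam: "lam > 0" and inj: "inj x"
    and sep: "uniformly_separated (range x)"
    and dens: "lower_Beurling_density (range x) > ereal \<Omega>"
  obtains C where "C > 0"
    "\<And>f g. f \<in> PW \<Omega> \<Longrightarrow> g \<in> PW \<Omega> \<Longrightarrow> L2_norm f \<le> R \<Longrightarrow> L2_norm g \<le> R \<Longrightarrow>
      L2_norm (\<lambda>t. f t - g t) \<le> C * ell2_torus_dist lam (folded_sampling lam x f) (folded_sampling lam x g)"
proof -
  obtain \<delta> where \<delta>: "\<delta> > 0" and sepd: "\<And>a b. a \<in> range x \<Longrightarrow> b \<in> range x \<Longrightarrow> a \<noteq> b \<Longrightarrow> \<delta> \<le> \<bar>a - b\<bar>"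
    using uniformly_separatedE[OF sep] by metis
  have \<kappa>: "pi * \<Omega> > 0" using \<Omega> by simp
  obtain B where B: "B > 0" and bessel: "\<And>X h. countable X \<Longrightarrow> (\<And>a b. a \<in> X \<Longrightarrow> b \<in> X \<Longrightarrow> a \<noteq> b \<Longrightarrow> \<delta> \<le> \<bar>a - b\<bar>) \<Longrightarrow> band_limited (pi * \<Omega>) h \<Longrightarrow>
       (\<integral>\<^sup>+x. ennreal ((cmod (h x))\<^sup>2) \<partial>count_space X) \<le> ennreal B * (\<integral>\<^sup>+t. ennreal ((cmod (h t))\<^sup>2) \<partial>lborel)"
    by (rule plancherel_polya_separated[OF \<kappa> \<delta>]) (rule that; blast)
  define M where "M = B * (4 * R\<^sup>2)"
  have M: "M \<ge> 0" unfolding M_def using B by simp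
  define N0 where "N0 = nat \<lceil>M / lam\<^sup>2\<rceil>"
  obtain T m where T: "T > 0" "\<Omega> * T < real m"
    and avoid: "\<And>S. finite S \<Longrightarrow> card S \<le> N0 \<Longrightarrow> \<exists>Y. node_blocks T m \<delta> Y \<and> \<Union>(range Y) \<subseteq> range x - S"
    by (rule node_blocks_avoiding[OF \<Omega> dens, of \<delta> N0]) ((rule sepd; assumption), (rule that; blast))
  have Tm: "pi * \<Omega> * T < pi * real m" using T(2) by (simp add: mult.assoc)
  obtain A where A: "A > 0" and samp: "\<And>Y h. node_blocks T m \<delta> Y \<Longrightarrow> band_limited (pi * \<Omega>) h \<Longrightarrow>
       (\<integral>\<^sup>+x. ennreal ((cmod (h x))\<^sup>2) \<partial>lborel) \<le> ennreal A * (\<integral>\<^sup>+y. ennreal ((cmod (h y))\<^sup>2) \<partial>count_space (\<Union>(range Y)))"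
    by (rule norm_sampling[OF T(1) \<delta> less_imp_le[OF \<kappa>] Tm]) (rule that; blast)
  show thesis
  proof (rule that[of "sqrt A"])
    fix f g assume f: "f \<in> PW \<Omega>" "L2_norm f \<le> R" and g: "g \<in> PW \<Omega>" "L2_norm g \<le> R"
    define h where "h = (\<lambda>t. f t - g t)"
    have bl: "band_limited (pi * \<Omega>) h" unfolding h_def
      by (intro band_limited_diff PW_band_limited f g \<Omega>)
    note fg = PW_band_limited(2)[OF f(1) \<Omega>] PW_band_limited(2)[OF g(1) \<Omega>]
    have sqh: "square_integrable h" unfolding h_def by (intro square_integrable_diff fg)
    have "(L2_norm f)\<^sup>2 \<le> R\<^sup>2" "(L2_norm g)\<^sup>2 \<le> R\<^sup>2" using f g by (auto intro!: power_mono L2_norm_nonneg)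
    then have h4: "(L2_norm h)\<^sup>2 \<le> 4 * R\<^sup>2" using square_integrable_diff(2)[OF fg] unfolding h_def by linarith
    have reindex: "(\<integral>\<^sup>+k. ennreal ((cmod (h (x k)))\<^sup>2) \<partial>count_space K) = (\<integral>\<^sup>+y. ennreal ((cmod (h y))\<^sup>2) \<partial>count_space (x ` K))" for K
      using inj by (intro nn_integral_bij_count_space inj_on_imp_bij_betw) (auto intro: inj_on_subset)
    have "(\<integral>\<^sup>+k. ennreal ((cmod (h (x k)))\<^sup>2) \<partial>count_space UNIV) \<le> ennreal B * ennreal ((L2_norm h)\<^sup>2)"
      using bessel[OF _ sepd bl] unfolding reindex nn_integral_eq_L2_norm[OF sqh] by simp
    also have "\<dots> \<le> ennreal M" unfolding M_def using B h4 by (simp add: ennreal_leI flip: ennreal_mult)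
    finally have sumM: "(\<integral>\<^sup>+k. ennreal ((cmod (h (x k)))\<^sup>2) \<partial>count_space UNIV) \<le> ennreal M" .
    define K where "K = {k. lam \<le> cmod (h (x k))}"
    have K: "finite K" "card K \<le> N0"
      using finitely_many_large_values[OF sumM M lam] unfolding K_def N0_def by auto
    define d where "d = (\<lambda>k. toral_dist lam (folded_sampling lam x f k) (folded_sampling lam x g k))"
    have dle: "(cmod (h (x k)))\<^sup>2 \<le> (d k)\<^sup>2" if "k \<notin> K" for k
      using le_toral_dist_fold[OF lam, of "f (x k)" "g (x k)"] that
      by (intro power_mono) (auto simp: K_def h_def d_def folded_sampling_def)
    have d_sum: "(\<lambda>k. (d k)\<^sup>2) summable_on UNIV"
    proof (rule summable_on_comparison_test)
      show "(\<lambda>k. 2 * (cmod (f (x k)))\<^sup>2 + 2 * (cmod (g (x k)))\<^sup>2) summable_on UNIV"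
        by (intro summable_on_add summable_on_cmult_right PW_samples_square_summable[OF _ \<Omega> inj sep] f g)
      show "(d k)\<^sup>2 \<le> 2 * (cmod (f (x k)))\<^sup>2 + 2 * (cmod (g (x k)))\<^sup>2" for k
      proof -
        have "d k \<le> cmod (fold_complex lam (f (x k)) - fold_complex lam (g (x k)))"
          unfolding d_def folded_sampling_def by (rule toral_dist_le)
        also have "\<dots> \<le> cmod (fold_complex lam (f (x k))) + cmod (fold_complex lam (g (x k)))"
          by (rule norm_triangle_ineq4)
        also have "\<dots> \<le> cmod (f (x k)) + cmod (g (x k))"
          by (intro add_mono cmod_fold_complex_le lam)
        finally have "(d k)\<^sup>2 \<le> (cmod (f (x k)) + cmod (g (x k)))\<^sup>2"
          by (intro power_mono) (auto simp: d_def toral_dist_nonneg)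
        also have "\<dots> \<le> 2 * (cmod (f (x k)))\<^sup>2 + 2 * (cmod (g (x k)))\<^sup>2"
          using sum_squares_bound[of "cmod (f (x k))" "cmod (g (x k))"] by (simp add: power2_sum)
        finally show ?thesis .
      qed
    qed simp
    obtain Y where Y: "node_blocks T m \<delta> Y" "\<Union>(range Y) \<subseteq> range x - x ` K"
      using avoid[of "x ` K"] K card_image_le[OF K(1), of x] by (meson finite_imageI le_trans)
    have Ysub: "\<Union>(range Y) \<subseteq> x ` (- K)" using Y(2) by blast
    have "ennreal ((L2_norm h)\<^sup>2) \<le> ennreal A * (\<integral>\<^sup>+y. ennreal ((cmod (h y))\<^sup>2) \<partial>count_space (\<Union>(range Y)))"
      using samp[OF Y(1) bl] unfolding nn_integral_eq_L2_norm[OF sqh] .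
    also have "(\<integral>\<^sup>+y. ennreal ((cmod (h y))\<^sup>2) \<partial>count_space (\<Union>(range Y))) \<le> (\<integral>\<^sup>+y. ennreal ((cmod (h y))\<^sup>2) \<partial>count_space (x ` (- K)))"
      using Ysub by (intro nn_integral_count_space_mono_set)
    also have "\<dots> = (\<integral>\<^sup>+k. ennreal ((cmod (h (x k)))\<^sup>2) \<partial>count_space (- K))" by (rule reindex[symmetric])
    also have "\<dots> \<le> (\<integral>\<^sup>+k. ennreal ((d k)\<^sup>2) \<partial>count_space (- K))"
      using dle by (intro nn_integral_mono ennreal_leI) auto
    also have "\<dots> \<le> (\<integral>\<^sup>+k. ennreal ((d k)\<^sup>2) \<partial>count_space UNIV)"
      by (intro nn_integral_count_space_mono_set) simp
    also have "\<dots> = ennreal (\<Sum>\<^sub>\<infinity>k. (d k)\<^sup>2)"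
      using d_sum by (intro nn_integral_count_space_eq_infsum) auto
    finally have "ennreal ((L2_norm h)\<^sup>2) \<le> ennreal (A * (\<Sum>\<^sub>\<infinity>k. (d k)\<^sup>2))"
      using A by (simp add: ennreal_mult infsum_nonneg mult_left_mono)
    then have "(L2_norm h)\<^sup>2 \<le> A * (\<Sum>\<^sub>\<infinity>k. (d k)\<^sup>2)"
      using A by (subst (asm) ennreal_le_iff) (auto intro!: mult_nonneg_nonneg infsum_nonneg)
    then have "L2_norm h \<le> sqrt (A * (\<Sum>\<^sub>\<infinity>k. (d k)\<^sup>2))" by (rule real_le_rsqrt)
    then show "L2_norm (\<lambda>t. f t - g t) \<le> sqrt A * ell2_torus_dist lam (folded_sampling lam x f) (folded_sampling lam x g)"
      by (simp add: h_def d_def ell2_torus_dist_def real_sqrt_mult)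
  qed (use A in simp)
qed

lemma PW_eqI:
  assumes f: "f \<in> PW \<Omega>" and g: "g \<in> PW \<Omega>" and \<Omega>: "\<Omega> > 0" and zero: "L2_norm (\<lambda>t. f t - g t) \<le> 0"
  shows "f = g"
proof
  fix x
  have \<kappa>: "pi * \<Omega> > 0" using \<Omega> by simp
  define h where "h = (\<lambda>t. f t - g t)"
  have bl: "band_limited (pi * \<Omega>) h" unfolding h_def by (intro band_limited_diff PW_band_limited f g \<Omega>)
  have sq: "square_integrable h" unfolding h_def by (intro square_integrable_diff PW_band_limited(2)[OF _ \<Omega>] f g)
  obtain C where C: "C > 0" and pt: "\<And>h x. band_limited (pi * \<Omega>) h \<Longrightarrow>
       ennreal ((cmod (h x))\<^sup>2) \<le> ennreal C * (\<integral>\<^sup>+t. ennreal ((cmod (h t))\<^sup>2 / (1 + (t - x)\<^sup>2)) \<partial>lborel)"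
    by (rule pointwise_local_L2_bound[OF \<kappa>]) (rule that; blast)
  have "L2_norm h = 0" using zero L2_norm_nonneg[of h] unfolding h_def by linarith
  have "(cmod (h t))\<^sup>2 / (1 + (t - x)\<^sup>2) \<le> (cmod (h t))\<^sup>2" for t
    by (simp add: divide_le_eq add_pos_nonneg mult_le_cancel_left1)
  then have "(\<integral>\<^sup>+t. ennreal ((cmod (h t))\<^sup>2 / (1 + (t - x)\<^sup>2)) \<partial>lborel) \<le> (\<integral>\<^sup>+t. ennreal ((cmod (h t))\<^sup>2) \<partial>lborel)"
    by (intro nn_integral_mono ennreal_leI)
  also have "\<dots> = 0" using \<open>L2_norm h = 0\<close> by (simp add: nn_integral_eq_L2_norm[OF sq])
  finally have "ennreal ((cmod (h x))\<^sup>2) \<le> 0" using pt[OF bl, of x] by simp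
  then show "f x = g x" by (simp add: h_def)
qed

theorem theorem2p2:
  fixes \<Omega> lam :: real and x :: "int \<Rightarrow> real" and B :: "(real \<Rightarrow> complex) set"
  assumes "\<Omega> > 0" and "lam > 0"
    and "inj x"
    and "uniformly_separated (range x)"
    and "lower_Beurling_density (range x) > ereal \<Omega>"
    and "B \<subseteq> PW \<Omega>"
    and "\<exists>R. \<forall>f\<in>B. L2_norm f \<le> R"
  shows "folded_sampling lam x \<in> PW \<Omega> \<rightarrow> ell2_torus lam \<and>
    (\<exists>C>0.
      (\<exists>L. (\<forall>f\<in>B. L (folded_sampling lam x f) = f) \<and>
           (\<forall>a\<in>folded_sampling lam x ` B. \<forall>b\<in>folded_sampling lam x ` B.
              L2_norm (\<lambda>t. L a t - L b t) \<le> C * ell2_torus_dist lam a b)) \<and>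
      (\<forall>f\<in>B. \<forall>g\<in>B. L2_norm (\<lambda>t. f t - g t)
         \<le> C * ell2_torus_dist lam (folded_sampling lam x f) (folded_sampling lam x g)))"
proof (intro conjI)
  show "folded_sampling lam x \<in> PW \<Omega> \<rightarrow> ell2_torus lam"
    using assms(1-4) by (intro Pi_I folded_sampling_in_ell2_torus PW_samples_square_summable)
  obtain R where R: "\<And>f. f \<in> B \<Longrightarrow> L2_norm f \<le> R" using assms(7) by blast
  obtain C where C: "C > 0" and low:
    "\<And>f g. f \<in> PW \<Omega> \<Longrightarrow> g \<in> PW \<Omega> \<Longrightarrow> L2_norm f \<le> R \<Longrightarrow> L2_norm g \<le> R \<Longrightarrow>
      L2_norm (\<lambda>t. f t - g t) \<le> C * ell2_torus_dist lam (folded_sampling lam x f) (folded_sampling lam x g)"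
    by (rule folded_sampling_lower_bound[OF assms(1-5), of R]) (rule that; blast)
  have lip: "L2_norm (\<lambda>t. f t - g t) \<le> C * ell2_torus_dist lam (folded_sampling lam x f) (folded_sampling lam x g)"
    if "f \<in> B" "g \<in> B" for f g using that assms(6) R by (intro low) auto
  have self: "ell2_torus_dist lam a a = 0" for a
  proof -
    have "toral_dist lam z z = 0" for z using toral_dist_le[of lam z z] toral_dist_nonneg[of lam z z] by simp
    then show ?thesis by (simp add: ell2_torus_dist_def)
  qed
  have inj: "inj_on (folded_sampling lam x) B"
  proof (rule inj_onI)
    fix f g assume fg: "f \<in> B" "g \<in> B" "folded_sampling lam x f = folded_sampling lam x g"
    then have "L2_norm (\<lambda>t. f t - g t) \<le> 0" using lip[OF fg(1,2)] by (simp add: self)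
    then show "f = g" using fg assms(1,6) by (intro PW_eqI[of f \<Omega> g]) auto
  qed
  define L where "L = the_inv_into B (folded_sampling lam x)"
  have L: "L (folded_sampling lam x f) = f" if "f \<in> B" for f
    unfolding L_def by (rule the_inv_into_f_f[OF inj that])
  show "\<exists>C>0. (\<exists>L. (\<forall>f\<in>B. L (folded_sampling lam x f) = f) \<and>
           (\<forall>a\<in>folded_sampling lam x ` B. \<forall>b\<in>folded_sampling lam x ` B.
              L2_norm (\<lambda>t. L a t - L b t) \<le> C * ell2_torus_dist lam a b)) \<and>
      (\<forall>f\<in>B. \<forall>g\<in>B. L2_norm (\<lambda>t. f t - g t)
         \<le> C * ell2_torus_dist lam (folded_sampling lam x f) (folded_sampling lam x g))"
    using C L lip by (intro exI[of _ C] conjI exI[of _ L]) auto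
qed

end
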